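(* Let $e=(1,0,0)\in\mathbb{R}^3$ and let $T>1$. Let $q_1,q_2\in C^{3}(\mathbb{R}^{3})$ be real-valued functions such that, for $i=1,2$, $q_{i}(x)=a_{i}(|x|+|x-e|)$ for all $x\in\mathbb{R}^3$, for some $C^{3}$ functions $a_{1},a_2$ on $(1-\epsilon,\infty)$ and some $0<\epsilon<1$. For $i=1,2$ let $u_{i}(x,t)$ be the solution to the initial value problem $$(\Box-q_{i}(x))u_{i}(x,t)=\delta(x,t),\quad (x,t)\in\mathbb{R}^{3}\times\mathbb{R},\qquad u_{i}(x,t)|_{t<0}=0,\quad x\in\mathbb{R}^{3}.$$ If $u_{1}(e,t)=u_{2}(e,t)$ for all $t\in[0,T]$, then $q_{1}(x)=q_{2}(x)$ for all $x\in\mathbb{R}^3$ with $|e-x|+|x|\leq T$.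
   Context: $\Box=\partial_t^2-\Delta_x$ is the wave operator on $\mathbb{R}^3\times\mathbb{R}$, and $\delta(x,t)$ is the Dirac distribution at the origin of $\mathbb{R}^3\times\mathbb{R}$. For real-valued $q\in C^3(\mathbb{R}^3)$, the (distributional) solution of $(\Box-q(x))u=\delta(x,t)$, $u|_{t<0}=0$, is given by $$u(x,t)=\frac{\delta(t-|x|)}{4\pi|x|}+v(x,t),$$ where $v(x,t)=0$ for $t<|x|$ and, in the region $t>|x|$, $v$ is a $C^2$ solution of the characteristic boundary value (Goursat) problem $(\Box-q(x))v(x,t)=0$ for $t>|x|$, $v(x,|x|)=\frac{1}{8\pi}\int_0^1 q(sx)\,ds$ (the boundary value being attained as the limit from $t>|x|$). Writing $u_i=\frac{\delta(t-|x|)}{4\pi|x|}+v_i$ for $q=q_i$, the singular terms of $u_1$ and $u_2$ coincide, so the condition $u_1(e,t)=u_2(e,t)$ for $t\in[0,T]$ means $v_1(e,t)=v_2(e,t)$ for $t\in[0,T]$ (both vanish for $t<1$). *)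

theory Defs
  imports "HOL-Analysis.Analysis"
begin

type_synonym space = "real^3"
type_synonym spacetime = "space \<times> real"

definition dir_deriv :: "'a::euclidean_space \<Rightarrow> ('a \<Rightarrow> real) \<Rightarrow> 'a \<Rightarrow> real" where
  "dir_deriv b f x = frechet_derivative f (at x) b"

text \<open>Only meaningful for open \<open>S\<close>, since derivatives are taken in the whole space.\<close>

fun Ck_on :: "nat \<Rightarrow> ('a::euclidean_space \<Rightarrow> real) \<Rightarrow> 'a set \<Rightarrow> bool" where
  "Ck_on 0 f S \<longleftrightarrow> continuous_on S f"
| "Ck_on (Suc k) f S \<longleftrightarrow>
     (\<forall>x\<in>S. f differentiable (at x)) \<and> (\<forall>b\<in>Basis. Ck_on k (dir_deriv b f) S)"

definition dt :: "(spacetime \<Rightarrow> real) \<Rightarrow> spacetime \<Rightarrow> real" where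
  "dt = dir_deriv (0, 1)"

definition laplacian_x :: "(spacetime \<Rightarrow> real) \<Rightarrow> spacetime \<Rightarrow> real" where
  "laplacian_x f p = (\<Sum>b\<in>Basis. dir_deriv (b, 0) (dir_deriv (b, 0) f) p)"

definition wave_op :: "(spacetime \<Rightarrow> real) \<Rightarrow> spacetime \<Rightarrow> real" where
  "wave_op f p = dt (dt f) p - laplacian_x f p"

definition Cc :: "(spacetime \<Rightarrow> real) set" where
  "Cc = {\<phi>. continuous_on UNIV \<phi> \<and> compact (closure (support_on UNIV \<phi>))}"

definition test_functions :: "(spacetime \<Rightarrow> real) set" where
  "test_functions = {\<phi>\<in>Cc. \<forall>k. Ck_on k \<phi> UNIV}"

text \<open>
  Distributions of order 0 on space-time, that is, real Radon measures viewed as functionals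
  on \<open>Cc\<close>. The coefficient \<open>q\<close> is merely of class \<open>C\<^sup>3\<close>, so the product of \<open>q\<close> with a
  distribution is not defined for arbitrary distributions; for those of order 0 it is
  \<open>\<langle>q u, \<phi>\<rangle> = \<langle>u, q \<phi>\<rangle>\<close>. Values outside \<open>Cc\<close> are irrelevant.
\<close>

type_synonym functional = "(spacetime \<Rightarrow> real) \<Rightarrow> real"

definition distribution0 :: "functional \<Rightarrow> bool" where
  "distribution0 u \<longleftrightarrow>
     (\<forall>\<phi>\<in>Cc. \<forall>\<psi>\<in>Cc. u (\<lambda>p. \<phi> p + \<psi> p) = u \<phi> + u \<psi>) \<and>
     (\<forall>\<phi>\<in>Cc. \<forall>c. u (\<lambda>p. c * \<phi> p) = c * u \<phi>) \<and>
     (\<forall>K. compact K \<longrightarrow>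
        (\<exists>C. \<forall>\<phi>\<in>Cc. closure (support_on UNIV \<phi>) \<subseteq> K \<longrightarrow> \<bar>u \<phi>\<bar> \<le> C * (SUP p. \<bar>\<phi> p\<bar>)))"

text \<open>
  \<open>(\<box> - q) u = \<delta>(x,t)\<close> in the sense of distributions (the wave operator is formally
  self-adjoint), and \<open>u = 0\<close> on the open half-space \<open>t < 0\<close>.
\<close>

definition point_source_solution :: "(space \<Rightarrow> real) \<Rightarrow> functional \<Rightarrow> bool" where
  "point_source_solution q u \<longleftrightarrow>
     distribution0 u \<and>
     (\<forall>\<phi>\<in>test_functions. u (\<lambda>(x, t). wave_op \<phi> (x, t) - q x * \<phi> (x, t)) = \<phi> (0, 0)) \<and>
     (\<forall>\<phi>\<in>test_functions. closure (support_on UNIV \<phi>) \<subseteq> {(x, t). t < 0} \<longrightarrow> u \<phi> = 0)"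

text \<open>The distribution \<open>\<delta>(t - |x|) / (4 \<pi> |x|)\<close>.\<close>

definition singular_part :: functional where
  "singular_part \<phi> = (\<integral>x. \<phi> (x, norm x) / (4 * pi * norm x) \<partial>(lborel :: space measure))"

text \<open>
  The characteristic (Goursat) problem for the regular part. The datum on the cone is
  prescribed both as the value of \<open>v\<close> there and as its limit from inside the cone.
\<close>

definition goursat_solution :: "(space \<Rightarrow> real) \<Rightarrow> (spacetime \<Rightarrow> real) \<Rightarrow> bool" where
  "goursat_solution q v \<longleftrightarrow>
     (\<forall>x t. t < norm x \<longrightarrow> v (x, t) = 0) \<and>
     Ck_on 2 v {(x, t). norm x < t} \<and>
     (\<forall>x t. norm x < t \<longrightarrow> wave_op v (x, t) - q x * v (x, t) = 0) \<and>
     (\<forall>x. v (x, norm x) = 1 / (8 * pi) * integral {0..1} (\<lambda>s. q (s *\<^sub>R x)) \<and>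
          (v \<longlongrightarrow> v (x, norm x)) (at (x, norm x) within {(y, s). norm y < s}))"

text \<open>
  \<open>u = \<delta>(t - |x|) / (4 \<pi> |x|) + v\<close>. Since the singular term does not depend on \<open>q\<close>, the
  pointwise comparison of two such solutions \<open>u\<close> is that of their regular parts \<open>v\<close>.
\<close>

definition regular_part :: "(space \<Rightarrow> real) \<Rightarrow> functional \<Rightarrow> (spacetime \<Rightarrow> real) \<Rightarrow> bool" where
  "regular_part q u v \<longleftrightarrow>
     goursat_solution q v \<and>
     (\<forall>\<phi>\<in>Cc. u \<phi> = singular_part \<phi> + (\<integral>p. v p * \<phi> p \<partial>lborel))"

end

theory Submission
  imports Defs
begin

text \<open>
  Since \<open>|x| + |x - e|\<close> is invariant under \<open>x \<mapsto> e - x\<close>, so is \<open>q\<^sub>2\<close>, and \<open>u\<^sub>2 (e - x, t)\<close> is the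
  solution with source at \<open>e\<close>. Testing the equation of \<open>u\<^sub>1\<close> with the convolution of \<open>u\<^sub>2\<close> with
  \<open>\<beta>\<^sub>n (x - e) \<psi> t\<close>, where \<open>\<beta>\<^sub>n\<close> is a mollifier in space, and letting \<open>n\<close> tend to infinity gives
  \<open>\<integral> (q\<^sub>2 - q\<^sub>1) x (\<integral>\<integral> \<psi> (t + s) u\<^sub>1 (x, dt) u\<^sub>2 (e - x, ds)) dx = 0\<close> for all smooth \<open>\<psi>\<close> supported below
  \<open>T\<close>. With \<open>w = |x| + |x - e|\<close>, the inner integral is
  \<open>\<psi> w / (16 \<pi>\<^sup>2 |x| |x - e|)\<close> plus a term that involves only the values of \<open>\<psi>\<close> beyond \<open>w\<close> and is
  bounded by \<open>(C/c) exp (- c w) / (|x| |x - e|)\<close> when \<open>|\<psi> t| \<le> 2 exp (- c t)\<close>. As \<open>q\<^sub>2 - q\<^sub>1 = f w\<close>,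
  one may let \<open>\<psi> t\<close> tend to \<open>sgn (f t) exp (- c t)\<close>; for large \<open>c\<close> the remainder is absorbed and
  \<open>\<integral> |q\<^sub>2 - q\<^sub>1| exp (- c w) / (|x| |x - e|)\<close> over \<open>w < T\<close> must vanish.
\<close>

section \<open>Smooth functions\<close>

text \<open>The data live on the single line x = e, whereas a solution of order zero is tested
  against functions on space-time; hence the kernel carries a bump at e that is shrunk afterwards.
  All derivatives are put on that kernel, so that continuity up to the cone is what is taken from v.
  In the limit y is forced to be e - x, which produces the weight 1/(|x| |x - e|), singular at both
  foci; this shapes the convergence lemmas. The limiting identity is of Volterra type: by causality
  the kernel at an ellipsoid of parameter w sees \<psi> at w through the singular parts and beyond w
  through the regular ones. Under a weight exp (- c t), all that lies beyond w weighs 1/c of the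
  value at w, which replaces an iteration or a Gronwall argument. The sign of \<psi> can be chosen
  separately on each ellipsoid, and q2 - q1 is constant there, so the main term can be made an
  integral of |q2 - q1|; without this, cancellation could hide a nonzero difference.\<close>

definition smooth :: "('a::euclidean_space \<Rightarrow> real) \<Rightarrow> bool" where
  "smooth f \<longleftrightarrow> (\<forall>k. Ck_on k f UNIV)"

text \<open>Induction on the order, for all members of \<open>S\<close> at once: differentiability
  gives continuity, and stability under partial derivatives carries the claim from k to k + 1.
  Smoothness proofs thus reduce to first derivatives, with no Leibniz or chain rule of higher
  order.\<close>

lemma smooth_coinduct:
  assumes "f \<in> S"
    and "\<And>g x. g \<in> S \<Longrightarrow> g differentiable (at x)"
    and "\<And>g b. g \<in> S \<Longrightarrow> b \<in> Basis \<Longrightarrow> dir_deriv b g \<in> S"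
  shows "smooth f"
proof -
  have "Ck_on k g UNIV" if "g \<in> S" for k g
    using that
  proof (induction k arbitrary: g)
    case 0
    then show ?case
      using assms(2) by (auto simp: continuous_on_eq_continuous_at intro: differentiable_imp_continuous_within)
  next
    case (Suc k)
    then show ?case using assms(2,3) by auto
  qed
  then show ?thesis using assms(1) by (auto simp: smooth_def)
qed

lemma smooth_differentiable: "smooth f \<Longrightarrow> f differentiable (at x)"
  unfolding smooth_def by (metis Ck_on.simps(2) UNIV_I)

lemma smooth_dir_deriv: "smooth f \<Longrightarrow> b \<in> Basis \<Longrightarrow> smooth (dir_deriv b f)"
  unfolding smooth_def by (metis Ck_on.simps(2))

lemma smooth_continuous_on: "smooth f \<Longrightarrow> continuous_on S f"
  unfolding smooth_def by (metis Ck_on.simps(1) continuous_on_subset subset_UNIV)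

lemma dir_deriv_eq: "(f has_derivative f') (at x) \<Longrightarrow> dir_deriv b f x = f' b"
  unfolding dir_deriv_def by (metis frechet_derivative_at)

lemma smooth_has_derivative: "smooth f \<Longrightarrow> (f has_derivative (\<lambda>h. dir_deriv h f x)) (at x)"
  unfolding dir_deriv_def using smooth_differentiable frechet_derivative_works
  by (metis eta_contract_eq)

text \<open>If the first derivatives of the generators lie in the generated algebra, then so do all
  derivatives of all its elements, which are therefore smooth.\<close>

inductive_set alg :: "('a::euclidean_space \<Rightarrow> real) set \<Rightarrow> ('a \<Rightarrow> real) set" for G where
  alg_const: "(\<lambda>x. c) \<in> alg G"
| alg_gen: "g \<in> G \<Longrightarrow> g \<in> alg G"
| alg_add: "f \<in> alg G \<Longrightarrow> g \<in> alg G \<Longrightarrow> (\<lambda>x. f x + g x) \<in> alg G"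
| alg_mult: "f \<in> alg G \<Longrightarrow> g \<in> alg G \<Longrightarrow> (\<lambda>x. f x * g x) \<in> alg G"

lemma alg_smooth:
  assumes diff: "\<And>g x. g \<in> G \<Longrightarrow> g differentiable (at x)"
    and deriv: "\<And>g b. g \<in> G \<Longrightarrow> b \<in> Basis \<Longrightarrow> dir_deriv b g \<in> alg G"
    and f: "f \<in> alg G"
  shows "smooth f"
proof -
  have *: "(\<forall>x. g differentiable (at x)) \<and> (\<forall>b\<in>Basis. dir_deriv b g \<in> alg G)" if "g \<in> alg G" for g
    using that
  proof induction
    case (alg_const c)
    have "dir_deriv b (\<lambda>x. c) = (\<lambda>x::'a. 0)" for b
      by (rule ext, rule dir_deriv_eq[THEN trans]) (auto intro!: derivative_eq_intros)
    then show ?case by (auto intro: alg.alg_const)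
  next
    case (alg_gen g)
    then show ?case using diff deriv by auto
  next
    case (alg_add f g)
    have "dir_deriv b (\<lambda>x. f x + g x) = (\<lambda>x. dir_deriv b f x + dir_deriv b g x)" for b
    proof
      fix x
      have "(f has_derivative frechet_derivative f (at x)) (at x)"
        "(g has_derivative frechet_derivative g (at x)) (at x)"
        using alg_add.IH by (auto simp flip: frechet_derivative_works)
      from has_derivative_add[OF this]
      show "dir_deriv b (\<lambda>x. f x + g x) x = dir_deriv b f x + dir_deriv b g x"
        by (subst dir_deriv_eq, assumption) (simp add: dir_deriv_def)
    qed
    then show ?case using alg_add by (auto intro: alg.alg_add)
  next
    case (alg_mult f g)
    have "dir_deriv b (\<lambda>x. f x * g x) = (\<lambda>x. f x * dir_deriv b g x + dir_deriv b f x * g x)" for b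
    proof
      fix x
      have "(f has_derivative frechet_derivative f (at x)) (at x)"
        "(g has_derivative frechet_derivative g (at x)) (at x)"
        using alg_mult.IH by (auto simp flip: frechet_derivative_works)
      from has_derivative_mult[OF this]
      show "dir_deriv b (\<lambda>x. f x * g x) x = f x * dir_deriv b g x + dir_deriv b f x * g x"
        by (subst dir_deriv_eq, assumption) (simp add: dir_deriv_def)
    qed
    then show ?case using alg_mult by (auto intro!: alg.alg_add alg.alg_mult)
  qed
  show ?thesis by (rule smooth_coinduct[OF f]) (use * in auto)
qed

lemma alg_smooth_smooth: "f \<in> alg (Collect smooth) \<Longrightarrow> smooth f"
  by (erule alg_smooth[rotated -1]) (auto intro: smooth_differentiable smooth_dir_deriv alg_gen)

lemma smooth_const: "smooth (\<lambda>x. c)"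
  by (intro alg_smooth_smooth alg_const)

lemma smooth_add: "smooth f \<Longrightarrow> smooth g \<Longrightarrow> smooth (\<lambda>x. f x + g x)"
  by (intro alg_smooth_smooth alg_add alg_gen) auto

lemma smooth_mult: "smooth f \<Longrightarrow> smooth g \<Longrightarrow> smooth (\<lambda>x. f x * g x)"
  by (intro alg_smooth_smooth alg_mult alg_gen) auto

lemma smooth_diff: "smooth f \<Longrightarrow> smooth g \<Longrightarrow> smooth (\<lambda>x. f x - g x)"
  using smooth_add[of f "\<lambda>x. (-1) * g x"] smooth_mult[OF smooth_const, of g "-1"] by simp

lemma smooth_sum: "finite A \<Longrightarrow> (\<And>i. i \<in> A \<Longrightarrow> smooth (f i)) \<Longrightarrow> smooth (\<lambda>x. \<Sum>i\<in>A. f i x)"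
  by (induction A rule: finite_induct) (auto intro: smooth_const smooth_add)

lemma smooth_linear:
  assumes "bounded_linear f" shows "smooth f"
proof (rule alg_smooth[of "{f}"])
  fix g b assume g: "g \<in> {f}"
  have "dir_deriv b f = (\<lambda>x. f b)" 
    using bounded_linear_imp_has_derivative[OF assms] dir_deriv_eq by blast
  then show "dir_deriv b g \<in> alg {f}" using g by (auto intro: alg_const)
qed (use assms bounded_linear_imp_differentiable in \<open>auto intro: alg_gen\<close>)

lemma dir_deriv_basis_sum:
  assumes "smooth f" shows "dir_deriv h f x = (\<Sum>b\<in>Basis. (h \<bullet> b) * dir_deriv b f x)"
proof -
  have l: "linear (\<lambda>h. dir_deriv h f x)"
    using has_derivative_linear[OF smooth_has_derivative[OF assms]] .
  have "dir_deriv h f x = dir_deriv (\<Sum>b\<in>Basis. (h \<bullet> b) *\<^sub>R b) f x" by (simp add: euclidean_representation)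
  also have "\<dots> = (\<Sum>b\<in>Basis. (h \<bullet> b) * dir_deriv b f x)"
    by (simp add: linear_sum[OF l] linear_scale[OF l])
  finally show ?thesis .
qed

text \<open>The generators are the pullbacks of all smooth functions. By the chain rule the
  b-derivative of f o L is the combination of the pullbacks of the partial derivatives of f with the
  constant coefficients \<open>L b \<bullet> c\<close>, so it stays in the algebra.\<close>

lemma smooth_compose_linear:
  fixes f :: "'a::euclidean_space \<Rightarrow> real" and L :: "'b::euclidean_space \<Rightarrow> 'a"
  assumes f: "smooth f" and L: "bounded_linear L"
  shows "smooth (\<lambda>x. f (L x))"
proof (rule alg_smooth[of "(\<lambda>f x. f (L x)) ` Collect smooth"])
  let ?G = "(\<lambda>f x. f (L x)) ` Collect smooth"
  have D: "((\<lambda>x. f (L x)) has_derivative (\<lambda>h. dir_deriv (L h) f (L x))) (at x)" if "smooth f" for f x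
    by (rule has_derivative_compose[OF bounded_linear_imp_has_derivative[OF L] smooth_has_derivative[OF that]])
  show "h differentiable (at x)" if "h \<in> ?G" for h x
    using that D unfolding differentiable_def by blast
  have sum: "(\<lambda>x. \<Sum>i\<in>I. c i * g i x) \<in> alg ?G" if "finite I" "\<And>i. i \<in> I \<Longrightarrow> g i \<in> ?G"
    for I :: "'a set" and c g
    using that by (induction I rule: finite_induct) (auto intro!: alg_add alg_mult alg_const intro: alg_gen)
  show "dir_deriv b h \<in> alg ?G" if "h \<in> ?G" "b \<in> Basis" for h b
  proof -
    obtain f where f: "smooth f" and h: "h = (\<lambda>x. f (L x))" using \<open>h \<in> ?G\<close> by auto
    have "dir_deriv b h = (\<lambda>x. \<Sum>c\<in>Basis. (L b \<bullet> c) * dir_deriv c f (L x))"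
    proof
      fix x
      have "dir_deriv (L b) f (L x) = dir_deriv (\<Sum>c\<in>Basis. (L b \<bullet> c) *\<^sub>R c) f (L x)"
        by (simp add: euclidean_representation)
      also have "\<dots> = (\<Sum>c\<in>Basis. (L b \<bullet> c) * dir_deriv c f (L x))"
        by (subst dir_deriv_basis_sum[OF f]) (simp add: euclidean_representation)
      finally show "dir_deriv b h x = (\<Sum>c\<in>Basis. (L b \<bullet> c) * dir_deriv c f (L x))"
        unfolding h dir_deriv_eq[OF D[OF f]] .
    qed
    also have "\<dots> \<in> alg ?G"
    proof (rule sum)
      fix c :: 'a assume "c \<in> Basis"
      from smooth_dir_deriv[OF f this] show "(\<lambda>x. dir_deriv c f (L x)) \<in> ?G" by blast
    qed simp
    finally show ?thesis .
  qed
  show "(\<lambda>x. f (L x)) \<in> alg ?G" using f by (intro alg_gen) blast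
qed

lemma dir_deriv_shift:
  assumes "smooth f" shows "dir_deriv b (\<lambda>q. f (p + q)) = (\<lambda>q. dir_deriv b f (p + q))"
proof
  fix q
  have "((\<lambda>q. p + q) has_derivative (\<lambda>h. h)) (at q)" by (auto intro!: derivative_eq_intros)
  from has_derivative_compose[OF this smooth_has_derivative[OF assms]]
  show "dir_deriv b (\<lambda>q. f (p + q)) q = dir_deriv b f (p + q)" by (rule dir_deriv_eq)
qed

lemma smooth_shift:
  assumes "smooth f" shows "smooth (\<lambda>q. f (p + q))"
proof (rule smooth_coinduct[where S = "(\<lambda>f q. f (p + q)) ` Collect smooth"])
  fix g x assume "g \<in> (\<lambda>f q. f (p + q)) ` Collect smooth"
  then obtain f where f: "smooth f" "g = (\<lambda>q. f (p + q))" by auto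
  have "((\<lambda>q. p + q) has_derivative (\<lambda>h. h)) (at x)" by (auto intro!: derivative_eq_intros)
  from has_derivative_compose[OF this smooth_has_derivative[OF f(1)]]
  show "g differentiable (at x)" unfolding f(2) differentiable_def by blast
next
  fix g and b :: 'a assume "g \<in> (\<lambda>f q. f (p + q)) ` Collect smooth" "b \<in> Basis"
  then show "dir_deriv b g \<in> (\<lambda>f q. f (p + q)) ` Collect smooth"
    using dir_deriv_shift smooth_dir_deriv by blast
qed (use assms in auto)

text \<open>One generator besides the smooth functions is enough, because the derivative of 1/g is -
  (1/g) (dg) (1/g), a product of generators.\<close>

lemma smooth_inverse:
  fixes g :: "'a::euclidean_space \<Rightarrow> real"
  assumes g: "smooth g" and nz: "\<And>x. g x \<noteq> 0"
  shows "smooth (\<lambda>x. inverse (g x))"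
proof (rule alg_smooth[of "insert (\<lambda>x. inverse (g x)) (Collect smooth)"])
  let ?G = "insert (\<lambda>x. inverse (g x)) (Collect smooth)"
  have D: "((\<lambda>x. inverse (g x)) has_derivative (\<lambda>h. - (inverse (g x) * dir_deriv h g x * inverse (g x)))) (at x)" for x
    by (rule Deriv.has_derivative_inverse[OF nz smooth_has_derivative[OF g]])
  show "h differentiable (at x)" if "h \<in> ?G" for h x
    using that D smooth_differentiable unfolding differentiable_def by blast
  show "dir_deriv b h \<in> alg ?G" if "h \<in> ?G" "b \<in> Basis" for h b
    using that(1)
  proof
    assume h: "h = (\<lambda>x. inverse (g x))"
    have "dir_deriv b h = (\<lambda>x. (-1) * ((inverse (g x) * dir_deriv b g x) * inverse (g x)))"
      unfolding h using dir_deriv_eq[OF D] by auto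
    moreover have "\<dots> \<in> alg ?G"
    proof (intro alg_mult)
      show "dir_deriv b g \<in> alg ?G" using smooth_dir_deriv[OF g that(2)] by (intro alg_gen) simp
      show "(\<lambda>x. - 1) \<in> alg ?G" by (rule alg_const)
    qed (rule alg_gen, blast)+
    ultimately show ?thesis by simp
  next
    assume "h \<in> Collect smooth"
    then show ?thesis using smooth_dir_deriv that(2) by (auto intro!: alg_gen)
  qed
qed (auto intro: alg_gen)

lemma smooth_polynomial: "real_polynomial_function f \<Longrightarrow> smooth f"
  by (induction rule: real_polynomial_function.induct)
    (auto intro: smooth_linear smooth_const smooth_add smooth_mult)

section \<open>Flat functions and a smooth step\<close>

definition expinv :: "nat \<Rightarrow> real \<Rightarrow> real" where
  "expinv m t = (if t > 0 then exp (- 1 / t) / t ^ m else 0)"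

text \<open>The exponent \<open>m\<close> is a parameter because differentiating exp (- 1/t) / t ^ m
  raises the power of 1/t; with all \<open>m\<close> together the family is closed under
  differentiation up to constants.\<close>

lemma expinv_has_derivative:
  "(expinv m has_real_derivative (- real m * expinv (Suc m) t + expinv (m + 2) t)) (at t)"
proof -
  consider "t > 0" | "t < 0" | "t = 0" by linarith
  then show ?thesis
  proof cases
    case 1
    have "((\<lambda>t. exp (- 1 / t) / t ^ m) has_real_derivative (exp (- 1 / t) * (1 / t\<^sup>2) * t ^ m
         - exp (- 1 / t) * (real m * t ^ (m - 1))) / (t ^ m * t ^ m)) (at t)"
      using 1 by (auto intro!: derivative_eq_intros simp: power2_eq_square)
    also have "(exp (- 1 / t) * (1 / t\<^sup>2) * t ^ m
         - exp (- 1 / t) * (real m * t ^ (m - 1))) / (t ^ m * t ^ m) =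
         - real m * expinv (Suc m) t + expinv (m + 2) t"
    \<comment> \<open>For \<open>m = 0\<close> the truncated \<open>m - 1\<close> is 0, but the
      coefficient \<open>real m\<close> removes that term; otherwise the power is genuine.\<close>
    proof (cases m)
      case 0
      then show ?thesis using 1 by (simp add: expinv_def power2_eq_square)
    next
      case (Suc k)
      then show ?thesis using 1 by (simp add: expinv_def power2_eq_square divide_simps) (simp add: algebra_simps)
    qed
    finally have D: "((\<lambda>t. exp (- 1 / t) / t ^ m) has_real_derivative (- real m * expinv (Suc m) t + expinv (m + 2) t)) (at t)" .
    have "eventually (\<lambda>s. s \<in> {0<..}) (nhds t)"
      using 1 by (intro eventually_nhds_in_open) auto
    then have ev: "eventually (\<lambda>s. exp (- 1 / s) / s ^ m = expinv m s) (nhds t)"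
      by eventually_elim (simp add: expinv_def)
    show ?thesis by (rule DERIV_cong_ev[OF refl ev refl, THEN iffD1, OF D])
  next
    case 2
    have "eventually (\<lambda>s. s \<in> {..<0}) (nhds t)"
      using 2 by (intro eventually_nhds_in_open) auto
    then have ev: "eventually (\<lambda>s. 0 = expinv m s) (nhds t)"
      by eventually_elim (simp add: expinv_def)
    have z: "0 = (- real m * expinv (Suc m) t + expinv (m + 2) t)" using 2 by (simp add: expinv_def)
    show ?thesis by (rule DERIV_cong_ev[OF refl ev z, THEN iffD1]) simp
  next
    case 3
    \<comment> \<open>With x = 1/h this is the right difference quotient at 0, namely exp (- 1/h) /
      h ^ (m + 1).\<close>
    have "((\<lambda>x. x ^ Suc m / exp x) \<longlongrightarrow> (0::real)) at_top" by (rule tendsto_power_div_exp_0)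
    then have lim: "((\<lambda>x. inverse x ^ Suc m / exp (inverse x)) \<longlongrightarrow> (0::real)) (at_right 0)"
      by (rule filterlim_compose) (rule filterlim_inverse_at_top_right)
    have "((\<lambda>h. (expinv m (0 + h) - expinv m 0) / h) \<longlongrightarrow> 0) (at 0)"
    proof (rule filterlim_split_at)
      show "((\<lambda>h. (expinv m (0 + h) - expinv m 0) / h) \<longlongrightarrow> 0) (at_right 0)"
      proof (rule Lim_transform_eventually[OF lim])
        show "\<forall>\<^sub>F h in at_right 0. inverse h ^ Suc m / exp (inverse h) = (expinv m (0 + h) - expinv m 0) / h"
          using eventually_at_right_less[of 0]
          by eventually_elim (simp add: expinv_def exp_minus inverse_eq_divide power_divide)
      qed
      show "((\<lambda>h. (expinv m (0 + h) - expinv m 0) / h) \<longlongrightarrow> 0) (at_left 0)"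
      proof (rule Lim_transform_eventually[OF tendsto_const])
        show "\<forall>\<^sub>F h in at_left 0. 0 = (expinv m (0 + h) - expinv m 0) / h"
          by (rule eventually_at_leftI[of "-1"]) (auto simp: expinv_def)
      qed
    qed
    then show ?thesis using 3 by (simp add: DERIV_def expinv_def)
  qed
qed

lemma smooth_expinv:
  fixes g :: "'a::euclidean_space \<Rightarrow> real"
  assumes g: "smooth g"
  shows "smooth (\<lambda>x. expinv m (g x))"
proof (rule alg_smooth[of "range (\<lambda>m x. expinv m (g x)) \<union> Collect smooth"])
  let ?G = "range (\<lambda>m x. expinv m (g x)) \<union> Collect smooth"
  have D: "((\<lambda>x. expinv m (g x)) has_derivative
      (\<lambda>h. dir_deriv h g x * (- real m * expinv (Suc m) (g x) + expinv (m + 2) (g x)))) (at x)" for x m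
    using has_derivative_compose[OF smooth_has_derivative[OF g]
      expinv_has_derivative[unfolded has_field_derivative_def]]
    by (simp add: mult.commute)
  show "h differentiable (at x)" if "h \<in> ?G" for h x
    using that D smooth_differentiable unfolding differentiable_def by blast
  show "dir_deriv b h \<in> alg ?G" if "h \<in> ?G" "b \<in> Basis" for h b
    using that(1)
  proof
    assume "h \<in> range (\<lambda>m x. expinv m (g x))"
    then obtain m where h: "h = (\<lambda>x. expinv m (g x))" by auto
    have "dir_deriv b h = (\<lambda>x. dir_deriv b g x * (- real m * expinv (Suc m) (g x) + expinv (m + 2) (g x)))"
      unfolding h using dir_deriv_eq[OF D] by auto
    moreover have "\<dots> \<in> alg ?G"
    proof (intro alg_mult alg_add)
      show "dir_deriv b g \<in> alg ?G" using smooth_dir_deriv[OF g that(2)] by (intro alg_gen) simp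
      show "(\<lambda>x. - real m) \<in> alg ?G" by (rule alg_const)
      show "(\<lambda>x. expinv n (g x)) \<in> alg ?G" for n by (rule alg_gen) blast
      show "(\<lambda>x. expinv n (g x)) \<in> alg ?G" for n by (rule alg_gen) blast
    qed
    ultimately show ?thesis by simp
  next
    assume "h \<in> Collect smooth"
    then show ?thesis using smooth_dir_deriv that(2) by (auto intro!: alg_gen)
  qed
qed (auto intro!: alg_gen)

lemma expinv_nonneg: "expinv m t \<ge> 0"
  by (simp add: expinv_def)

lemma expinv_pos_iff: "expinv m t > 0 \<longleftrightarrow> t > 0"
  by (simp add: expinv_def)

lemma expinv_eq_0_iff: "expinv m t = 0 \<longleftrightarrow> t \<le> 0"
  by (simp add: expinv_def)

lemma expinv_0_le_1: "expinv 0 t \<le> 1"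
  by (simp add: expinv_def)

text \<open>Quotient A/(A + B): A vanishes exactly for t \<le> -1 and B exactly for t \<ge> -1/2, so
  the denominator has no zero.\<close>

lemma smooth_step:
  obtains \<theta> :: "real \<Rightarrow> real" where "smooth \<theta>" "\<And>t. t \<ge> - 1 / 2 \<Longrightarrow> \<theta> t = 1" "\<And>t. t \<le> - 1 \<Longrightarrow> \<theta> t = 0"
proof
  let ?d = "\<lambda>t::real. expinv 0 (t + 1) + expinv 0 (- 1 / 2 - t)"
  let ?\<theta> = "\<lambda>t::real. expinv 0 (t + 1) * inverse (?d t)"
  have id: "smooth (\<lambda>t::real. t)" by (rule smooth_linear) (rule bounded_linear_ident)
  have "?d t \<noteq> 0" for t
  proof -
    have "t + 1 > 0 \<or> - 1 / 2 - t > 0" by linarith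
    then have "?d t > 0"
      using expinv_pos_iff[of 0] expinv_nonneg[of 0] by (metis add_nonneg_pos add_pos_nonneg)
    then show ?thesis by simp
  qed
  then show "smooth ?\<theta>"
    by (intro smooth_mult smooth_inverse smooth_add smooth_expinv smooth_diff smooth_const id)
  show "?\<theta> t = 1" if "t \<ge> - 1 / 2" for t using that
    by (simp add: expinv_eq_0_iff) (simp add: expinv_def)
  show "?\<theta> t = 0" if "t \<le> - 1" for t using that by (simp add: expinv_eq_0_iff)
qed

section \<open>Convolution with a distribution of order zero\<close>

lemma closure_support_subset:
  assumes "closed A" "\<And>p. p \<notin> A \<Longrightarrow> f p = 0"
  shows "closure (support_on UNIV f) \<subseteq> A"
  using assms by (intro closure_minimal) (auto simp: support_on_def)

lemma CcI:
  assumes "continuous_on UNIV \<phi>" "compact A" "\<And>p. p \<notin> A \<Longrightarrow> \<phi> p = 0"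
  shows "\<phi> \<in> Cc"
proof -
  have "closure (support_on UNIV \<phi>) \<subseteq> A"
    using assms by (intro closure_support_subset compact_imp_closed)
  then have "compact (closure (support_on UNIV \<phi>))"
    using assms(2) by (metis closed_closure compact_Int_closed inf.absorb_iff2)
  then show ?thesis using assms(1) by (simp add: Cc_def)
qed

lemma CcE:
  assumes "\<phi> \<in> Cc"
  obtains A where "compact A" "\<And>p. p \<notin> A \<Longrightarrow> \<phi> p = 0" "continuous_on UNIV \<phi>"
proof
  show "compact (closure (support_on UNIV \<phi>))" "continuous_on UNIV \<phi>"
    using assms by (auto simp: Cc_def)
  show "\<phi> p = 0" if "p \<notin> closure (support_on UNIV \<phi>)" for p
    using that closure_subset[of "support_on UNIV \<phi>"] by (auto simp: support_on_def)
qed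

lemma test_functions_iff: "\<phi> \<in> test_functions \<longleftrightarrow> smooth \<phi> \<and> \<phi> \<in> Cc"
  by (auto simp: test_functions_def smooth_def)

lemma zero_in_Cc: "(\<lambda>p. 0) \<in> Cc"
  by (rule CcI[of _ "{}"]) auto

lemma Cc_add:
  assumes "\<phi> \<in> Cc" "\<psi> \<in> Cc" shows "(\<lambda>p. \<phi> p + \<psi> p) \<in> Cc"
proof -
  obtain A where A: "compact A" "\<And>p. p \<notin> A \<Longrightarrow> \<phi> p = 0" "continuous_on UNIV \<phi>"
    using CcE[OF assms(1)] by blast
  obtain B where B: "compact B" "\<And>p. p \<notin> B \<Longrightarrow> \<psi> p = 0" "continuous_on UNIV \<psi>"
    using CcE[OF assms(2)] by blast
  show ?thesis
    using A B by (intro CcI[of _ "A \<union> B"]) (auto intro!: continuous_intros)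
qed

lemma Cc_mult:
  assumes "continuous_on UNIV g" "\<phi> \<in> Cc" shows "(\<lambda>p. g p * \<phi> p) \<in> Cc"
proof -
  obtain A where A: "compact A" "\<And>p. p \<notin> A \<Longrightarrow> \<phi> p = 0" "continuous_on UNIV \<phi>"
    using CcE[OF assms(2)] by blast
  show ?thesis
    using A assms by (intro CcI[of _ "A"]) (auto intro!: continuous_intros)
qed

lemma Cc_sum: "finite I \<Longrightarrow> (\<And>i. i \<in> I \<Longrightarrow> f i \<in> Cc) \<Longrightarrow> (\<lambda>p. \<Sum>i\<in>I. f i p) \<in> Cc"
  by (induction I rule: finite_induct) (auto intro: zero_in_Cc Cc_add)

lemma Cc_shift:
  assumes "\<phi> \<in> Cc" shows "(\<lambda>q. \<phi> (p + q)) \<in> Cc"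
proof -
  obtain A where A: "compact A" "\<And>p. p \<notin> A \<Longrightarrow> \<phi> p = 0" "continuous_on UNIV \<phi>"
    using CcE[OF assms] by blast
  have "compact ((+) (- p) ` A)" using A(1) by (intro compact_translation)
  moreover have "\<phi> (p + q) = 0" if "q \<notin> (+) (- p) ` A" for q
    using that by (intro A(2)) (metis add.commute add_minus_cancel image_eqI)
  ultimately show ?thesis
    using A(3) by (intro CcI) (auto intro!: continuous_intros continuous_on_compose2[OF A(3)])
qed

lemma dir_deriv_cong_open:
  assumes "open S" "x \<in> S" "\<And>y. y \<in> S \<Longrightarrow> f y = g y"
  shows "dir_deriv b f x = dir_deriv b g x"
proof -
  have "(f has_derivative f') (at x) \<longleftrightarrow> (g has_derivative f') (at x)" for f'
    using assms by (metis has_derivative_transform_within_open)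
  then show ?thesis by (simp add: dir_deriv_def frechet_derivative_def)
qed

lemma dir_deriv_eq_0:
  assumes "closed A" "\<And>x. x \<notin> A \<Longrightarrow> f x = 0" "p \<notin> A"
  shows "dir_deriv b f p = 0"
proof -
  have "dir_deriv b f p = dir_deriv b (\<lambda>x. 0) p"
    using assms by (intro dir_deriv_cong_open[of "- A"]) auto
  also have "\<dots> = 0" by (rule dir_deriv_eq[THEN trans]) (auto intro!: derivative_eq_intros)
  finally show ?thesis .
qed

lemma dir_deriv_test_function:
  assumes "\<phi> \<in> test_functions" "b \<in> Basis" shows "dir_deriv b \<phi> \<in> test_functions"
proof -
  have sm: "smooth \<phi>" and cc: "\<phi> \<in> Cc" using assms by (auto simp: test_functions_iff)
  obtain A where A: "compact A" "\<And>p. p \<notin> A \<Longrightarrow> \<phi> p = 0" "continuous_on UNIV \<phi>"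
    using CcE[OF cc] by blast
  have "dir_deriv b \<phi> p = 0" if "p \<notin> A" for p
    using dir_deriv_eq_0[OF compact_imp_closed[OF A(1)] A(2) that] .
  moreover have "smooth (dir_deriv b \<phi>)" by (rule smooth_dir_deriv[OF sm assms(2)])
  ultimately show ?thesis
    using A(1) by (auto simp: test_functions_iff intro!: CcI[of _ A] smooth_continuous_on)
qed

lemma Cc_uniformly_continuous:
  assumes "\<phi> \<in> Cc" shows "uniformly_continuous_on UNIV \<phi>"
proof -
  obtain A where A: "compact A" "\<And>p. p \<notin> A \<Longrightarrow> \<phi> p = 0" "continuous_on UNIV \<phi>"
    using CcE[OF assms] by blast
  \<comment> \<open>The thickening by the unit ball contains both points of any pair at distance
    below 1 of which one lies in \<open>A\<close>; if neither does, both values are 0.\<close>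
  let ?A = "{x + y |x y. x \<in> A \<and> y \<in> cball 0 1}"
  have "compact ?A" using A(1) by (intro compact_sums) auto
  then have uc: "uniformly_continuous_on ?A \<phi>"
    using A(3) by (intro compact_uniformly_continuous continuous_on_subset[OF A(3)]) auto
  show ?thesis
    unfolding uniformly_continuous_on_def
  proof (intro allI impI)
    fix e :: real assume e: "e > 0"
    have "\<exists>d>0. \<forall>x\<in>?A. \<forall>y\<in>?A. dist y x < d \<longrightarrow> dist (\<phi> y) (\<phi> x) < e"
      by (rule uc[unfolded uniformly_continuous_on_def, rule_format, OF e])
    then obtain d where d: "d > 0"
      "\<And>x y. x \<in> ?A \<Longrightarrow> y \<in> ?A \<Longrightarrow> dist y x < d \<Longrightarrow> dist (\<phi> y) (\<phi> x) < e"
      by (elim exE conjE) (rule that, assumption, blast)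
    have mem: "\<And>x y. x \<in> A \<Longrightarrow> y \<in> cball 0 1 \<Longrightarrow> x + y \<in> ?A" by blast
    have near: "y \<in> ?A" if "x \<in> A" "dist y x < min d 1" for x y
    proof -
      have "x + (y - x) \<in> ?A"
        using that by (intro mem) (auto simp: dist_norm norm_minus_commute)
      then show ?thesis by simp
    qed
    show "\<exists>d>0. \<forall>x\<in>UNIV. \<forall>y\<in>UNIV. dist y x < d \<longrightarrow> dist (\<phi> y) (\<phi> x) < e"
    proof (intro exI[of _ "min d 1"] conjI ballI impI)
      fix x y :: spacetime assume xy: "dist y x < min d 1"
      consider "x \<in> A" | "y \<in> A" | "x \<notin> A" "y \<notin> A" by blast
      then show "dist (\<phi> y) (\<phi> x) < e"
      proof cases
        case 1
        have "x \<in> ?A" "y \<in> ?A" by (rule near[OF 1], use xy d(1) in simp)+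
        then show ?thesis using xy by (intro d(2)) auto
      next
        case 2
        have "x \<in> ?A" "y \<in> ?A" by (rule near[OF 2], use xy d(1) in \<open>simp add: dist_commute\<close>)+
        then show ?thesis using xy by (intro d(2)) auto
      next
        case 3
        then show ?thesis using A(2) e by auto
      qed
    qed (use d in auto)
  qed
qed

section \<open>Functionals of order zero and their convolution with test functions\<close>

lemma distribution0_add:
  "distribution0 u \<Longrightarrow> \<phi> \<in> Cc \<Longrightarrow> \<psi> \<in> Cc \<Longrightarrow> u (\<lambda>p. \<phi> p + \<psi> p) = u \<phi> + u \<psi>"
  by (simp add: distribution0_def)

lemma distribution0_cmult:
  "distribution0 u \<Longrightarrow> \<phi> \<in> Cc \<Longrightarrow> u (\<lambda>p. c * \<phi> p) = c * u \<phi>"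
  by (simp add: distribution0_def)

lemma distribution0_zero: "distribution0 u \<Longrightarrow> u (\<lambda>p. 0) = 0"
  using distribution0_cmult[of u "\<lambda>p. 0" 0] zero_in_Cc by simp

lemma distribution0_diff:
  assumes "distribution0 u" "\<phi> \<in> Cc" "\<psi> \<in> Cc"
  shows "u (\<lambda>p. \<phi> p - \<psi> p) = u \<phi> - u \<psi>"
proof -
  have "(\<lambda>p. (-1) * \<psi> p) \<in> Cc" using assms by (intro Cc_mult) auto
  then show ?thesis
    using distribution0_add[OF assms(1,2), of "\<lambda>p. (-1) * \<psi> p"] distribution0_cmult[OF assms(1,3), of "-1"]
    by simp
qed

lemma distribution0_sum:
  assumes u: "distribution0 u" and "finite I" "\<And>i. i \<in> I \<Longrightarrow> f i \<in> Cc"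
  shows "u (\<lambda>p. \<Sum>i\<in>I. f i p) = (\<Sum>i\<in>I. u (f i))"
  using assms(2,3)
proof (induction I rule: finite_induct)
  case empty
  then show ?case by (simp add: distribution0_zero[OF u])
next
  case (insert i I)
  have "u (\<lambda>p. f i p + (\<Sum>i\<in>I. f i p)) = u (f i) + u (\<lambda>p. \<Sum>i\<in>I. f i p)"
    using insert by (intro distribution0_add[OF u] Cc_sum) auto
  then show ?case using insert by simp
qed

lemma distribution0_bound:
  assumes "distribution0 u" "compact A"
  obtains C where "C \<ge> 0" "\<And>\<phi> M. \<phi> \<in> Cc \<Longrightarrow> (\<And>p. p \<notin> A \<Longrightarrow> \<phi> p = 0) \<Longrightarrow> (\<And>p. \<bar>\<phi> p\<bar> \<le> M) \<Longrightarrow> \<bar>u \<phi>\<bar> \<le> C * M"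
proof -
  obtain C where C: "\<And>\<phi>. \<phi> \<in> Cc \<Longrightarrow> closure (support_on UNIV \<phi>) \<subseteq> A \<Longrightarrow> \<bar>u \<phi>\<bar> \<le> C * (SUP p. \<bar>\<phi> p\<bar>)"
    using assms unfolding distribution0_def by meson
  show thesis
  proof (rule that[of "\<bar>C\<bar>"])
    fix \<phi> M assume \<phi>: "\<phi> \<in> Cc" "\<And>p. p \<notin> A \<Longrightarrow> \<phi> p = 0" and M: "\<And>p. \<bar>\<phi> p\<bar> \<le> M"
    have "\<bar>u \<phi>\<bar> \<le> C * (SUP p. \<bar>\<phi> p\<bar>)"
      using \<phi> assms(2) by (intro C closure_support_subset compact_imp_closed)
    moreover have "(SUP p. \<bar>\<phi> p\<bar>) \<le> M" by (rule cSUP_least) (use M in auto)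
    \<comment> \<open>The constant from the definition may be negative; as the supremum is
      nonnegative, its absolute value serves as well.\<close>
    moreover have "0 \<le> (SUP p. \<bar>\<phi> p\<bar>)"
      using M by (intro order_trans[OF abs_ge_zero cSUP_upper[of 0]]) (auto intro!: bdd_aboveI2)
    ultimately show "\<bar>u \<phi>\<bar> \<le> \<bar>C\<bar> * M"
      by (smt (verit) mult_mono mult_right_mono abs_ge_self abs_ge_zero)
  qed auto
qed

text \<open>The Taylor remainder is small uniformly in the base point, because the partial
  derivatives are uniformly continuous. Uniformity matters since a functional of order zero controls
  only the supremum norm of its argument.\<close>

lemma test_function_remainder:
  assumes K: "K \<in> test_functions" and e: "e > 0"
  obtains d where "d > 0" "\<And>x h. norm h < d \<Longrightarrow>
    \<bar>K (x + h) - K x - (\<Sum>b\<in>Basis. (h \<bullet> b) * dir_deriv b K x)\<bar> \<le> e * norm h"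
proof -
  have sm: "smooth K" using K by (auto simp: test_functions_iff)
  \<comment> \<open>The dimension: each partial derivative is allowed the oscillation e/n, and the n
    contributions add up to e.\<close>
  define n where "n = real (card (Basis :: spacetime set))"
  have n: "n > 0" by (auto simp: n_def card_gt_0_iff)
  have "\<exists>d>0. \<forall>x y. dist y x < d \<longrightarrow> dist (dir_deriv b K y) (dir_deriv b K x) < e / n" if "b \<in> Basis" for b
  proof -
    have "uniformly_continuous_on UNIV (dir_deriv b K)"
      using dir_deriv_test_function[OF K that] by (auto simp: test_functions_iff intro: Cc_uniformly_continuous)
    from this[unfolded uniformly_continuous_on_def, rule_format, of "e / n"]
    show ?thesis using e n by auto
  qed
  then obtain D where D: "\<And>b. b \<in> Basis \<Longrightarrow> D b > 0"
    "\<And>b x y. b \<in> Basis \<Longrightarrow> dist y x < D b \<Longrightarrow> dist (dir_deriv b K y) (dir_deriv b K x) < e / n"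
    by metis
  define d where "d = Min (D ` Basis)"
  have d: "d > 0" using D(1) by (auto simp: d_def)
  have dD: "d \<le> D b" if "b \<in> Basis" for b using that by (auto simp: d_def)
  show thesis
  proof (rule that[OF d])
    fix x h :: spacetime assume h: "norm h < d"
    have "norm (K (x + h) - K x - dir_deriv ((x + h) - x) K x) \<le> norm ((x + h) - x) * e"
    proof (rule differentiable_bound_linearization[where S = "ball x d" and f' = "\<lambda>x h. dir_deriv h K x"])
      show "x + t *\<^sub>R (x + h - x) \<in> ball x d" if "t \<in> {0..1}" for t
      proof -
        have "t * norm h \<le> 1 * norm h" using that by (intro mult_right_mono) auto
        then show ?thesis using that h by (auto simp: dist_norm)
      qed
      show "(K has_derivative (\<lambda>h. dir_deriv h K y)) (at y within ball x d)" for y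
        using smooth_has_derivative[OF sm] by (rule has_derivative_at_withinI)
      show "onorm ((\<lambda>h. dir_deriv h K y) - (\<lambda>h. dir_deriv h K x)) \<le> e" if y: "y \<in> ball x d" for y
        unfolding fun_diff_def
      proof (rule onorm_bound)
        fix k :: spacetime
        have "\<bar>dir_deriv k K y - dir_deriv k K x\<bar> = \<bar>\<Sum>b\<in>Basis. (k \<bullet> b) * (dir_deriv b K y - dir_deriv b K x)\<bar>"
          by (simp add: dir_deriv_basis_sum[OF sm, of k] sum_subtractf algebra_simps)
        also have "\<dots> \<le> (\<Sum>b\<in>(Basis :: spacetime set). norm k * (e / n))"
        proof (rule order_trans[OF sum_abs], rule sum_mono)
          fix b :: spacetime assume b: "b \<in> Basis"
          have "dist (dir_deriv b K y) (dir_deriv b K x) < e / n"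
            using y dD[OF b] by (intro D(2)[OF b]) (auto simp: dist_commute)
          then show "\<bar>(k \<bullet> b) * (dir_deriv b K y - dir_deriv b K x)\<bar> \<le> norm k * (e / n)"
            unfolding abs_mult using Basis_le_norm[OF b, of k]
            by (intro mult_mono) (auto simp: dist_real_def)
        qed
        also have "\<dots> = e * norm k" using n by (simp add: n_def)
        finally show "norm (dir_deriv k K y - dir_deriv k K x) \<le> e * norm k" by simp
      qed (use e in auto)
      show "x \<in> ball x d" using d by simp
    qed
    then show "\<bar>K (x + h) - K x - (\<Sum>b\<in>Basis. (h \<bullet> b) * dir_deriv b K x)\<bar> \<le> e * norm h"
      by (simp add: dir_deriv_basis_sum[OF sm, of h] mult.commute)
  qed
qed

text \<open>Apply u to the difference quotient in p: its first-order remainder is uniformly small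
  and supported in one fixed compact set, so the bound of order zero makes its image small
  too.\<close>

lemma conv_has_derivative:
  assumes u: "distribution0 u" and K: "K \<in> test_functions"
  shows "((\<lambda>p. u (\<lambda>q. K (p + q))) has_derivative
    (\<lambda>h. \<Sum>b\<in>Basis. (h \<bullet> b) * u (\<lambda>q. dir_deriv b K (p0 + q)))) (at p0)"
  unfolding has_derivative_at_alt
proof (intro conjI allI impI)
  show "bounded_linear (\<lambda>h. \<Sum>b\<in>Basis. (h \<bullet> b) * u (\<lambda>q. dir_deriv b K (p0 + q)))"
    by (intro bounded_linear_sum bounded_linear_mult_const bounded_linear_inner_left)
  fix e :: real assume e: "e > 0"
  have Kc: "K \<in> Cc" using K by (simp add: test_functions_iff)
  have Dc: "dir_deriv b K \<in> Cc" if "b \<in> Basis" for b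
    using dir_deriv_test_function[OF K that] by (simp add: test_functions_iff)
  obtain A where A: "compact A" "\<And>p. p \<notin> A \<Longrightarrow> K p = 0" "continuous_on UNIV K"
    using CcE[OF Kc] by blast
  have DA: "dir_deriv b K p = 0" if "p \<notin> A" for b p
    using dir_deriv_eq_0[OF compact_imp_closed[OF A(1)] A(2) that] .
  \<comment> \<open>If K (y + q) is nonzero with |y - p0| \<le> 1, then q = (y + q) - y lies in
    \<open>B\<close>. One constant therefore serves all increments.\<close>
  define B where "B = {x - y |x y. x \<in> A \<and> y \<in> cball p0 1}"
  have mem: "\<And>x y. x \<in> A \<Longrightarrow> y \<in> cball p0 1 \<Longrightarrow> x - y \<in> B" unfolding B_def by blast
  have B: "compact B" unfolding B_def using A(1) by (intro compact_differences) auto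
  obtain C where C: "C \<ge> 0" "\<And>\<phi> M. \<phi> \<in> Cc \<Longrightarrow> (\<And>p. p \<notin> B \<Longrightarrow> \<phi> p = 0) \<Longrightarrow> (\<And>p. \<bar>\<phi> p\<bar> \<le> M) \<Longrightarrow> \<bar>u \<phi>\<bar> \<le> C * M"
    using distribution0_bound[OF u B] by blast
  \<comment> \<open>Dividing by C + 1 rather than by C covers C = 0.\<close>
  define e' where "e' = e / (C + 1)"
  have e': "e' > 0" "C * e' \<le> e" using e C(1) by (auto simp: e'_def field_simps)
  obtain d where d: "d > 0" "\<And>x h. norm h < d \<Longrightarrow>
    \<bar>K (x + h) - K x - (\<Sum>b\<in>Basis. (h \<bullet> b) * dir_deriv b K x)\<bar> \<le> e' * norm h"
    using test_function_remainder[OF K e'(1)] by blast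
  show "\<exists>d>0. \<forall>y. norm (y - p0) < d \<longrightarrow>
      norm (u (\<lambda>q. K (y + q)) - u (\<lambda>q. K (p0 + q)) -
        (\<Sum>b\<in>Basis. ((y - p0) \<bullet> b) * u (\<lambda>q. dir_deriv b K (p0 + q)))) \<le> e * norm (y - p0)"
  proof (intro exI[of _ "min d 1"] conjI allI impI)
    fix y assume y: "norm (y - p0) < min d 1"
    let ?h = "y - p0"
    let ?S = "\<lambda>q. \<Sum>b\<in>Basis. (?h \<bullet> b) * dir_deriv b K (p0 + q)"
    have S: "(\<lambda>q. (?h \<bullet> b) * dir_deriv b K (p0 + q)) \<in> Cc" if "b \<in> Basis" for b
      using Dc[OF that] by (intro Cc_mult Cc_shift) auto
    have Sc: "?S \<in> Cc" using S by (intro Cc_sum) auto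
    have uS: "u ?S = (\<Sum>b\<in>Basis. (?h \<bullet> b) * u (\<lambda>q. dir_deriv b K (p0 + q)))"
      using S Dc by (simp add: distribution0_sum[OF u] distribution0_cmult[OF u] Cc_shift)
    let ?d = "\<lambda>q. K (y + q) - K (p0 + q)"
    have dc: "?d \<in> Cc"
    proof -
      have "(\<lambda>q. K (y + q) + (-1) * K (p0 + q)) \<in> Cc" by (intro Cc_add Cc_mult Cc_shift Kc) auto
      then show ?thesis by simp
    qed
    have "(\<lambda>q. ?d q + (-1) * ?S q) \<in> Cc" by (rule Cc_add[OF dc Cc_mult[OF _ Sc]]) auto
    then have Rc: "(\<lambda>q. ?d q - ?S q) \<in> Cc" by simp
    have eq: "u (\<lambda>q. ?d q - ?S q) = u (\<lambda>q. K (y + q)) - u (\<lambda>q. K (p0 + q)) - u ?S"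
      by (simp add: distribution0_diff[OF u dc Sc] distribution0_diff[OF u Cc_shift[OF Kc] Cc_shift[OF Kc]])
    have "\<bar>u (\<lambda>q. ?d q - ?S q)\<bar> \<le> C * (e' * norm ?h)"
    proof (rule C(2)[OF Rc])
      fix q assume q: "q \<notin> B"
      have "p0 + q \<notin> A" 
      proof
        assume "p0 + q \<in> A"
        then have "(p0 + q) - p0 \<in> B" by (intro mem) auto
        then have "q \<in> B" by simp
        then show False using q by simp
      qed
      moreover have "y + q \<notin> A"
      proof
        assume "y + q \<in> A"
        then have "(y + q) - y \<in> B"
          using y by (intro mem) (auto simp: dist_norm norm_minus_commute)
        then have "q \<in> B" by simp
        then show False using q by simp
      qed
      ultimately show "?d q - ?S q = 0" using A(2) DA by simp
    next
      fix q show "\<bar>?d q - ?S q\<bar> \<le> e' * norm ?h"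
        using d(2)[of ?h "p0 + q"] y by (simp add: algebra_simps)
    qed
    also have "\<dots> \<le> e * norm ?h"
      using mult_right_mono[OF e'(2), of "norm ?h"] by (simp add: mult.assoc)
    finally show "norm (u (\<lambda>q. K (y + q)) - u (\<lambda>q. K (p0 + q)) -
        (\<Sum>b\<in>Basis. (?h \<bullet> b) * u (\<lambda>q. dir_deriv b K (p0 + q)))) \<le> e * norm ?h"
      using eq uS by simp
  qed (use d in auto)
qed

lemma dir_deriv_conv:
  assumes u: "distribution0 u" and K: "K \<in> test_functions" and b: "b \<in> Basis"
  shows "dir_deriv b (\<lambda>p. u (\<lambda>q. K (p + q))) = (\<lambda>p. u (\<lambda>q. dir_deriv b K (p + q)))"
proof
  fix p
  have "dir_deriv b (\<lambda>p. u (\<lambda>q. K (p + q))) p = (\<Sum>c\<in>Basis. (b \<bullet> c) * u (\<lambda>q. dir_deriv c K (p + q)))"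
    using dir_deriv_eq[OF conv_has_derivative[OF u K]] .
  also have "\<dots> = (\<Sum>c\<in>Basis. if c = b then u (\<lambda>q. dir_deriv c K (p + q)) else 0)"
    using b by (intro sum.cong) (auto simp: inner_Basis)
  finally show "dir_deriv b (\<lambda>p. u (\<lambda>q. K (p + q))) p = u (\<lambda>q. dir_deriv b K (p + q))"
    using b by simp
qed

text \<open>Derivatives fall on K, so the class of all these convolutions, with K ranging over the
  test functions, is stable under partial derivatives.\<close>

lemma smooth_conv:
  assumes u: "distribution0 u" and K: "K \<in> test_functions"
  shows "smooth (\<lambda>p. u (\<lambda>q. K (p + q)))"
proof (rule smooth_coinduct[where S = "(\<lambda>K p. u (\<lambda>q. K (p + q))) ` test_functions"])
  fix g x assume "g \<in> (\<lambda>K p. u (\<lambda>q. K (p + q))) ` test_functions"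
  then show "g differentiable (at x)"
    using conv_has_derivative[OF u] unfolding differentiable_def by blast
next
  fix g and b :: spacetime assume "g \<in> (\<lambda>K p. u (\<lambda>q. K (p + q))) ` test_functions" "b \<in> Basis"
  then show "dir_deriv b g \<in> (\<lambda>K p. u (\<lambda>q. K (p + q))) ` test_functions"
    using dir_deriv_conv[OF u] dir_deriv_test_function by blast
qed (use K in auto)

section \<open>The wave operator on convolutions, and the duality identity\<close>

lemma Basis_spacetime: "(0, 1) \<in> (Basis :: spacetime set)" "b \<in> Basis \<Longrightarrow> (b, 0) \<in> (Basis :: spacetime set)"
  by (auto simp: Basis_prod_def)

lemma wave_op_shift:
  assumes "smooth f" shows "wave_op (\<lambda>q. f (p + q)) = (\<lambda>q. wave_op f (p + q))"
proof -
  have "dir_deriv b (dir_deriv b (\<lambda>q. f (p + q))) q = dir_deriv b (dir_deriv b f) (p + q)" if "b \<in> Basis" for b q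
    unfolding dir_deriv_shift[OF assms, of b] dir_deriv_shift[OF smooth_dir_deriv[OF assms that], of b] ..
  then show ?thesis
    by (simp add: fun_eq_iff wave_op_def dt_def laplacian_x_def Basis_spacetime)
qed

lemma wave_op_cong_open:
  assumes S: "open S" "x \<in> S" and "\<And>y. y \<in> S \<Longrightarrow> f y = g y"
  shows "wave_op f x = wave_op g x"
proof -
  have 1: "dir_deriv b f y = dir_deriv b g y" if "y \<in> S" for b y
    using dir_deriv_cong_open[OF S(1) that assms(3)] .
  have "dir_deriv c (dir_deriv b f) x = dir_deriv c (dir_deriv b g) x" for b c
    using dir_deriv_cong_open[OF S 1] .
  then show ?thesis by (simp add: wave_op_def dt_def laplacian_x_def)
qed

lemma wave_op_test:
  assumes "\<phi> \<in> test_functions" shows "wave_op \<phi> \<in> Cc"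
proof -
  have d2: "dir_deriv b (dir_deriv b \<phi>) \<in> Cc" if "b \<in> Basis" for b
    using dir_deriv_test_function[OF dir_deriv_test_function[OF assms that] that] by (simp add: test_functions_iff)
  have "(\<lambda>p. dir_deriv (0,1) (dir_deriv (0,1) \<phi>) p + (-1) * (\<Sum>b\<in>Basis. dir_deriv (b,0) (dir_deriv (b,0) \<phi>) p)) \<in> Cc"
    by (intro Cc_add Cc_mult Cc_sum d2 Basis_spacetime) auto
  also have "(\<lambda>p. dir_deriv (0,1) (dir_deriv (0,1) \<phi>) p + (-1) * (\<Sum>b\<in>Basis. dir_deriv (b,0) (dir_deriv (b,0) \<phi>) p)) = wave_op \<phi>"
    by (simp add: fun_eq_iff wave_op_def dt_def laplacian_x_def)
  finally show ?thesis .
qed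

lemma wave_op_conv:
  assumes u: "distribution0 u" and K: "K \<in> test_functions"
  shows "wave_op (\<lambda>p. u (\<lambda>q. K (p + q))) p = u (\<lambda>q. wave_op K (p + q))"
proof -
  have d2: "dir_deriv b (dir_deriv b K) \<in> Cc" if "b \<in> Basis" for b
    using dir_deriv_test_function[OF dir_deriv_test_function[OF K that] that] by (simp add: test_functions_iff)
  have e2: "dir_deriv b (dir_deriv b (\<lambda>p. u (\<lambda>q. K (p + q)))) = (\<lambda>p. u (\<lambda>q. dir_deriv b (dir_deriv b K) (p + q)))"
    if "b \<in> Basis" for b
    unfolding dir_deriv_conv[OF u K that] dir_deriv_conv[OF u dir_deriv_test_function[OF K that] that] ..
  have "u (\<lambda>q. wave_op K (p + q)) = u (\<lambda>q. dir_deriv (0,1) (dir_deriv (0,1) K) (p + q))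
     - u (\<lambda>q. \<Sum>b\<in>Basis. dir_deriv (b,0) (dir_deriv (b,0) K) (p + q))"
    unfolding wave_op_def dt_def laplacian_x_def
    by (intro distribution0_diff[OF u] Cc_sum Cc_shift d2 Basis_spacetime) auto
  also have "u (\<lambda>q. \<Sum>b\<in>Basis. dir_deriv (b,0) (dir_deriv (b,0) K) (p + q)) =
     (\<Sum>b\<in>Basis. u (\<lambda>q. dir_deriv (b,0) (dir_deriv (b,0) K) (p + q)))"
    by (intro distribution0_sum[OF u] Cc_shift d2 Basis_spacetime) auto
  finally show ?thesis
    by (simp add: wave_op_def dt_def laplacian_x_def e2 Basis_spacetime)
qed

text \<open>The test function is \<open>\<Phi>(p) = u2 (K (p + \<cdot>))\<close>, cut off for \<open>t < - 1/2\<close>, where \<open>u1\<close> vanishes.\<close>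

lemma duality_identity:
  assumes s1: "point_source_solution q1 u1" and s2: "point_source_solution q2 u2"
    and c1: "continuous_on UNIV q1" and c2: "continuous_on UNIV q2"
    and l1: "\<And>\<phi> \<psi>. \<phi> \<in> Cc \<Longrightarrow> \<psi> \<in> Cc \<Longrightarrow> (\<And>x t. norm x \<le> t \<Longrightarrow> \<phi> (x, t) = \<psi> (x, t)) \<Longrightarrow> u1 \<phi> = u1 \<psi>"
    and l2: "\<And>\<phi> \<psi>. \<phi> \<in> Cc \<Longrightarrow> \<psi> \<in> Cc \<Longrightarrow> (\<And>x t. norm x \<le> t \<Longrightarrow> \<phi> (x, t) = \<psi> (x, t)) \<Longrightarrow> u2 \<phi> = u2 \<psi>"
    and K: "K \<in> test_functions"
  obtains W where "W \<in> Cc" "u2 K - u1 K = u1 W"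
    "\<And>x t. t \<ge> 0 \<Longrightarrow> W (x, t) = u2 (\<lambda>(y, s). (q2 y - q1 x) * K (x + y, t + s))"
proof -
  have d1: "distribution0 u1" and d2: "distribution0 u2"
    using s1 s2 by (auto simp: point_source_solution_def)
  have Kc: "K \<in> Cc" and Ks: "smooth K" using K by (auto simp: test_functions_iff)
  obtain \<theta> :: "real \<Rightarrow> real" where \<theta>: "smooth \<theta>" "\<And>t. t \<ge> - 1 / 2 \<Longrightarrow> \<theta> t = 1" "\<And>t. t \<le> - 1 \<Longrightarrow> \<theta> t = 0"
    using smooth_step by blast
  define \<Phi> where "\<Phi> = (\<lambda>p. u2 (\<lambda>q. K (p + q)))"
  define F where "F = (\<lambda>p::spacetime. \<theta> (snd p) * \<Phi> p)"
  obtain A where A: "compact A" "\<And>p. p \<notin> A \<Longrightarrow> K p = 0"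
    using CcE[OF Kc] by metis
  obtain R where R: "\<And>p. p \<in> A \<Longrightarrow> norm p \<le> R"
    using compact_imp_bounded[OF A(1)] unfolding bounded_iff by auto
  have Fs: "smooth F" unfolding F_def \<Phi>_def
    by (intro smooth_mult smooth_conv d2 K smooth_compose_linear[OF \<theta>(1) bounded_linear_snd])
  \<comment> \<open>The convolution may reach arbitrarily far into the past, so the cutoff is what
    makes the support compact. Where F is nonzero, t > -1 and K is nonzero at p + (y, s) for some
    |y| \<le> s. Then s \<le> R + 1, hence |y| \<le> R + 1, and |x| \<le> R + |y| gives the radius
    2R + 1.\<close>
  have F0: "F p = 0" if p: "p \<notin> cball 0 (2 * \<bar>R\<bar> + 1) \<times> cball 0 (\<bar>R\<bar> + 1)" for p
  proof (rule ccontr)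
    assume "F p \<noteq> 0"
    then have t: "snd p > - 1" and "\<Phi> p \<noteq> 0" using \<theta>(3)[of "snd p"] by (auto simp: F_def not_le[symmetric])
    have "\<exists>y s. norm y \<le> s \<and> K (p + (y, s)) \<noteq> 0"
    proof (rule ccontr)
      assume "\<not> ?thesis"
      then have "u2 (\<lambda>q. K (p + q)) = u2 (\<lambda>q. 0)"
        by (intro l2[OF Cc_shift[OF Kc] zero_in_Cc]) auto
      then show False using \<open>\<Phi> p \<noteq> 0\<close> distribution0_zero[OF d2] by (simp add: \<Phi>_def)
    qed
    then obtain y s where ys: "norm y \<le> s" "K (p + (y, s)) \<noteq> 0" by auto
    then have "norm (p + (y, s)) \<le> R" using A(2) R by blast
    then have "norm (fst p + y) \<le> R" "\<bar>snd p + s\<bar> \<le> R"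
      using norm_fst_le[of "fst p + y" "snd p + s"] norm_snd_le[of "snd p + s" "fst p + y"]
      by (cases p; auto)+
    moreover from this have "norm (fst p) \<le> R + norm y"
      using norm_triangle_ineq4[of "fst p + y" y] by simp
    moreover have "norm y \<ge> 0" by simp
    ultimately have "norm (fst p) \<le> 2 * \<bar>R\<bar> + 1" "\<bar>snd p\<bar> \<le> \<bar>R\<bar> + 1"
      using ys(1) t by linarith+
    then show False using p by (cases p) simp
  qed
  have Fc: "F \<in> Cc"
    by (rule CcI[OF smooth_continuous_on[OF Fs] compact_Times[OF compact_cball compact_cball] F0])
  have Ft: "F \<in> test_functions" using Fs Fc by (simp add: test_functions_iff)
  define G where "G = (\<lambda>(x, t). wave_op F (x, t) - q1 x * F (x, t))"
  have cfst: "continuous_on UNIV (\<lambda>p::spacetime. q (fst p))" if "continuous_on UNIV q" for q :: "space \<Rightarrow> real"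
    by (intro continuous_on_compose2[OF that] continuous_intros) auto
  have "(\<lambda>p. wave_op F p + (- q1 (fst p)) * F p) \<in> Cc"
    by (intro Cc_add wave_op_test Ft Cc_mult Fc continuous_intros cfst c1)
  moreover have "G = (\<lambda>p. wave_op F p + (- q1 (fst p)) * F p)" by (auto simp: G_def)
  ultimately have Gc: "G \<in> Cc" by simp
  \<comment> \<open>The source of u1 sits at the origin, where the cutoff is 1 and the convolution
    takes the value u2 K.\<close>
  have "u1 G = F (0, 0)" using s1 Ft unfolding point_source_solution_def G_def by blast
  also have "F (0, 0) = u2 K" using \<theta>(2)[of 0] by (simp add: F_def \<Phi>_def flip: zero_prod_def)
  finally have uG: "u1 G = u2 K" .
  \<comment> \<open>For t \<ge> 0 the operator with potential q1 applied to the convolution gives K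
    plus the defect caused by q2 - q1; subtracting K leaves the defect. Values of W at negative
    times are harmless, as u1 sees only |x| \<le> t.\<close>
  define W where "W = (\<lambda>p. G p - K p)"
  have "(\<lambda>p. G p + (-1) * K p) \<in> Cc" by (intro Cc_add Cc_mult Gc Kc) auto
  then have Wc: "W \<in> Cc" by (simp add: W_def)
  show thesis
  proof (rule that[OF Wc])
    show "u2 K - u1 K = u1 W" unfolding W_def distribution0_diff[OF d1 Gc Kc] uG ..
    fix x :: space and t :: real assume t: "t \<ge> 0"
    let ?p = "(x, t)"
    let ?k = "\<lambda>q. K (?p + q)"
    have kc: "?k \<in> Cc" by (rule Cc_shift[OF Kc])
    have kt: "?k \<in> test_functions" using kc smooth_shift[OF Ks] by (simp add: test_functions_iff)
    have "open {p::spacetime. snd p > - 1 / 2}"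
      by (intro open_Collect_less continuous_intros)
    then have "wave_op F ?p = wave_op \<Phi> ?p"
      by (rule wave_op_cong_open) (use t \<theta>(2) in \<open>auto simp: F_def\<close>)
    also have "\<dots> = u2 (\<lambda>q. wave_op K (?p + q))"
      unfolding \<Phi>_def by (rule wave_op_conv[OF d2 K])
    also have "\<dots> = u2 (wave_op ?k)" by (simp add: wave_op_shift[OF Ks])
    finally have 1: "wave_op F ?p = u2 (wave_op ?k)" .
    have q2c: "(\<lambda>q. q2 (fst q) * ?k q) \<in> Cc" by (intro Cc_mult kc cfst c2)
    \<comment> \<open>The equation of u2, tested with the translated kernel: its source at the
      origin returns K at the point of translation.\<close>
    have "u2 (\<lambda>(y, s). wave_op ?k (y, s) - q2 y * ?k (y, s)) = ?k (0, 0)"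
      using s2 kt unfolding point_source_solution_def by blast
    moreover have "u2 (\<lambda>(y, s). wave_op ?k (y, s) - q2 y * ?k (y, s)) = u2 (wave_op ?k) - u2 (\<lambda>q. q2 (fst q) * ?k q)"
    proof -
      have "(\<lambda>(y, s). wave_op ?k (y, s) - q2 y * ?k (y, s)) = (\<lambda>q. wave_op ?k q - q2 (fst q) * ?k q)"
        by auto
      then show ?thesis using distribution0_diff[OF d2 wave_op_test[OF kt] q2c] by simp
    qed
    ultimately have 2: "u2 (wave_op ?k) = K ?p + u2 (\<lambda>q. q2 (fst q) * ?k q)" by simp
    have q1c: "(\<lambda>q. q1 x * ?k q) \<in> Cc" by (intro Cc_mult kc) auto
    have "u2 (\<lambda>(y, s). (q2 y - q1 x) * K (x + y, t + s)) = u2 (\<lambda>q. q2 (fst q) * ?k q - q1 x * ?k q)"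
      by (intro arg_cong[of _ _ u2] ext) (auto simp: algebra_simps)
    also have "\<dots> = u2 (\<lambda>q. q2 (fst q) * ?k q) - q1 x * u2 ?k"
      by (simp only: distribution0_diff[OF d2 q2c q1c] distribution0_cmult[OF d2 kc])
    finally have 3: "u2 (\<lambda>(y, s). (q2 y - q1 x) * K (x + y, t + s)) = u2 (\<lambda>q. q2 (fst q) * ?k q) - q1 x * u2 ?k" .
    have "F ?p = u2 ?k" using \<theta>(2)[of t] t by (simp add: F_def \<Phi>_def)
    then show "W ?p = u2 (\<lambda>(y, s). (q2 y - q1 x) * K (x + y, t + s))"
      unfolding 3 by (simp add: W_def G_def 1 2)
  qed
qed

section \<open>Mollification of kernels singular at the two foci\<close>

lemma partial_fractions:
  fixes a b c :: real
  assumes "a > 0" "b > 0"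
  shows "c / (a + b) / a + c / (a + b) / b = c / (a * b)"
proof -
  have "c / (a + b) / a + c / (a + b) / b = c / (a + b) * ((a + b) / (a * b))"
    using assms by (simp add: add_divide_distrib distrib_left mult.commute)
  then show ?thesis using assms by simp
qed

section \<open>Translations, reflections and integrability against 1/|x|\<close>

lemma integral_lborel_shift:
  fixes f :: "'a::euclidean_space \<Rightarrow> real"
  assumes "f \<in> borel_measurable borel"
  shows "(LINT x|lborel. f (c + x)) = (LINT x|lborel. f x)"
proof -
  have "(LINT x|distr lborel borel ((+) c). f x) = (LINT x|lborel. f (c + x))"
    by (rule integral_distr) (use assms in auto)
  then show ?thesis by (simp add: lborel_distr_plus)
qed

lemma integral_lborel_reflect:
  fixes f :: "'a::euclidean_space \<Rightarrow> real"
  assumes "f \<in> borel_measurable borel"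
  shows "(LINT x|lborel. f (c - x)) = (LINT x|lborel. f x)"
proof -
  have "(lborel :: 'a measure) = distr lborel borel (\<lambda>x. c + (-1) *\<^sub>R x)"
    by (subst lborel_affine[of "-1" c]) (auto simp: density_1)
  then have "(LINT x|lborel. f x) = (LINT x|distr lborel borel (\<lambda>x. c + (-1) *\<^sub>R x). f x)" by simp
  also have "\<dots> = (LINT x|lborel. f (c + (-1) *\<^sub>R x))"
    by (rule integral_distr) (use assms in auto)
  finally show ?thesis by simp
qed

lemma integrable_lborel_reflect:
  fixes f :: "'a::euclidean_space \<Rightarrow> real"
  assumes "integrable lborel f"
  shows "integrable lborel (\<lambda>x. f (c - x))"
proof -
  have "(lborel :: 'a measure) = distr lborel borel (\<lambda>x. c + (-1) *\<^sub>R x)"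
    by (subst lborel_affine[of "-1" c]) (auto simp: density_1)
  then have "integrable (distr lborel borel (\<lambda>x. c + (-1) *\<^sub>R x)) f" using assms by simp
  then have "integrable lborel (\<lambda>x. f (c + (-1) *\<^sub>R x))"
    by (rule integrable_distr[rotated]) simp
  then show ?thesis by simp
qed

lemma AE_lborel_neq: "AE x in lborel. x \<noteq> (c :: 'a::euclidean_space)"
  by (rule AE_I[of _ _ "{c}"]) auto

lemma continuous_bounded_compact_support:
  fixes f :: "'a::topological_space \<Rightarrow> real"
  assumes "continuous_on A f" "compact A" "\<And>p. p \<notin> A \<Longrightarrow> f p = 0"
  obtains M where "M > 0" "\<And>p. \<bar>f p\<bar> \<le> M"
proof -
  have "bounded (f ` A)" using assms by (intro compact_imp_bounded compact_continuous_image)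
  then obtain M where M: "M > 0" "\<And>x. x \<in> A \<Longrightarrow> \<bar>f x\<bar> \<le> M"
    unfolding bounded_pos by auto
  show thesis
  proof (rule that[OF M(1)])
    fix p show "\<bar>f p\<bar> \<le> M" using M assms(3)[of p] by (cases "p \<in> A") auto
  qed
qed

lemma integrable_mult_pair:
  fixes f :: "'a \<Rightarrow> real" and g :: "'b \<Rightarrow> real"
  assumes "sigma_finite_measure M" "sigma_finite_measure N" and f: "integrable M f" and g: "integrable N g"
  shows "integrable (M \<Otimes>\<^sub>M N) (\<lambda>(x, y). f x * g y)"
proof -
  interpret M: sigma_finite_measure M by fact
  interpret N: sigma_finite_measure N by fact
  interpret pair_sigma_finite M N ..
  show ?thesis
  proof (rule Fubini_integrable)
    show "(\<lambda>(x, y). f x * g y) \<in> borel_measurable (M \<Otimes>\<^sub>M N)"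
      using borel_measurable_times[OF measurable_compose[OF measurable_fst borel_measurable_integrable[OF f]]
          measurable_compose[OF measurable_snd borel_measurable_integrable[OF g]]]
      by (simp add: case_prod_beta')
    show "integrable M (\<lambda>x. LINT y|N. norm (case (x, y) of (x, y) \<Rightarrow> f x * g y))"
      using f g by (auto simp: abs_mult)
    show "AE x in M. integrable N (\<lambda>y. case (x, y) of (x, y) \<Rightarrow> f x * g y)"
      using g by auto
  qed
qed

text \<open>Dyadic domination: on the shell R/2^(n+1) < |x| \<le> R/2^n one has 1/|x| \<le>
  2^(n+1)/R, and the ball of radius R/2^n has volume V (R/2^n)^3, so the n-th term integrates to 2 V
  R^2 / 4^n, a geometric series.\<close>

lemma inverse_norm_integrable_cball:
  assumes R: "R > 0"
  shows "integrable lborel (\<lambda>x::space. indicator (cball 0 R) x / norm x)"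
proof (rule integrableI_bounded)
  define V where "V = unit_ball_vol 3"
  have V: "V \<ge> 0" by (simp add: V_def)
  define g :: "nat \<Rightarrow> space \<Rightarrow> ennreal" where
    "g n x = ennreal (2 ^ (n + 1) / R) * indicator (cball 0 (R / 2 ^ n)) x" for n x
  have le: "ennreal (norm (indicator (cball 0 R) x / norm x)) \<le> (\<Sum>n. g n x)" for x :: space
  proof (cases "x \<noteq> 0 \<and> norm x \<le> R")
    case True
    define P where "P n \<longleftrightarrow> norm x > R / 2 ^ (n + 1)" for n
    have "\<exists>n. P n"
    proof -
      obtain n where "R / norm x < 2 ^ n" using real_arch_pow[of 2 "R / norm x"] by auto
      also have "\<dots> \<le> 2 ^ (n + 1)" by simp
      finally show ?thesis using True R unfolding P_def by (intro exI[of _ n]) (simp add: field_simps)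
    qed
    \<comment> \<open>The index of the shell of x: the least n with |x| > R/2^(n+1). Leastness
      supplies the upper bound R/2^n.\<close>
    define n where "n = (LEAST n. P n)"
    have Pn: "P n" unfolding n_def using \<open>\<exists>n. P n\<close> by (rule LeastI_ex)
    have le: "norm x \<le> R / 2 ^ n"
    proof (cases n)
      case 0
      then show ?thesis using True by simp
    next
      case (Suc m)
      then have "\<not> P m" using not_less_Least[of m P] by (simp add: n_def)
      then show ?thesis by (simp add: P_def Suc)
    qed
    have "1 / norm x \<le> 2 ^ (n + 1) / R"
      using Pn True R unfolding P_def by (simp add: field_simps)
    then have "ennreal (norm (indicator (cball 0 R) x / norm x)) \<le> g n x"
      using True le by (simp add: g_def ennreal_leI)
    also have "g n x = sum (\<lambda>n. g n x) {n}" by simp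
    also have "\<dots> \<le> (\<Sum>n. g n x)" by (rule sum_le_suminf) auto
    finally show ?thesis .
  qed auto
  have nn: "(\<integral>\<^sup>+x. g n x \<partial>lborel) = ennreal (2 * V * R\<^sup>2 * (1 / 4) ^ n)" for n
  proof -
    have "(\<integral>\<^sup>+x. g n x \<partial>lborel) = ennreal (2 ^ (n + 1) / R) * emeasure lborel (cball (0::space) (R / 2 ^ n))"
      unfolding g_def by (rule nn_integral_cmult_indicator) simp
    also have "\<dots> = ennreal (2 ^ (n + 1) / R * (V * (R / 2 ^ n) ^ 3))"
    proof -
      have "emeasure lborel (cball (0::space) (R / 2 ^ n)) = ennreal (V * (R / 2 ^ n) ^ 3)"
        using R by (subst emeasure_cball) (auto simp: V_def)
      then show ?thesis using R V by (subst ennreal_mult) auto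
    qed
    also have "2 ^ (n + 1) / R * (V * (R / 2 ^ n) ^ 3) = 2 * V * R\<^sup>2 * (1 / 4) ^ n"
    proof -
      have "(2::real) ^ n * 2 ^ n = 4 ^ n" by (simp flip: power_mult_distrib)
      then have "(1 / 4::real) ^ n = 1 / (2 ^ n * 2 ^ n)" by (simp add: power_divide)
      then show ?thesis using R by (simp add: power2_eq_square power3_eq_cube field_simps)
    qed
    finally show ?thesis .
  qed
  have "(\<integral>\<^sup>+x. ennreal (norm (indicator (cball 0 R) x / norm x)) \<partial>(lborel :: space measure)) \<le> (\<integral>\<^sup>+x. (\<Sum>n. g n x) \<partial>lborel)"
    by (intro nn_integral_mono le)
  also have "\<dots> = (\<Sum>n. \<integral>\<^sup>+x. g n x \<partial>lborel)"
    by (rule nn_integral_suminf) (unfold g_def, intro borel_measurable_times_ennreal borel_measurable_const borel_measurable_indicator, simp)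
  also have "\<dots> = (\<Sum>n. ennreal (2 * V * R\<^sup>2 * (1 / 4) ^ n))" by (simp add: nn)
  also have "\<dots> = ennreal (\<Sum>n. 2 * V * R\<^sup>2 * (1 / 4) ^ n)"
    using V by (intro suminf_ennreal2) (auto intro!: summable_mult summable_geometric)
  also have "\<dots> < \<infinity>" by simp
  finally show "(\<integral>\<^sup>+x. ennreal (norm (indicator (cball 0 R) x / norm x)) \<partial>(lborel :: space measure)) < \<infinity>" .
qed (simp, intro borel_measurable_divide borel_measurable_indicator borel_measurable_norm measurable_ident; simp)

lemma borel_measurable_over_norm:
  fixes f :: "'a::euclidean_space \<Rightarrow> real"
  assumes "f \<in> borel_measurable lborel"
  shows "(\<lambda>x. f x / norm x) \<in> borel_measurable lborel"
  using assms by (intro borel_measurable_divide borel_measurable_norm) simp_all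

lemma integrable_over_norm:
  assumes h: "h \<in> borel_measurable lborel" and M: "\<And>x. \<bar>h x\<bar> \<le> M" and R: "\<And>x. norm x > R \<Longrightarrow> h x = 0"
  shows "integrable lborel (\<lambda>x::space. h x / norm x)"
proof (rule Bochner_Integration.integrable_bound)
  let ?R = "\<bar>R\<bar> + 1"
  show "integrable lborel (\<lambda>x::space. M * (indicator (cball 0 ?R) x / norm x))"
    by (intro integrable_mult_right inverse_norm_integrable_cball) auto
  show "(\<lambda>x. h x / norm x) \<in> borel_measurable lborel" by (rule borel_measurable_over_norm[OF h])
  have M0: "M \<ge> 0" using M[of 0] by linarith
  have "norm (h x / norm x) \<le> norm (M * (indicator (cball 0 ?R) x / norm x))" for x
    using M[of x] R[of x] M0 by (cases "norm x \<le> ?R") (auto simp: divide_right_mono)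
  then show "AE x in lborel. norm (h x / norm x) \<le> norm (M * (indicator (cball 0 ?R) x / norm x))" by simp
qed

lemma integrable_compact_support:
  fixes f :: "'a::euclidean_space \<Rightarrow> real"
  assumes "continuous_on UNIV f" "compact A" "\<And>x. x \<notin> A \<Longrightarrow> f x = 0"
  shows "integrable lborel f"
proof -
  have "integrable lborel (\<lambda>x. indicator A x *\<^sub>R f x)"
    using assms by (intro borel_integrable_compact continuous_on_subset[OF assms(1)]) auto
  also have "(\<lambda>x. indicator A x *\<^sub>R f x) = f" using assms(3) by (auto simp: indicator_def fun_eq_iff)
  finally show ?thesis .
qed

lemma integrable_pair_over_norm:
  fixes h :: "space \<times> space \<Rightarrow> real"
  assumes h: "continuous_on UNIV h" and A: "compact A" "\<And>p. p \<notin> A \<Longrightarrow> h p = 0"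
  shows "integrable (lborel \<Otimes>\<^sub>M lborel) (\<lambda>(x, y). h (x, y) / norm x)"
proof -
  obtain M where M: "M > 0" "\<And>p. \<bar>h p\<bar> \<le> M"
    using continuous_bounded_compact_support[OF continuous_on_subset[OF h] A] by blast
  obtain R where R: "R > 0" "\<And>p. p \<in> A \<Longrightarrow> norm p \<le> R"
    using compact_imp_bounded[OF A(1)] unfolding bounded_pos by auto
  have h0: "h (x, y) = 0" if "x \<notin> cball 0 R \<or> y \<notin> cball 0 R" for x y
    using that A(2)[of "(x, y)"] R(2)[of "(x, y)"] norm_fst_le[of x y] norm_snd_le[of y x] by force
  have meas: "(\<lambda>(x, y). h (x, y) / norm x) \<in> borel_measurable (lborel \<Otimes>\<^sub>M lborel)"
  proof -
    have "(\<lambda>p. h p / norm (fst p)) \<in> borel_measurable borel"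
      by (intro borel_measurable_divide borel_measurable_continuous_onI h continuous_intros)
    then show ?thesis unfolding lborel_prod by (simp add: case_prod_beta')
  qed
  have dom: "integrable (lborel \<Otimes>\<^sub>M lborel)
      (\<lambda>(x::space, y::space). M * (indicator (cball 0 R) x / norm x) * indicator (cball 0 R) y)"
    using R(1) emeasure_lborel_cball_finite[of "0::space" R]
    by (intro integrable_mult_pair integrable_mult_right inverse_norm_integrable_cball sigma_finite_lborel)
      auto
  show ?thesis
  proof (rule Bochner_Integration.integrable_bound[OF dom meas], rule AE_I2, clarify)
    fix x y :: space
    show "norm (h (x, y) / norm x) \<le> norm (M * (indicator (cball 0 R) x / norm x) * indicator (cball 0 R) y)"
      using h0[of x y] M(1) M(2)[of "(x, y)"]
      by (cases "x \<in> cball 0 R \<and> y \<in> cball 0 R") (auto simp: divide_right_mono)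
  qed
qed

text \<open>Continuity is what the limit lemmas use; smoothness is demanded separately where these
  functions enter a test kernel. The radius 1/(n + 1) makes sense for every index.\<close>

definition mollifier :: "(nat \<Rightarrow> space \<Rightarrow> real) \<Rightarrow> bool" where
  "mollifier \<beta> \<longleftrightarrow> (\<forall>n. continuous_on UNIV (\<beta> n) \<and> (\<forall>z. \<beta> n z \<ge> 0) \<and>
     (\<forall>z. norm z \<ge> 1 / real (n + 1) \<longrightarrow> \<beta> n z = 0) \<and> (LINT z|lborel. \<beta> n z) = 1)"

section \<open>Limits of mollified integrals\<close>

context
  fixes \<beta> assumes \<beta>: "mollifier \<beta>"
begin

lemma mollifier_cont: "continuous_on UNIV (\<beta> n)"
  and mollifier_nonneg: "\<beta> n z \<ge> 0"
  and mollifier_zero: "norm z \<ge> 1 / real (n + 1) \<Longrightarrow> \<beta> n z = 0"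
  and mollifier_integral: "(LINT z|lborel. \<beta> n z) = 1"
  using \<beta> unfolding mollifier_def by auto

lemma mollifier_cont_comp: "continuous_on S f \<Longrightarrow> continuous_on S (\<lambda>x. \<beta> n (f x))"
  by (rule continuous_on_compose2[OF mollifier_cont]) auto

lemma mollifier_shift:
  shows "integrable lborel (\<lambda>y. \<beta> n (y - c))" "(LINT y|lborel. \<beta> n (y - c)) = 1"
proof -
  have "\<beta> n (y - c) = 0" if "y \<notin> cball c 1" for y
  proof (rule mollifier_zero)
    have "1 / real (n + 1) \<le> 1" by simp
    moreover have "1 < norm (y - c)" using that by (simp add: dist_norm norm_minus_commute)
    ultimately show "1 / real (n + 1) \<le> norm (y - c)" by linarith
  qed
  then show "integrable lborel (\<lambda>y. \<beta> n (y - c))"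
    by (intro integrable_compact_support[of _ "cball c 1"] mollifier_cont_comp continuous_intros) auto
  show "(LINT y|lborel. \<beta> n (y - c)) = 1"
    using integral_lborel_shift[of "\<beta> n" "- c"] mollifier_integral mollifier_cont
    by (simp add: borel_measurable_continuous_onI)
qed

lemma mollifier_integrable_mult:
  assumes "continuous_on UNIV k"
  shows "integrable lborel (\<lambda>y. k y * \<beta> n (y - c))"
proof -
  have "\<beta> n (y - c) = 0" if "y \<notin> cball c 1" for y
  proof (rule mollifier_zero)
    have "1 / real (n + 1) \<le> 1" by simp
    moreover have "1 < norm (y - c)" using that by (simp add: dist_norm norm_minus_commute)
    ultimately show "1 / real (n + 1) \<le> norm (y - c)" by linarith
  qed
  then show ?thesis
    by (intro integrable_compact_support[of _ "cball c 1"] continuous_intros mollifier_cont_comp assms) auto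
qed

lemma mollifier_bound:
  assumes k: "continuous_on UNIV k" and "\<And>y. norm (y - c) < 1 / real (n + 1) \<Longrightarrow> \<bar>k y\<bar> \<le> M"
  shows "\<bar>LINT y|lborel. k y * \<beta> n (y - c)\<bar> \<le> M"
proof -
  have "\<bar>LINT y|lborel. k y * \<beta> n (y - c)\<bar> \<le> (LINT y|lborel. M * \<beta> n (y - c))"
  proof (rule integral_abs_bound_integral)
    show "integrable lborel (\<lambda>y. k y * \<beta> n (y - c))" by (rule mollifier_integrable_mult[OF k])
    show "integrable lborel (\<lambda>y. M * \<beta> n (y - c))" by (intro integrable_mult_right mollifier_shift)
    fix y
    show "\<bar>k y * \<beta> n (y - c)\<bar> \<le> M * \<beta> n (y - c)"
      using assms(2)[of y] mollifier_zero[of n "y - c"] mollifier_nonneg[of n "y - c"]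
      by (cases "norm (y - c) < 1 / real (n + 1)") (auto simp: abs_mult intro: mult_right_mono)
  qed
  also have "\<dots> = M" by (simp add: mollifier_shift)
  finally show ?thesis .
qed

lemma mollifier_limit:
  assumes k: "continuous_on UNIV k"
  shows "(\<lambda>n. LINT y|lborel. k y * \<beta> n (y - c)) \<longlonglongrightarrow> k c"
proof (rule LIMSEQ_I)
  fix r :: real assume r: "r > 0"
  have "isCont k c" using k by (simp add: continuous_on_eq_continuous_at)
  then obtain d where d: "d > 0" "\<And>y. norm (y - c) < d \<Longrightarrow> \<bar>k y - k c\<bar> < r / 2"
    unfolding continuous_at_eps_delta dist_norm real_norm_def using r by (metis half_gt_zero)
  obtain N where N: "1 / real (N + 1) < d" using reals_Archimedean[OF d(1)] by (auto simp: inverse_eq_divide)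
  show "\<exists>no. \<forall>n\<ge>no. norm ((LINT y|lborel. k y * \<beta> n (y - c)) - k c) < r"
  proof (intro exI[of _ N] allI impI)
    fix n assume n: "n \<ge> N"
    have nd: "1 / real (n + 1) \<le> 1 / real (N + 1)" using n by (intro divide_left_mono) auto
    have "(LINT y|lborel. k y * \<beta> n (y - c)) - k c = (LINT y|lborel. k y * \<beta> n (y - c)) - (LINT y|lborel. k c * \<beta> n (y - c))"
      by (simp add: mollifier_shift)
    also have "\<dots> = (LINT y|lborel. (k y - k c) * \<beta> n (y - c))"
      using mollifier_integrable_mult[OF k] mollifier_shift(1)
      by (subst Bochner_Integration.integral_diff[symmetric]) (auto simp: algebra_simps)
    finally have eq: "(LINT y|lborel. k y * \<beta> n (y - c)) - k c = (LINT y|lborel. (k y - k c) * \<beta> n (y - c))" .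
    have "\<bar>LINT y|lborel. (k y - k c) * \<beta> n (y - c)\<bar> \<le> r / 2"
    proof (rule mollifier_bound)
      show "continuous_on UNIV (\<lambda>y. k y - k c)" by (intro continuous_intros k)
      show "\<bar>k y - k c\<bar> \<le> r / 2" if "norm (y - c) < 1 / real (n + 1)" for y
        using d(2)[of y] that nd N by auto
    qed
    then show "norm ((LINT y|lborel. k y * \<beta> n (y - c)) - k c) < r"
      unfolding eq using r by simp
  qed
qed

text \<open>For fixed x the bump in y concentrates at e - x. The inner average is bounded by sup |h|
  and vanishes for large x, so a multiple of 1/|x| on a ball dominates.\<close>

lemma mollifier_integral_limit:
  fixes h :: "space \<times> space \<Rightarrow> real"
  assumes h: "continuous_on UNIV h" and A: "compact A" "\<And>p. p \<notin> A \<Longrightarrow> h p = 0"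
  shows "(\<lambda>n. LINT x|lborel. (LINT y|lborel. h (x, y) * \<beta> n (x + y - e)) / norm x)
      \<longlonglongrightarrow> (LINT x|lborel. h (x, e - x) / norm x)"
proof -
  obtain M where M: "M > 0" "\<And>p. \<bar>h p\<bar> \<le> M"
    using continuous_bounded_compact_support[OF continuous_on_subset[OF h] A] by blast
  obtain R where R: "R > 0" "\<And>p. p \<in> A \<Longrightarrow> norm p \<le> R"
    using compact_imp_bounded[OF A(1)] unfolding bounded_pos by auto
  have h0: "h (x, y) = 0" if "x \<notin> cball 0 R" for x y
    using that A(2)[of "(x, y)"] R(2)[of "(x, y)"] norm_fst_le[of x y] by force
  have hx: "continuous_on UNIV (\<lambda>y. h (x, y))" for x
    by (intro continuous_on_compose2[OF h] continuous_intros) auto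
  have arg: "x + y - e = y - (e - x)" for x y by simp
  show ?thesis
  proof (rule integral_dominated_convergence[where w = "\<lambda>x. M * (indicator (cball 0 R) x / norm x)"])
    show "integrable lborel (\<lambda>x::space. M * (indicator (cball 0 R) x / norm x))"
      using R(1) by (intro integrable_mult_right inverse_norm_integrable_cball)
    have "continuous_on UNIV (\<lambda>x. h (x, e - x))"
      by (intro continuous_on_compose2[OF h] continuous_intros) auto
    from borel_measurable_continuous_onI[OF this]
    show "(\<lambda>x. h (x, e - x) / norm x) \<in> borel_measurable lborel"
      by (intro borel_measurable_over_norm) simp
    fix n
    have "continuous_on UNIV (\<lambda>p. h p * \<beta> n (fst p + snd p - e))"
      by (intro continuous_intros mollifier_cont_comp h)
    then have "(\<lambda>p. h p * \<beta> n (fst p + snd p - e)) \<in> borel_measurable (lborel \<Otimes>\<^sub>M lborel)"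
      unfolding lborel_prod using borel_measurable_continuous_onI by auto
    then have "(\<lambda>(x, y). h (x, y) * \<beta> n (x + y - e)) \<in> borel_measurable (lborel \<Otimes>\<^sub>M lborel)"
      by (simp add: case_prod_beta')
    from lborel.borel_measurable_lebesgue_integral[OF this]
    show "(\<lambda>x. (LINT y|lborel. h (x, y) * \<beta> n (x + y - e)) / norm x) \<in> borel_measurable lborel"
      by (rule borel_measurable_over_norm)
    have "norm ((LINT y|lborel. h (x, y) * \<beta> n (x + y - e)) / norm x) \<le> M * (indicator (cball 0 R) x / norm x)" for x
    proof (cases "x \<in> cball 0 R")
      case True
      have "\<bar>LINT y|lborel. h (x, y) * \<beta> n (x + y - e)\<bar> \<le> M"
        unfolding arg by (rule mollifier_bound[OF hx]) (rule M(2))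
      then show ?thesis using True by (simp add: divide_right_mono)
    next
      case False
      then show ?thesis by (simp add: h0)
    qed
    then show "AE x in lborel. norm ((LINT y|lborel. h (x, y) * \<beta> n (x + y - e)) / norm x) \<le> M * (indicator (cball 0 R) x / norm x)"
      by simp
  next
    show "AE x in lborel. (\<lambda>n. (LINT y|lborel. h (x, y) * \<beta> n (x + y - e)) / norm x) \<longlonglongrightarrow> h (x, e - x) / norm x"
    proof (rule AE_mp[OF AE_lborel_neq[of 0]], rule AE_I2, rule impI)
      fix x :: space assume "x \<noteq> 0"
      then show "(\<lambda>n. (LINT y|lborel. h (x, y) * \<beta> n (x + y - e)) / norm x) \<longlonglongrightarrow> h (x, e - x) / norm x"
        unfolding arg by (intro tendsto_divide tendsto_const mollifier_limit[OF hx]) auto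
    qed
  qed
qed

lemma mollifier_double_limit:
  fixes g :: "space \<times> space \<Rightarrow> real"
  assumes g: "continuous_on UNIV g" and A: "compact A" "\<And>p. p \<notin> A \<Longrightarrow> g p = 0" and e: "norm e = 1"
  shows "(\<lambda>n. LINT x|lborel. (LINT y|lborel. g (x, y) * \<beta> n (x + y - e) / norm y) / norm x)
      \<longlonglongrightarrow> (LINT x|lborel. g (x, e - x) / (norm x * norm (e - x)))"
proof -
  \<comment> \<open>\<open>1/(ab) = (1/a + 1/b)/(a + b)\<close> separates the two singularities; on the support of the
    mollifier \<open>|x| + |y| \<ge> 1/2\<close>, so the truncation by \<open>1/2\<close> is harmless.\<close>
  define h where "h p = g p / max (norm (fst p) + norm (snd p)) (1 / 2)" for p
  \<comment> \<open>Swapping the coordinates turns the term singular at y = 0 into one singular at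
    the outer variable, the form that \<open>mollifier_integral_limit\<close> handles.\<close>
  define h' where "h' p = h (snd p, fst p)" for p
  have h: "continuous_on UNIV h"
    unfolding h_def by (intro continuous_intros g) (auto simp: max_def split: if_splits)
  have hA: "h p = 0" if "p \<notin> A" for p using A(2)[OF that] by (simp add: h_def)
  have h': "continuous_on UNIV h'"
    unfolding h'_def by (intro continuous_on_compose2[OF h] continuous_intros) auto
  let ?A' = "(\<lambda>p. (snd p, fst p)) ` A"
  have A': "compact ?A'"
    using A(1) by (intro compact_continuous_image continuous_intros)
  have h'A: "h' p = 0" if "p \<notin> ?A'" for p
    unfolding h'_def using that by (intro hA) force
  have lim1: "(\<lambda>n. LINT x|lborel. (LINT y|lborel. h (x, y) * \<beta> n (x + y - e)) / norm x)
      \<longlonglongrightarrow> (LINT x|lborel. h (x, e - x) / norm x)"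
    by (rule mollifier_integral_limit[OF h A(1) hA])
  have lim2: "(\<lambda>n. LINT x|lborel. (LINT y|lborel. h' (x, y) * \<beta> n (x + y - e)) / norm x)
      \<longlonglongrightarrow> (LINT x|lborel. h' (x, e - x) / norm x)"
    by (rule mollifier_integral_limit[OF h' A' h'A])
  have cm: "(\<lambda>x. h (x, e - x)) \<in> borel_measurable borel" "(\<lambda>x. h' (x, e - x)) \<in> borel_measurable borel"
    by (intro borel_measurable_continuous_onI continuous_on_compose2[OF h] continuous_on_compose2[OF h'] continuous_intros; auto)+
  obtain R where R: "R > 0" "\<And>p. p \<in> A \<Longrightarrow> norm p \<le> R"
    using compact_imp_bounded[OF A(1)] unfolding bounded_pos by auto
  have h0: "h (x, y) = 0" if "norm x > R \<or> norm y > R" for x y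
    using that hA[of "(x, y)"] R(2)[of "(x, y)"] norm_fst_le[of x y] norm_snd_le[of y x] by force
  obtain M where M: "M > 0" "\<And>p. \<bar>h p\<bar> \<le> M"
    using continuous_bounded_compact_support[OF continuous_on_subset[OF h] A(1) hA] by blast
  have fin: "(LINT x|lborel. h (x, e - x) / norm x) + (LINT x|lborel. h' (x, e - x) / norm x)
      = (LINT x|lborel. g (x, e - x) / (norm x * norm (e - x)))"
  proof -
    have i1: "integrable lborel (\<lambda>x. h (x, e - x) / norm x)"
      by (rule integrable_over_norm[of _ M R]) (use cm M h0 in auto)
    have m: "(\<lambda>x. h' (x, e - x) / norm x) \<in> borel_measurable borel"
      using borel_measurable_over_norm[of "\<lambda>x. h' (x, e - x)"] cm by simp
    have r: "(LINT x|lborel. h' (x, e - x) / norm x) = (LINT x|lborel. h (x, e - x) / norm (e - x))"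
      using integral_lborel_reflect[OF m, of e] by (simp add: h'_def)
    have i2: "integrable lborel (\<lambda>x. h (x, e - x) / norm (e - x))"
    proof -
      have "integrable lborel (\<lambda>x. h' (x, e - x) / norm x)"
        by (rule integrable_over_norm[of _ M R]) (use cm M h0 in \<open>auto simp: h'_def\<close>)
      from integrable_lborel_reflect[OF this, of e]
      show ?thesis by (simp add: h'_def)
    qed
    have "(LINT x|lborel. h (x, e - x) / norm x) + (LINT x|lborel. h (x, e - x) / norm (e - x))
      = (LINT x|lborel. h (x, e - x) / norm x + h (x, e - x) / norm (e - x))"
      by (rule Bochner_Integration.integral_add[OF i1 i2, symmetric])
    also have "\<dots> = (LINT x|lborel. g (x, e - x) / (norm x * norm (e - x)))"
    proof (rule integral_cong_AE)
      have "(\<lambda>x. g (x, e - x)) \<in> borel_measurable borel"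
        by (intro borel_measurable_continuous_onI continuous_on_compose2[OF g] continuous_intros) auto
      then show "(\<lambda>x. g (x, e - x) / (norm x * norm (e - x))) \<in> borel_measurable lborel"
        using borel_measurable_continuous_onI[of "\<lambda>x. norm x * norm (e - x)"]
        by (intro borel_measurable_divide) (auto intro!: continuous_intros)
      show "(\<lambda>x. h (x, e - x) / norm x + h (x, e - x) / norm (e - x)) \<in> borel_measurable lborel"
        using borel_measurable_integrable[OF i1] borel_measurable_integrable[OF i2] by (rule borel_measurable_add)
      show "AE x in lborel. h (x, e - x) / norm x + h (x, e - x) / norm (e - x) = g (x, e - x) / (norm x * norm (e - x))"
        using AE_lborel_neq[of 0] AE_lborel_neq[of e]
      proof eventually_elim
        fix x :: space assume x: "x \<noteq> 0" "x \<noteq> e"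
        \<comment> \<open>On the limiting set y = e - x the sum of norms is at least |e| = 1, so the
          truncation in \<open>h\<close> is inactive.\<close>
        have w: "norm x + norm (e - x) \<ge> 1"
          using norm_triangle_ineq[of x "e - x"] e by simp
        have pos: "norm x > 0" "norm (e - x) > 0" using x by auto
        show "h (x, e - x) / norm x + h (x, e - x) / norm (e - x) = g (x, e - x) / (norm x * norm (e - x))"
          using w partial_fractions[OF pos] by (simp add: h_def max_def)
      qed
    qed
    finally show ?thesis unfolding r .
  qed
  \<comment> \<open>From index 1 on the bump has radius at most 1/2, so on its support |x| + |y|
    \<ge> |x + y| \<ge> 1 - 1/2.\<close>
  have step: "(LINT x|lborel. (LINT y|lborel. g (x, y) * \<beta> n (x + y - e) / norm y) / norm x)
    = (LINT x|lborel. (LINT y|lborel. h (x, y) * \<beta> n (x + y - e)) / norm x)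
      + (LINT x|lborel. (LINT y|lborel. h' (x, y) * \<beta> n (x + y - e)) / norm x)" if n: "n \<ge> 1" for n
  proof -
    define F where "F p = h p * \<beta> n (fst p + snd p - e)" for p
    define F' where "F' p = h' p * \<beta> n (fst p + snd p - e)" for p
    have F: "continuous_on UNIV F" "\<And>p. p \<notin> A \<Longrightarrow> F p = 0"
      using hA unfolding F_def by (auto intro!: continuous_intros mollifier_cont_comp h)
    have F': "continuous_on UNIV F'" "\<And>p. p \<notin> ?A' \<Longrightarrow> F' p = 0"
      using h'A unfolding F'_def by (auto intro!: continuous_intros mollifier_cont_comp h')
    have FF': "F' (y, x) = F (x, y)" for x y by (simp add: F_def F'_def h'_def add.commute)
    have F0: "F (x, y) = 0" if "norm x > R \<or> norm y > R" for x y using h0[OF that] by (simp add: F_def)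
    obtain N where N: "N > 0" "\<And>p. \<bar>F p\<bar> \<le> N"
      using continuous_bounded_compact_support[OF continuous_on_subset[OF F(1)] A(1) F(2)] by blast
    have I: "integrable (lborel \<Otimes>\<^sub>M lborel) (\<lambda>(x, y). F (x, y) / norm x)"
      by (rule integrable_pair_over_norm[OF F(1) A(1) F(2)])
    have I': "integrable (lborel \<Otimes>\<^sub>M lborel) (\<lambda>(x, y). F' (x, y) / norm x)"
      by (rule integrable_pair_over_norm[OF F'(1) A' F'(2)])
    have I'': "integrable (lborel \<Otimes>\<^sub>M lborel) (\<lambda>(x, y). F (x, y) / norm y)"
      using lborel_pair.integrable_product_swap[OF I'] by (simp add: FF' case_prod_beta')
    have Fx: "continuous_on UNIV (\<lambda>y. F (x, y))" for x
      by (intro continuous_on_compose2[OF F(1)] continuous_intros) auto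
    have inner: "(LINT y|lborel. g (x, y) * \<beta> n (x + y - e) / norm y) / norm x
      = (LINT y|lborel. F (x, y) / norm x) + (LINT y|lborel. F (x, y) / norm y)" if x: "x \<noteq> 0" for x
    proof -
      have a: "integrable lborel (\<lambda>y. F (x, y) / norm x)"
        by (intro integrable_divide integrable_compact_support[OF Fx, of "cball 0 R"]) (auto intro: F0)
      have b: "integrable lborel (\<lambda>y. F (x, y) / norm y)"
        by (rule integrable_over_norm[of _ N R])
          (use Fx N F0 in \<open>auto intro: borel_measurable_continuous_onI\<close>)
      have "(LINT y|lborel. F (x, y) / norm x) + (LINT y|lborel. F (x, y) / norm y)
        = (LINT y|lborel. F (x, y) / norm x + F (x, y) / norm y)"
        by (rule Bochner_Integration.integral_add[OF a b, symmetric])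
      also have "\<dots> = (LINT y|lborel. g (x, y) * \<beta> n (x + y - e) / norm y / norm x)"
      proof (rule integral_cong_AE)
        have "(\<lambda>y. g (x, y)  * \<beta> n (x + y - e)) \<in> borel_measurable borel"
          by (intro borel_measurable_continuous_onI continuous_intros mollifier_cont_comp continuous_on_compose2[OF g]) auto
        then show "(\<lambda>y. g (x, y) * \<beta> n (x + y - e) / norm y / norm x) \<in> borel_measurable lborel"
          by (intro borel_measurable_divide[OF borel_measurable_over_norm] borel_measurable_const) simp
        show "(\<lambda>y. F (x, y) / norm x + F (x, y) / norm y) \<in> borel_measurable lborel"
          using a b by (intro borel_measurable_add borel_measurable_integrable)
        show "AE y in lborel. F (x, y) / norm x + F (x, y) / norm y = g (x, y) * \<beta> n (x + y - e) / norm y / norm x"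
          using AE_lborel_neq[of 0]
        proof eventually_elim
          fix y :: space assume y: "y \<noteq> 0"
          show "F (x, y) / norm x + F (x, y) / norm y = g (x, y) * \<beta> n (x + y - e) / norm y / norm x"
          proof (cases "norm (x + y - e) < 1 / 2")
            case True
            have "1 \<le> norm (x + y) + norm (x + y - e)"
              using norm_triangle_ineq4[of "x + y" "x + y - e"] e by simp
            then have "norm x + norm y \<ge> 1 / 2" using True norm_triangle_ineq[of x y] by linarith
            moreover have "norm x > 0" "norm y > 0" using x y by auto
            ultimately show ?thesis
              using partial_fractions[of "norm x" "norm y" "g (x, y) * \<beta> n (x + y - e)"]
              by (simp add: F_def h_def max_absorb1 mult.commute)
          next
            case False
            have "1 / real (n + 1) \<le> 1 / 2" using n by (intro divide_left_mono) auto
            then have "\<beta> n (x + y - e) = 0" using False by (intro mollifier_zero) linarith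
            then show ?thesis by (simp add: F_def)
          qed
        qed
      qed
      also have "\<dots> = (LINT y|lborel. g (x, y) * \<beta> n (x + y - e) / norm y) / norm x"
        by (rule integral_divide_zero)
      finally show ?thesis by (rule sym)
    qed
    have m: "(\<lambda>x. LINT y|lborel. g (x, y) * \<beta> n (x + y - e) / norm y) \<in> borel_measurable lborel"
    proof (rule lborel.borel_measurable_lebesgue_integral)
      have "(\<lambda>p. g p * \<beta> n (fst p + snd p - e) / norm (snd p)) \<in> borel_measurable borel"
        by (intro borel_measurable_divide borel_measurable_continuous_onI continuous_intros mollifier_cont_comp g)
      then show "(\<lambda>(x, y). g (x, y) * \<beta> n (x + y - e) / norm y) \<in> borel_measurable (lborel \<Otimes>\<^sub>M lborel)"
        unfolding lborel_prod by (simp add: case_prod_beta')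
    qed
    have "(LINT x|lborel. (LINT y|lborel. g (x, y) * \<beta> n (x + y - e) / norm y) / norm x)
      = (LINT x|lborel. (LINT y|lborel. F (x, y) / norm x) + (LINT y|lborel. F (x, y) / norm y))"
    proof (rule integral_cong_AE)
      show "AE x in lborel. (LINT y|lborel. g (x, y) * \<beta> n (x + y - e) / norm y) / norm x
        = (LINT y|lborel. F (x, y) / norm x) + (LINT y|lborel. F (x, y) / norm y)"
        using AE_lborel_neq[of 0] by eventually_elim (rule inner)
      show "(\<lambda>x. (LINT y|lborel. g (x, y) * \<beta> n (x + y - e) / norm y) / norm x) \<in> borel_measurable lborel"
        by (rule borel_measurable_over_norm[OF m])
      show "(\<lambda>x. (LINT y|lborel. F (x, y) / norm x) + (LINT y|lborel. F (x, y) / norm y)) \<in> borel_measurable lborel"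
        using lborel_pair.integrable_fst[OF I] lborel_pair.integrable_fst[OF I'']
        by (intro borel_measurable_add borel_measurable_integrable)
    qed
    also have "\<dots> = (LINT x|lborel. LINT y|lborel. F (x, y) / norm x) + (LINT x|lborel. LINT y|lborel. F (x, y) / norm y)"
      by (rule Bochner_Integration.integral_add[OF lborel_pair.integrable_fst[OF I] lborel_pair.integrable_fst[OF I'']])
    \<comment> \<open>Exchanging the integrations makes the singular variable the outer one, which
      gives the expression in \<open>lim2\<close>.\<close>
    also have "(LINT x|lborel. LINT y|lborel. F (x, y) / norm y) = (LINT y|lborel. LINT x|lborel. F (x, y) / norm y)"
      by (rule lborel_pair.Fubini_integral[OF I'', symmetric])
    also have "\<dots> = (LINT y|lborel. LINT x|lborel. F' (y, x) / norm y)" by (simp add: FF')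
    finally show ?thesis by (simp add: F_def F'_def)
  qed
  have "(\<lambda>n. (LINT x|lborel. (LINT y|lborel. h (x, y) * \<beta> n (x + y - e)) / norm x)
      + (LINT x|lborel. (LINT y|lborel. h' (x, y) * \<beta> n (x + y - e)) / norm x))
      \<longlonglongrightarrow> (LINT x|lborel. g (x, e - x) / (norm x * norm (e - x)))"
    using tendsto_add[OF lim1 lim2] unfolding fin .
  then show ?thesis
    by (rule Lim_transform_eventually) (use step in \<open>auto intro!: eventually_sequentiallyI[of 1]\<close>)
qed

end

section \<open>Time slices of the solution\<close>

lemma continuous_on_integral_param:
  fixes F :: "'a::topological_space \<times> real \<Rightarrow> real"
  assumes "continuous_on UNIV F"
  shows "continuous_on UNIV (\<lambda>x. integral {0..R} (\<lambda>s. F (x, s)))"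
proof -
  have "continuous_on (UNIV \<times> cbox 0 R) (\<lambda>(x, s). F (x, s))"
    using continuous_on_subset[OF assms] by (simp add: case_prod_beta')
  from integral_continuous_on_param[OF this] show ?thesis by simp
qed

text \<open>Inside the cone continuity follows from differentiability. At a boundary point two
  limits are combined: the one from the inside, which is part of the Goursat condition, and the one
  along the cone, where v is a ray average of q and so depends continuously on x.\<close>

lemma goursat_continuous_on_cone:
  assumes v: "goursat_solution q v" and q: "continuous_on UNIV q"
  shows "continuous_on {(x, t). norm x \<le> t} v"
proof -
  define C where "C = {p :: spacetime. norm (fst p) < snd p}"
  define B where "B = {p :: spacetime. norm (fst p) = snd p}"
  have C_eq: "C = {(x, t). norm x < t}" by (auto simp: C_def)
  have un: "{(x, t). norm x \<le> t} = C \<union> B" by (auto simp: C_def B_def)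
  have oC: "open C" unfolding C_def by (intro open_Collect_less continuous_intros)
  have "\<forall>p\<in>C. v differentiable (at p)"
    using v unfolding goursat_solution_def C_eq numeral_2_eq_2 Ck_on.simps by blast
  then have inner: "(v \<longlongrightarrow> v p) (at p)" if "p \<in> C" for p
    using that by (meson differentiable_imp_continuous_within isCont_def)
  define D where "D x = 1 / (8 * pi) * integral {0..1} (\<lambda>s. q (s *\<^sub>R x))" for x
  have "continuous_on UNIV (\<lambda>(x, s). q (s *\<^sub>R x))"
    unfolding case_prod_beta by (intro continuous_on_compose2[OF q] continuous_intros) auto
  from continuous_on_integral_param[OF this, of 1] have D: "continuous_on UNIV D"
    unfolding D_def by (intro continuous_intros) simp
  have vB: "v p = D (fst p)" if "p \<in> B" for p
    using v that unfolding goursat_solution_def D_def B_def by (cases p) auto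
  have "continuous_on B (\<lambda>p. D (fst p))"
    by (intro continuous_on_compose2[OF D] continuous_intros) auto
  then have cB: "continuous_on B v" by (rule continuous_on_eq) (simp add: vB)
  have "(v \<longlongrightarrow> v p) (at p within (C \<union> B))" if p: "p \<in> C \<union> B" for p
  proof (cases "p \<in> C")
    case True
    then show ?thesis using inner by (blast intro: Lim_at_imp_Lim_at_within)
  next
    case False
    then have pB: "p \<in> B" using p by simp
    have "(v \<longlongrightarrow> v p) (at p within B)" using cB pB by (simp add: continuous_on_def)
    moreover have "(v \<longlongrightarrow> v p) (at p within C)"
      using v pB unfolding goursat_solution_def B_def C_eq by (cases p) auto
    ultimately show ?thesis unfolding at_within_union by (intro filterlim_sup)
  qed
  then show ?thesis unfolding un by (simp add: continuous_on_def)
qed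

text \<open>\<open>v (x, |x| + s)\<close> in the characteristic variable \<open>s \<ge> 0\<close>, extended constantly to \<open>s < 0\<close> so
  that it is continuous everywhere.\<close>

definition cone_part :: "(spacetime \<Rightarrow> real) \<Rightarrow> spacetime \<Rightarrow> real" where
  "cone_part v p = v (fst p, norm (fst p) + max (snd p) 0)"

lemma cone_part_continuous:
  assumes v: "goursat_solution q v" and q: "continuous_on UNIV q"
  shows "continuous_on UNIV (cone_part v)"
  unfolding cone_part_def
  by (intro continuous_on_compose2[OF goursat_continuous_on_cone[OF v q]] continuous_intros) auto

lemma lebesgue_integral_interval:
  fixes f :: "real \<Rightarrow> real"
  assumes "continuous_on {a..b} f"
  shows "(LINT s|lborel. indicator {a..b} s * f s) = integral {a..b} f"
  using set_borel_integral_eq_integral(2)[OF borel_integrable_atLeastAtMost'[OF assms]]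
  by (simp add: set_lebesgue_integral_def)

text \<open>\<open>slice V R \<phi> x / |x|\<close> is the integral of \<open>\<phi> (x, \<cdot>)\<close> against the time slice at \<open>x\<close> of the
  solution; \<open>R\<close> bounds the support of \<open>\<phi>\<close> in time.\<close>

definition slice :: "(spacetime \<Rightarrow> real) \<Rightarrow> real \<Rightarrow> (spacetime \<Rightarrow> real) \<Rightarrow> space \<Rightarrow> real" where
  "slice V R \<phi> x = \<phi> (x, norm x) / (4 * pi)
     + norm x * integral {0..R} (\<lambda>s. V (x, s) * \<phi> (x, norm x + s))"

lemma slice_continuous:
  assumes V: "continuous_on UNIV V" and \<phi>: "continuous_on UNIV \<phi>"
  shows "continuous_on UNIV (slice V R \<phi>)"
proof -
  have "continuous_on UNIV (\<lambda>p. V (fst p, snd p) * \<phi> (fst p, norm (fst p) + snd p))"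
    by (intro continuous_intros continuous_on_compose2[OF V] continuous_on_compose2[OF \<phi>]) auto
  from continuous_on_integral_param[OF this, of R]
  have I: "continuous_on UNIV (\<lambda>x. integral {0..R} (\<lambda>s. V (x, s) * \<phi> (x, norm x + s)))" by simp
  show ?thesis
    unfolding slice_def by (intro continuous_intros I continuous_on_compose2[OF \<phi>]) auto
qed

text \<open>Fubini in time, then t = |x| + s. The factor \<open>norm x\<close> in
  \<open>slice\<close> lets the regular part share the 1/|x| of the singular part, so that the
  numerator is continuous on all of space.\<close>

lemma regular_part_representation:
  assumes r: "regular_part q u v" and q: "continuous_on UNIV q" and \<phi>: "\<phi> \<in> Cc"
    and R: "\<And>x t. norm x \<le> t \<Longrightarrow> R \<le> t \<Longrightarrow> \<phi> (x, t) = 0"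
  shows "u \<phi> = (LINT x|lborel. slice (cone_part v) R \<phi> x / norm x)"
proof -
  have v: "goursat_solution q v" and u: "u \<phi> = singular_part \<phi> + (\<integral>p. v p * \<phi> p \<partial>lborel)"
    using r \<phi> by (auto simp: regular_part_def)
  have v0: "v (x, t) = 0" if "t < norm x" for x t using v that by (auto simp: goursat_solution_def)
  obtain A where A: "compact A" "\<And>p. p \<notin> A \<Longrightarrow> \<phi> p = 0" "continuous_on UNIV \<phi>"
    using CcE[OF \<phi>] by blast
  obtain R' where R': "R' > 0" "\<And>p. p \<in> A \<Longrightarrow> norm p \<le> R'"
    using compact_imp_bounded[OF A(1)] unfolding bounded_pos by auto
  define C where "C = {(x :: space, t). norm x \<le> t}"
  have C_eq: "C = {p. norm (fst p) \<le> snd p}" by (auto simp: C_def)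
  have clC: "closed C" unfolding C_eq by (intro closed_Collect_le continuous_intros)
  define g where "g p = v p * \<phi> p" for p
  have gC: "continuous_on C g"
    unfolding g_def using goursat_continuous_on_cone[OF v q]
    by (intro continuous_intros continuous_on_subset[OF A(3)]) (auto simp: C_def)
  \<comment> \<open>v may jump across the cone; since it vanishes outside, integrability follows
    from continuity on the compact set \<open>A \<inter> C\<close>.\<close>
  have g0: "g p = 0" if "p \<notin> A \<inter> C" for p
    using that A(2)[of p] v0 by (cases p) (auto simp: g_def C_def not_le)
  have "integrable lborel (\<lambda>p. indicator (A \<inter> C) p *\<^sub>R g p)"
    using A(1) clC by (intro borel_integrable_compact compact_Int_closed continuous_on_subset[OF gC]) auto
  also have "(\<lambda>p. indicator (A \<inter> C) p *\<^sub>R g p) = g" using g0 by (auto simp: indicator_def fun_eq_iff)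
  finally have gi: "integrable lborel g" .
  then have gi': "integrable (lborel \<Otimes>\<^sub>M lborel) g" by (simp add: lborel_prod)
  define V where "V = cone_part v"
  have V: "continuous_on UNIV V" unfolding V_def by (rule cone_part_continuous[OF v q])
  have inner: "(LINT t|lborel. g (x, t)) = integral {0..R} (\<lambda>s. V (x, s) * \<phi> (x, norm x + s))" for x
  proof -
    have "g \<in> borel_measurable borel" using gi by (simp add: borel_measurable_integrable)
    moreover have "(\<lambda>t::real. (x, t)) \<in> borel_measurable borel"
      by (intro borel_measurable_continuous_onI continuous_intros)
    ultimately have "(\<lambda>t. g (x, t)) \<in> borel_measurable borel" by (rule measurable_compose[rotated])
    from integral_lborel_shift[OF this, of "norm x"]
    have "(LINT t|lborel. g (x, t)) = (LINT s|lborel. g (x, norm x + s))" by simp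
    also have "\<dots> = (LINT s|lborel. indicator {0..R} s * (V (x, s) * \<phi> (x, norm x + s)))"
    proof (intro Bochner_Integration.integral_cong refl)
      fix s :: real
      consider "s < 0" | "s > R" "s \<ge> 0" | "0 \<le> s" "s \<le> R" by linarith
      then show "g (x, norm x + s) = indicator {0..R} s * (V (x, s) * \<phi> (x, norm x + s))"
      proof cases
        case 1
        then show ?thesis using v0 by (simp add: g_def)
      next
        case 2
        then have "\<phi> (x, norm x + s) = 0" using norm_ge_zero[of x] by (intro R) linarith+
        then show ?thesis using 2 by (simp add: g_def)
      next
        case 3
        then show ?thesis by (simp add: g_def V_def cone_part_def max_def)
      qed
    qed
    also have "\<dots> = integral {0..R} (\<lambda>s. V (x, s) * \<phi> (x, norm x + s))"
      by (intro lebesgue_integral_interval continuous_intros continuous_on_compose2[OF V] continuous_on_compose2[OF A(3)]) auto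
    finally show ?thesis .
  qed
  have "(LINT p|lborel. v p * \<phi> p) = (LINT p|(lborel \<Otimes>\<^sub>M lborel). g p)" by (simp add: g_def lborel_prod)
  also have "\<dots> = (LINT x|lborel. LINT t|lborel. g (x, t))"
    by (rule lborel_pair.integral_fst'[OF gi', symmetric])
  finally have e2: "(LINT p|lborel. v p * \<phi> p) = (LINT x|lborel. LINT t|lborel. g (x, t))" .
  have i2: "integrable lborel (\<lambda>x. LINT t|lborel. g (x, t))" by (rule lborel_pair.integrable_fst'[OF gi'])
  obtain M where M: "M > 0" "\<And>p. \<bar>\<phi> p\<bar> \<le> M"
    using continuous_bounded_compact_support[OF continuous_on_subset[OF A(3)] A(1,2)] by blast
  have c1: "continuous_on UNIV (\<lambda>x::space. \<phi> (x, norm x) / (4 * pi))"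
    by (intro continuous_intros continuous_on_compose2[OF A(3)]) auto
  have i1: "integrable lborel (\<lambda>x::space. \<phi> (x, norm x) / (4 * pi) / norm x)"
  proof (rule integrable_over_norm)
    show "(\<lambda>x::space. \<phi> (x, norm x) / (4 * pi)) \<in> borel_measurable lborel"
      using borel_measurable_continuous_onI[OF c1] by simp
    show "\<bar>\<phi> (x, norm x) / (4 * pi)\<bar> \<le> M / (4 * pi)" for x :: space
      using M(2)[of "(x, norm x)"] by (simp add: divide_right_mono)
    show "\<phi> (x, norm x) / (4 * pi) = 0" if "norm x > R'" for x :: space
      using A(2)[of "(x, norm x)"] R'(2)[of "(x, norm x)"] that norm_fst_le[of x "norm x"] by force
  qed
  have "u \<phi> = (LINT x|lborel. \<phi> (x, norm x) / (4 * pi) / norm x) + (LINT x|lborel. LINT t|lborel. g (x, t))"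
    unfolding u e2 singular_part_def by simp
  also have "\<dots> = (LINT x|lborel. \<phi> (x, norm x) / (4 * pi) / norm x + (LINT t|lborel. g (x, t)))"
    by (rule Bochner_Integration.integral_add[OF i1 i2, symmetric])
  also have "\<dots> = (LINT x|lborel. slice V R \<phi> x / norm x)"
  proof (rule integral_cong_AE)
    show "(\<lambda>x. \<phi> (x, norm x) / (4 * pi) / norm x + (LINT t|lborel. g (x, t))) \<in> borel_measurable lborel"
      using i1 i2 by (intro borel_measurable_add borel_measurable_integrable)
    have "slice V R \<phi> \<in> borel_measurable borel"
      by (intro borel_measurable_continuous_onI slice_continuous V A(3))
    then show "(\<lambda>x. slice V R \<phi> x / norm x) \<in> borel_measurable lborel"
      by (intro borel_measurable_over_norm) simp
    show "AE x in lborel. \<phi> (x, norm x) / (4 * pi) / norm x + (LINT t|lborel. g (x, t)) = slice V R \<phi> x / norm x"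
      using AE_lborel_neq[of 0]
      by eventually_elim (simp add: inner slice_def add_divide_distrib)
  qed
  finally show ?thesis unfolding V_def .
qed

text \<open>Both parts of u are carried by the closed forward cone. This is the form of finite speed
  of propagation on which the duality identity relies.\<close>

lemma regular_part_cong:
  assumes r: "regular_part q u v" and q: "continuous_on UNIV q" and \<phi>: "\<phi> \<in> Cc" and \<psi>: "\<psi> \<in> Cc"
    and eq: "\<And>x t. norm x \<le> t \<Longrightarrow> \<phi> (x, t) = \<psi> (x, t)"
  shows "u \<phi> = u \<psi>"
proof -
  have v0: "v (x, t) = 0" if "t < norm x" for x t
    using r that by (auto simp: regular_part_def goursat_solution_def)
  have "(\<lambda>p. v p * \<phi> p) = (\<lambda>p. v p * \<psi> p)"
  proof
    fix p :: spacetime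
    show "v p * \<phi> p = v p * \<psi> p"
      using eq[of "fst p" "snd p"] v0[of "snd p" "fst p"] by (cases "norm (fst p) \<le> snd p") auto
  qed
  moreover have "singular_part \<phi> = singular_part \<psi>"
    unfolding singular_part_def by (simp add: eq)
  ultimately show ?thesis using r \<phi> \<psi> by (simp add: regular_part_def)
qed

lemma integral_swap_over_norm:
  fixes F :: "spacetime \<Rightarrow> real"
  assumes F: "continuous_on UNIV F" and F0: "\<And>y t. norm y > R \<Longrightarrow> F (y, t) = 0"
  shows "integral {0..T} (\<lambda>t. LINT y|lborel. F (y, t) / norm y)
    = (LINT y|lborel. integral {0..T} (\<lambda>t. F (y, t)) / norm y)"
proof -
  define G where "G p = F (snd p, fst p)" for p
  have G: "continuous_on UNIV G"
    unfolding G_def by (intro continuous_on_compose2[OF F] continuous_intros) auto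
  let ?A = "{0..T} \<times> cball (0::space) (\<bar>R\<bar> + 1)"
  have "bounded (G ` ?A)"
    by (intro compact_imp_bounded compact_continuous_image continuous_on_subset[OF G] compact_Times) auto
  then obtain M where M: "M > 0" "\<And>x. x \<in> ?A \<Longrightarrow> \<bar>G x\<bar> \<le> M"
    unfolding bounded_pos by auto
  have I: "integrable (lborel \<Otimes>\<^sub>M lborel) (\<lambda>(t, y). indicator {0..T} t * (F (y, t) / norm y))"
  proof (rule Bochner_Integration.integrable_bound)
    show "integrable (lborel \<Otimes>\<^sub>M lborel)
        (\<lambda>(t, y::space). indicator {0..T} t * (M * (indicator (cball 0 (\<bar>R\<bar> + 1)) y / norm y)))"
      by (intro integrable_mult_pair integrable_mult_right inverse_norm_integrable_cball sigma_finite_lborel)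
        (auto intro!: integrable_real_indicator simp: emeasure_lborel_Icc_eq)
    have "(indicator ({0..T} \<times> UNIV) :: real \<times> space \<Rightarrow> real) \<in> borel_measurable borel"
      by (intro borel_measurable_indicator borel_closed closed_Times) auto
    moreover have "(\<lambda>p. G p / norm (snd p)) \<in> borel_measurable borel"
      by (intro borel_measurable_divide borel_measurable_continuous_onI G continuous_intros)
    ultimately have "(\<lambda>p. indicator ({0..T} \<times> UNIV) p * (G p / norm (snd p))) \<in> borel_measurable borel"
      by (rule borel_measurable_times)
    then show "(\<lambda>(t, y). indicator {0..T} t * (F (y, t) / norm y)) \<in> borel_measurable (lborel \<Otimes>\<^sub>M lborel)"
      unfolding lborel_prod by (simp add: case_prod_beta' G_def indicator_times)
    show "AE p in lborel \<Otimes>\<^sub>M lborel. norm (case p of (t, y) \<Rightarrow> indicator {0..T} t * (F (y, t) / norm y))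
      \<le> norm (case p of (t, y::space) \<Rightarrow> indicator {0..T} t * (M * (indicator (cball 0 (\<bar>R\<bar> + 1)) y / norm y)))"
    proof (rule AE_I2, clarify)
      fix t :: real and y :: space
      show "norm (indicator {0..T} t * (F (y, t) / norm y))
        \<le> norm (indicator {0..T} t * (M * (indicator (cball 0 (\<bar>R\<bar> + 1)) y / norm y)))"
      proof (cases "(t, y) \<in> ?A")
        case True
        then show ?thesis using M(1) M(2)[OF True] by (simp add: G_def divide_right_mono)
      next
        case False
        then have "t \<notin> {0..T} \<or> F (y, t) = 0" using F0[of y t] by auto
        then show ?thesis by auto
      qed
    qed
  qed
  have "integral {0..T} (\<lambda>t. LINT y|lborel. F (y, t) / norm y)
    = (LINT t|lborel. indicator {0..T} t * (LINT y|lborel. F (y, t) / norm y))"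
  proof -
    have "set_integrable lborel {0..T} (\<lambda>t. LINT y|lborel. F (y, t) / norm y)"
      using lborel_pair.integrable_fst[OF I]
      unfolding set_integrable_def integral_mult_right_zero real_scaleR_def .
    from set_borel_integral_eq_integral(2)[OF this] show ?thesis
      by (simp add: set_lebesgue_integral_def)
  qed
  also have "\<dots> = (LINT t|lborel. LINT y|lborel. indicator {0..T} t * (F (y, t) / norm y))"
    unfolding integral_mult_right_zero ..
  also have "\<dots> = (LINT y|lborel. LINT t|lborel. indicator {0..T} t * (F (y, t) / norm y))"
    by (rule lborel_pair.Fubini_integral[OF I, symmetric])
  also have "\<dots> = (LINT y|lborel. integral {0..T} (\<lambda>t. F (y, t)) / norm y)"
  proof (intro Bochner_Integration.integral_cong refl)
    fix y
    have "(LINT t|lborel. indicator {0..T} t * (F (y, t) / norm y)) = (LINT t|lborel. indicator {0..T} t * F (y, t) / norm y)"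
      by simp
    also have "\<dots> = (LINT t|lborel. indicator {0..T} t * F (y, t)) / norm y" by (rule integral_divide_zero)
    also have "(LINT t|lborel. indicator {0..T} t * F (y, t)) = integral {0..T} (\<lambda>t. F (y, t))"
      by (intro lebesgue_integral_interval continuous_on_compose2[OF F] continuous_intros) auto
    finally show "(LINT t|lborel. indicator {0..T} t * (F (y, t) / norm y)) = integral {0..T} (\<lambda>t. F (y, t)) / norm y" .
  qed
  finally show ?thesis .
qed

section \<open>The duality identity in the limit\<close>

text \<open>With \<open>u(x, dt)\<close> denoting the time slice at \<open>x\<close> of a solution \<open>u\<close>,
  \<open>time_part V T \<psi> y r / |y|\<close> is the integral of \<open>\<psi> (r + s)\<close> against \<open>u2(y, ds)\<close>, and
  \<open>source_kernel V1 V2 T \<psi> x y / (|x| |y|)\<close> that of \<open>\<psi> (t + s)\<close> against \<open>u1(x, dt) u2(y, ds)\<close>.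
  Both use that \<open>\<psi>\<close> vanishes beyond \<open>T\<close>.\<close>

definition time_part :: "(spacetime \<Rightarrow> real) \<Rightarrow> real \<Rightarrow> (real \<Rightarrow> real) \<Rightarrow> space \<Rightarrow> real \<Rightarrow> real" where
  "time_part V T \<psi> y r = \<psi> (r + norm y) / (4 * pi)
     + norm y * integral {0..T} (\<lambda>s. V (y, s) * \<psi> (r + norm y + s))"

definition source_kernel :: "(spacetime \<Rightarrow> real) \<Rightarrow> (spacetime \<Rightarrow> real) \<Rightarrow> real \<Rightarrow> (real \<Rightarrow> real) \<Rightarrow> space \<Rightarrow> space \<Rightarrow> real" where
  "source_kernel V1 V2 T \<psi> x y = time_part V2 T \<psi> y (norm x) / (4 * pi)
     + norm x * integral {0..T} (\<lambda>t. V1 (x, t) * time_part V2 T \<psi> y (norm x + t))"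

lemma time_part_continuous:
  assumes V: "continuous_on UNIV V" and \<psi>: "continuous_on UNIV \<psi>"
  shows "continuous_on UNIV (\<lambda>p. time_part V T \<psi> (fst p) (snd p))"
proof -
  have "continuous_on UNIV (\<lambda>z. V (fst (fst z), snd z) * \<psi> (snd (fst z) + norm (fst (fst z)) + snd z))"
    by (intro continuous_intros continuous_on_compose2[OF V] continuous_on_compose2[OF \<psi>]) auto
  from continuous_on_integral_param[OF this, of T]
  have I: "continuous_on UNIV (\<lambda>p. integral {0..T} (\<lambda>s. V (fst p, s) * \<psi> (snd p + norm (fst p) + s)))" by simp
  show ?thesis
    unfolding time_part_def by (intro continuous_intros I continuous_on_compose2[OF \<psi>]) simp_all
qed

lemma source_kernel_continuous:
  assumes V1: "continuous_on UNIV V1" and V2: "continuous_on UNIV V2" and \<psi>: "continuous_on UNIV \<psi>"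
  shows "continuous_on UNIV (\<lambda>p. source_kernel V1 V2 T \<psi> (fst p) (snd p))"
proof -
  note tp = time_part_continuous[OF V2 \<psi>, of T]
  have tp': "continuous_on S (\<lambda>z. time_part V2 T \<psi> (f z) (g z))"
    if "continuous_on S f" "continuous_on S g" for S :: "'c::topological_space set" and f g
    using continuous_on_compose2[OF tp, of S "\<lambda>z. (f z, g z)"] that by (auto intro: continuous_intros)
  have "continuous_on UNIV (\<lambda>z. V1 (fst (fst z), snd z) * time_part V2 T \<psi> (snd (fst z)) (norm (fst (fst z)) + snd z))"
    by (intro continuous_intros continuous_on_compose2[OF V1] tp') auto
  from continuous_on_integral_param[OF this, of T]
  have I: "continuous_on UNIV (\<lambda>p. integral {0..T} (\<lambda>t. V1 (fst p, t) * time_part V2 T \<psi> (snd p) (norm (fst p) + t)))"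
    by simp
  show ?thesis
    unfolding source_kernel_def by (intro continuous_intros I tp') simp_all
qed

lemma time_part_eq_0:
  assumes "\<And>t. t \<ge> T \<Longrightarrow> \<psi> t = 0" "norm y + r \<ge> T"
  shows "time_part V T \<psi> y r = 0"
proof -
  have "integral {0..T} (\<lambda>s. V (y, s) * \<psi> (r + norm y + s)) = integral {0..T} (\<lambda>s. 0)"
    by (rule Henstock_Kurzweil_Integration.integral_cong) (use assms in auto)
  then show ?thesis using assms by (simp add: time_part_def add.commute)
qed

lemma source_kernel_eq_0:
  assumes "\<And>t. t \<ge> T \<Longrightarrow> \<psi> t = 0" "norm x + norm y \<ge> T"
  shows "source_kernel V1 V2 T \<psi> x y = 0"
proof -
  have "integral {0..T} (\<lambda>t. V1 (x, t) * time_part V2 T \<psi> y (norm x + t)) = integral {0..T} (\<lambda>s. 0)"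
    by (rule Henstock_Kurzweil_Integration.integral_cong)
      (use assms time_part_eq_0[of T \<psi> y] in auto)
  then show ?thesis using assms time_part_eq_0[of T \<psi> y "norm x"] by (simp add: source_kernel_def add.commute)
qed

lemma product_in_Cc:
  assumes k: "continuous_on UNIV k" and k0: "\<And>y. norm y > R \<Longrightarrow> k y = 0"
    and \<psi>: "continuous_on UNIV \<psi>" and \<psi>0: "\<And>t. t \<ge> T \<Longrightarrow> \<psi> t = 0" "\<And>t. t \<le> - 1 \<Longrightarrow> \<psi> t = 0"
  shows "(\<lambda>(y, s). k y * \<psi> (r + s)) \<in> Cc"
proof (rule CcI[of _ "cball 0 R \<times> {- 1 - r..T - r}"])
  show "continuous_on UNIV (\<lambda>(y, s). k y * \<psi> (r + s))"
    unfolding case_prod_beta'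
    by (intro continuous_intros continuous_on_compose2[OF k] continuous_on_compose2[OF \<psi>]) auto
  show "compact (cball (0::space) R \<times> {- 1 - r..T - r})" by (intro compact_Times) auto
  fix p :: spacetime assume p: "p \<notin> cball 0 R \<times> {- 1 - r..T - r}"
  then have "norm (fst p) > R \<or> r + snd p \<ge> T \<or> r + snd p \<le> - 1" by (cases p) auto
  then show "(case p of (y, s) \<Rightarrow> k y * \<psi> (r + s)) = 0"
    using k0 \<psi>0 by (auto simp: case_prod_beta')
qed

lemma product_pairing:
  assumes r: "regular_part q u v" and q: "continuous_on UNIV q"
    and k: "continuous_on UNIV k" and k0: "\<And>y. norm y > R \<Longrightarrow> k y = 0"
    and \<psi>: "continuous_on UNIV \<psi>" and \<psi>0: "\<And>t. t \<ge> T \<Longrightarrow> \<psi> t = 0" "\<And>t. t \<le> - 1 \<Longrightarrow> \<psi> t = 0"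
    and r0: "r \<ge> 0"
  shows "u (\<lambda>(y, s). k y * \<psi> (r + s)) = (LINT y|lborel. k y * time_part (cone_part v) T \<psi> y r / norm y)"
proof -
  have rep: "u (\<lambda>(y, s). k y * \<psi> (r + s))
    = (LINT y|lborel. slice (cone_part v) T (\<lambda>(y, s). k y * \<psi> (r + s)) y / norm y)"
  proof (rule regular_part_representation[OF r q])
    show "(\<lambda>(y, s). k y * \<psi> (r + s)) \<in> Cc" by (rule product_in_Cc) fact+
    show "(case (x, t) of (y, s) \<Rightarrow> k y * \<psi> (r + s)) = 0" if "T \<le> t" for x t
      using \<psi>0(1)[of "r + t"] r0 that by simp
  qed
  have sl: "slice (cone_part v) T (\<lambda>(y, s). k y * \<psi> (r + s)) y = k y * time_part (cone_part v) T \<psi> y r" for y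
  proof -
    have "integral {0..T} (\<lambda>s. cone_part v (y, s) * (k y * \<psi> (r + (norm y + s))))
      = integral {0..T} (\<lambda>s. k y * (cone_part v (y, s) * \<psi> (r + norm y + s)))"
      by (simp add: mult_ac add_ac)
    also have "\<dots> = k y * integral {0..T} (\<lambda>s. cone_part v (y, s) * \<psi> (r + norm y + s))"
      by (rule integral_mult_right)
    finally show ?thesis by (simp add: slice_def time_part_def algebra_simps)
  qed
  show ?thesis using rep unfolding sl .
qed

locale point_source_pair =
  fixes q1 q2 :: "space \<Rightarrow> real" and u1 u2 :: functional and v1 v2 :: "spacetime \<Rightarrow> real"
  assumes s1: "point_source_solution q1 u1" and s2: "point_source_solution q2 u2"
    and r1: "regular_part q1 u1 v1" and r2: "regular_part q2 u2 v2"
    and c1: "continuous_on UNIV q1" and c2: "continuous_on UNIV q2"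
begin

lemma cone_part_v1: "continuous_on UNIV (cone_part v1)" and cone_part_v2: "continuous_on UNIV (cone_part v2)"
  using cone_part_continuous r1 r2 c1 c2 by (auto simp: regular_part_def)

text \<open>The duality identity for K (x, t) = b (x - e) \<psi> t, written out as integrals. On the
  left the singular parts of u1 and u2 cancel, being independent of q, and the factor |y| of the
  regular parts removes 1/|y|. On the right u1 is applied to a function that is itself a pairing
  with u2, and this nesting is \<open>source_kernel\<close>.\<close>

lemma duality_kernel:
  fixes b :: "space \<Rightarrow> real" and e :: space and T :: real
  assumes \<psi>: "smooth \<psi>" and \<psi>0: "\<And>t. t \<ge> T \<Longrightarrow> \<psi> t = 0" "\<And>t. t \<le> - 1 \<Longrightarrow> \<psi> t = 0"
    and b: "smooth b" and b0: "\<And>z. norm z \<ge> 1 \<Longrightarrow> b z = 0" and T: "T \<ge> 0"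
  shows "(LINT y|lborel. (integral {0..T} (\<lambda>s. (cone_part v2 (y, s) - cone_part v1 (y, s)) * \<psi> (norm y + s))) * b (y - e))
    = (LINT x|lborel. (LINT y|lborel. (q2 y - q1 x) * source_kernel (cone_part v1) (cone_part v2) T \<psi> x y * b (x + y - e) / norm y) / norm x)"
proof -
  let ?V1 = "cone_part v1" and ?V2 = "cone_part v2"
  have \<psi>c: "continuous_on UNIV \<psi>" and bc: "continuous_on UNIV b"
    using \<psi> b by (auto intro: smooth_continuous_on)
  have bc': "continuous_on S (\<lambda>x. b (f x))" if "continuous_on S f" for S :: "'c::topological_space set" and f
    by (rule continuous_on_compose2[OF bc that]) auto
  define K where "K = (\<lambda>(x, t). b (x - e) * \<psi> t)"
  have b0': "b (x + y - e) = 0" if "norm y > norm e + norm x + 1" for x y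
    using that norm_triangle_ineq4[of "x + y - e" "x - e"] norm_triangle_ineq4[of x e] by (intro b0) simp
  have K_smooth: "smooth K"
  proof -
    have "smooth (\<lambda>x. b (- e + x))" by (rule smooth_shift[OF b])
    from smooth_compose_linear[OF this bounded_linear_fst]
    have "smooth (\<lambda>p::spacetime. b (- e + fst p))" .
    moreover have "smooth (\<lambda>p::spacetime. \<psi> (snd p))" by (rule smooth_compose_linear[OF \<psi> bounded_linear_snd])
    ultimately show ?thesis unfolding K_def case_prod_beta' by (simp add: smooth_mult)
  qed
  have K_eq: "K = (\<lambda>(y, s). b (y - e) * \<psi> (0 + s))" by (simp add: K_def)
  have b1: "b (y - e) = 0" if "norm y > norm e + 1" for y
    using b0'[of 0 y] that by simp
  have K_Cc: "K \<in> Cc"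
    unfolding K_eq by (rule product_in_Cc[where R = "norm e + 1" and T = T]) (use b1 \<psi>c \<psi>0 in \<open>auto intro!: bc' continuous_intros\<close>)
  have K_test: "K \<in> test_functions" using K_smooth K_Cc by (simp add: test_functions_iff)
  have uK: "u K = (LINT y|lborel. b (y - e) * time_part (cone_part v) T \<psi> y 0 / norm y)"
    if "regular_part q u v" "continuous_on UNIV q" for q u v
    unfolding K_eq
    by (rule product_pairing[OF that, where R = "norm e + 1"]) (use b1 \<psi>c \<psi>0 in \<open>auto intro!: bc' continuous_intros\<close>)
  obtain W where W: "W \<in> Cc" "u2 K - u1 K = u1 W"
    "\<And>x t. t \<ge> 0 \<Longrightarrow> W (x, t) = u2 (\<lambda>(y, s). (q2 y - q1 x) * K (x + y, t + s))"
    using duality_identity[OF s1 s2 c1 c2 regular_part_cong[OF r1 c1] regular_part_cong[OF r2 c2] K_test] by blast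
  have W_eq: "W (x, t) = (LINT y|lborel. (q2 y - q1 x) * b (x + y - e) * time_part ?V2 T \<psi> y t / norm y)"
    if t: "t \<ge> 0" for x t
  proof -
    have "W (x, t) = u2 (\<lambda>(y, s). ((q2 y - q1 x) * b (x + y - e)) * \<psi> (t + s))"
      unfolding W(3)[OF t] by (simp add: K_def mult.assoc)
    also have "\<dots> = (LINT y|lborel. ((q2 y - q1 x) * b (x + y - e)) * time_part ?V2 T \<psi> y t / norm y)"
      by (rule product_pairing[OF r2 c2, where R = "norm e + norm x + 1"])
        (use b0' \<psi>c \<psi>0 t in \<open>auto intro!: bc' continuous_intros c2\<close>)
    finally show ?thesis .
  qed
  \<comment> \<open>Causality: from time T on every argument of \<psi> is at least T. This permits T
    as the time bound when u1 is represented.\<close>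
  have W0: "W (x, t) = 0" if "T \<le> t" for x t
  proof -
    have "time_part ?V2 T \<psi> y t = 0" for y
      by (rule time_part_eq_0) (use \<psi>0 that norm_ge_zero[of y] in \<open>auto simp del: norm_ge_zero\<close>)
    then show ?thesis using W_eq[of t x] that T by simp
  qed
  have tp: "continuous_on S (\<lambda>z. time_part ?V2 T \<psi> (f z) (g z))"
    if "continuous_on S f" "continuous_on S g" for S :: "'c::topological_space set" and f g
    using continuous_on_compose2[OF time_part_continuous[OF cone_part_v2 \<psi>c, of T], of S "\<lambda>z. (f z, g z)"] that
    by (auto intro: continuous_intros)
  have slice_W: "slice ?V1 T W x = (LINT y|lborel. (q2 y - q1 x) * source_kernel ?V1 ?V2 T \<psi> x y * b (x + y - e) / norm y)" for x
  proof -
    define P where "P y = (q2 y - q1 x) * b (x + y - e)" for y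
    have Pc: "continuous_on UNIV P" unfolding P_def by (intro bc' continuous_intros c2)
    have P0: "P y = 0" if "norm y > norm e + norm x + 1" for y using b0'[OF that] by (simp add: P_def)
    have Pc': "continuous_on S (\<lambda>z. P (f z))" if "continuous_on S f" for S :: "'c::topological_space set" and f
      by (rule continuous_on_compose2[OF Pc that]) auto
    let ?F = "\<lambda>p. ?V1 (x, snd p) * (P (fst p) * time_part ?V2 T \<psi> (fst p) (norm x + snd p))"
    have Fc: "continuous_on UNIV ?F"
      by (intro continuous_intros continuous_on_compose2[OF cone_part_v1] Pc' tp) auto
    have I1: "integral {0..T} (\<lambda>t. ?V1 (x, t) * W (x, norm x + t)) =
      (LINT y|lborel. P y * integral {0..T} (\<lambda>t. ?V1 (x, t) * time_part ?V2 T \<psi> y (norm x + t)) / norm y)"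
    proof -
      have i1: "integral {0..T} (\<lambda>t. ?V1 (x, t) * W (x, norm x + t))
        = integral {0..T} (\<lambda>t. LINT y|lborel. ?F (y, t) / norm y)"
      proof (rule Henstock_Kurzweil_Integration.integral_cong)
        fix t :: real assume t: "t \<in> {0..T}"
        have "?V1 (x, t) * W (x, norm x + t)
          = ?V1 (x, t) * (LINT y|lborel. P y * time_part ?V2 T \<psi> y (norm x + t) / norm y)"
          using t by (subst W_eq) (auto simp: P_def)
        also have "\<dots> = (LINT y|lborel. ?V1 (x, t) * (P y * time_part ?V2 T \<psi> y (norm x + t) / norm y))"
          by (rule integral_mult_right_zero[symmetric])
        finally show "?V1 (x, t) * W (x, norm x + t) = (LINT y|lborel. ?F (y, t) / norm y)" by simp
      qed
      have i2: "integral {0..T} (\<lambda>t. LINT y|lborel. ?F (y, t) / norm y) = (LINT y|lborel. integral {0..T} (\<lambda>t. ?F (y, t)) / norm y)"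
        by (rule integral_swap_over_norm[OF Fc, of "norm e + norm x + 1"]) (use P0 in auto)
      have i3: "integral {0..T} (\<lambda>t. ?F (y, t)) = P y * integral {0..T} (\<lambda>t. ?V1 (x, t) * time_part ?V2 T \<psi> y (norm x + t))" for y
      proof -
        have "integral {0..T} (\<lambda>t. ?F (y, t)) = integral {0..T} (\<lambda>t. P y * (?V1 (x, t) * time_part ?V2 T \<psi> y (norm x + t)))"
          by (simp add: mult_ac)
        also have "\<dots> = P y * integral {0..T} (\<lambda>t. ?V1 (x, t) * time_part ?V2 T \<psi> y (norm x + t))"
          by (rule integral_mult_right)
        finally show ?thesis .
      qed
      show ?thesis unfolding i1 i2 i3 ..
    qed
    have Jc: "continuous_on UNIV (\<lambda>y. integral {0..T} (\<lambda>t. ?V1 (x, t) * time_part ?V2 T \<psi> y (norm x + t)))"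
    proof -
      have "continuous_on UNIV (\<lambda>p. ?V1 (x, snd p) * time_part ?V2 T \<psi> (fst p) (norm x + snd p))"
        by (intro continuous_intros continuous_on_compose2[OF cone_part_v1] tp) auto
      from continuous_on_integral_param[OF this, of T] show ?thesis by simp
    qed
    have over: "integrable lborel (\<lambda>y. P y * f y / norm y)" if f: "continuous_on UNIV f" for f
    proof -
      have Pf: "continuous_on UNIV (\<lambda>y. P y * f y)" by (intro continuous_intros Pc f)
      let ?R = "norm e + norm x + 1"
      have z: "P y * f y = 0" if "y \<notin> cball 0 ?R" for y using that P0[of y] by simp
      obtain M where M: "M > 0" "\<And>y. \<bar>P y * f y\<bar> \<le> M"
        using continuous_bounded_compact_support[OF continuous_on_subset[OF Pf subset_UNIV] compact_cball z] by blast
      show ?thesis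
        by (rule integrable_over_norm[of _ M ?R]) (use M P0 borel_measurable_continuous_onI[OF Pf] in auto)
    qed
    have "slice ?V1 T W x = W (x, norm x) / (4 * pi) + norm x * integral {0..T} (\<lambda>t. ?V1 (x, t) * W (x, norm x + t))"
      by (simp add: slice_def)
    also have "\<dots> = (LINT y|lborel. P y * (time_part ?V2 T \<psi> y (norm x) / (4 * pi)) / norm y)
      + (LINT y|lborel. P y * (norm x * integral {0..T} (\<lambda>t. ?V1 (x, t) * time_part ?V2 T \<psi> y (norm x + t))) / norm y)"
      (is "_ = ?A + ?B")
    proof -
      have "W (x, norm x) / (4 * pi) = ?A"
        by (subst W_eq) (auto simp: P_def simp flip: integral_divide_zero intro!: Bochner_Integration.integral_cong)
      moreover have "norm x * integral {0..T} (\<lambda>t. ?V1 (x, t) * W (x, norm x + t)) = ?B"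
        unfolding I1 by (auto simp flip: integral_mult_right_zero intro!: Bochner_Integration.integral_cong)
      ultimately show ?thesis by simp
    qed
    also have "\<dots> = (LINT y|lborel. P y * (time_part ?V2 T \<psi> y (norm x) / (4 * pi)) / norm y
        + P y * (norm x * integral {0..T} (\<lambda>t. ?V1 (x, t) * time_part ?V2 T \<psi> y (norm x + t))) / norm y)"
      by (rule Bochner_Integration.integral_add[OF over over, symmetric]) (intro continuous_intros tp Jc; simp)+
    also have "\<dots> = (LINT y|lborel. (q2 y - q1 x) * source_kernel ?V1 ?V2 T \<psi> x y * b (x + y - e) / norm y)"
      by (intro Bochner_Integration.integral_cong refl)
        (simp add: P_def source_kernel_def distrib_left distrib_right add_divide_distrib mult_ac)
    finally show ?thesis .
  qed
  have "u1 W = (LINT x|lborel. slice ?V1 T W x / norm x)"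
    by (rule regular_part_representation[OF r1 c1 W(1)]) (use W0 in auto)
  then have right: "u2 K - u1 K = (LINT x|lborel. (LINT y|lborel. (q2 y - q1 x) * source_kernel ?V1 ?V2 T \<psi> x y * b (x + y - e) / norm y) / norm x)"
    unfolding W(2) slice_W .
  have over: "integrable lborel (\<lambda>y. b (y - e) * time_part V T \<psi> y 0 / norm y)" if V: "continuous_on UNIV V" for V
  proof -
    have "continuous_on UNIV (\<lambda>y. time_part V T \<psi> y 0)"
      using continuous_on_compose2[OF time_part_continuous[OF V \<psi>c, of T], of UNIV "\<lambda>z. (z, 0)"]
      by (simp add: continuous_on_Pair continuous_on_const continuous_on_id)
    then have c: "continuous_on UNIV (\<lambda>y. b (y - e) * time_part V T \<psi> y 0)" by (intro continuous_intros bc')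
    let ?R = "norm e + 1"
    have z: "b (y - e) * time_part V T \<psi> y 0 = 0" if "y \<notin> cball 0 ?R" for y using that b1[of y] by simp
    obtain M where M: "M > 0" "\<And>y. \<bar>b (y - e) * time_part V T \<psi> y 0\<bar> \<le> M"
      using continuous_bounded_compact_support[OF continuous_on_subset[OF c subset_UNIV] compact_cball z] by blast
    show ?thesis
      by (rule integrable_over_norm[of _ M ?R]) (use M b1 borel_measurable_continuous_onI[OF c] in auto)
  qed
  have "u2 K - u1 K = (LINT y|lborel. b (y - e) * time_part ?V2 T \<psi> y 0 / norm y - b (y - e) * time_part ?V1 T \<psi> y 0 / norm y)"
    unfolding uK[OF r1 c1] uK[OF r2 c2]
    by (rule Bochner_Integration.integral_diff[OF over[OF cone_part_v2] over[OF cone_part_v1], symmetric])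
  also have "\<dots> = (LINT y|lborel. (integral {0..T} (\<lambda>s. (?V2 (y, s) - ?V1 (y, s)) * \<psi> (norm y + s))) * b (y - e))"
  proof (rule integral_cong_AE)
    show "(\<lambda>y. b (y - e) * time_part ?V2 T \<psi> y 0 / norm y - b (y - e) * time_part ?V1 T \<psi> y 0 / norm y) \<in> borel_measurable lborel"
      using over[OF cone_part_v1] over[OF cone_part_v2] by (intro borel_measurable_diff borel_measurable_integrable)
    have "continuous_on UNIV (\<lambda>p. (?V2 (fst p, snd p) - ?V1 (fst p, snd p)) * \<psi> (norm (fst p) + snd p))"
      by (intro continuous_intros continuous_on_compose2[OF cone_part_v1] continuous_on_compose2[OF cone_part_v2] continuous_on_compose2[OF \<psi>c]) auto
    from continuous_on_integral_param[OF this, of T]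
    have "continuous_on UNIV (\<lambda>y. (integral {0..T} (\<lambda>s. (?V2 (y, s) - ?V1 (y, s)) * \<psi> (norm y + s))) * b (y - e))"
      by (intro continuous_intros bc') simp
    then show "(\<lambda>y. (integral {0..T} (\<lambda>s. (?V2 (y, s) - ?V1 (y, s)) * \<psi> (norm y + s))) * b (y - e)) \<in> borel_measurable lborel"
      using borel_measurable_continuous_onI by simp
    show "AE y in lborel. b (y - e) * time_part ?V2 T \<psi> y 0 / norm y - b (y - e) * time_part ?V1 T \<psi> y 0 / norm y
      = (integral {0..T} (\<lambda>s. (?V2 (y, s) - ?V1 (y, s)) * \<psi> (norm y + s))) * b (y - e)"
      using AE_lborel_neq[of 0]
    proof eventually_elim
      fix y :: space assume y: "y \<noteq> 0"
      have int: "(\<lambda>s. V (y, s) * \<psi> (norm y + s)) integrable_on {0..T}" if "continuous_on UNIV V" for V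
        by (intro integrable_continuous_real continuous_intros continuous_on_compose2[OF that] continuous_on_compose2[OF \<psi>c]) auto
      have eq: "integral {0..T} (\<lambda>s. (?V2 (y, s) - ?V1 (y, s)) * \<psi> (norm y + s))
        = integral {0..T} (\<lambda>s. ?V2 (y, s) * \<psi> (norm y + s)) - integral {0..T} (\<lambda>s. ?V1 (y, s) * \<psi> (norm y + s))"
        using Henstock_Kurzweil_Integration.integral_diff[OF int[OF cone_part_v2] int[OF cone_part_v1]] by (simp add: left_diff_distrib)
      \<comment> \<open>Here a is the common singular contribution, d the norm of y, and i, j are
        the time integrals of the regular parts.\<close>
      have alg: "\<beta> * (a + d * i) / d - \<beta> * (a + d * j) / d = (i - j) * \<beta>" if "d \<noteq> 0" for a d i j \<beta> :: real
        using that by (simp add: field_simps)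
      show "b (y - e) * time_part ?V2 T \<psi> y 0 / norm y - b (y - e) * time_part ?V1 T \<psi> y 0 / norm y
        = (integral {0..T} (\<lambda>s. (?V2 (y, s) - ?V1 (y, s)) * \<psi> (norm y + s))) * b (y - e)"
        unfolding eq time_part_def add_0 by (rule alg) (use y in simp)
    qed
  qed
  finally show ?thesis using right by simp
qed

text \<open>Let the bump shrink to e in \<open>duality_kernel\<close>: the left side tends to the
  value at e of a continuous function, which the data annihilate, and on the right y is forced to
  equal e - x.\<close>

lemma limit_identity:
  assumes \<psi>: "smooth \<psi>" and \<psi>0: "\<And>t. t \<ge> T \<Longrightarrow> \<psi> t = 0" "\<And>t. t \<le> - 1 \<Longrightarrow> \<psi> t = 0"
    and \<beta>: "mollifier \<beta>" "\<And>n. smooth (\<beta> n)" and T: "T \<ge> 0" and e: "norm e = 1"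
    and data: "\<And>t. t \<in> {0..T} \<Longrightarrow> v1 (e, t) = v2 (e, t)"
  shows "(LINT x|lborel. (q2 (e - x) - q1 x) * source_kernel (cone_part v1) (cone_part v2) T \<psi> x (e - x) / (norm x * norm (e - x))) = 0"
proof -
  let ?V1 = "cone_part v1" and ?V2 = "cone_part v2"
  have \<psi>c: "continuous_on UNIV \<psi>" using \<psi> by (auto intro: smooth_continuous_on)
  define g where "g p = (q2 (snd p) - q1 (fst p)) * source_kernel ?V1 ?V2 T \<psi> (fst p) (snd p)" for p
  have g: "continuous_on UNIV g"
    unfolding g_def
    by (intro continuous_intros source_kernel_continuous cone_part_v1 cone_part_v2 \<psi>c continuous_on_compose2[OF c1] continuous_on_compose2[OF c2]) auto
  have g0: "g p = 0" if "p \<notin> cball 0 T \<times> cball 0 T" for p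
  proof -
    have "norm (fst p) > T \<or> norm (snd p) > T" using that by (cases p) auto
    then have "norm (fst p) + norm (snd p) \<ge> T" using norm_ge_zero[of "fst p"] norm_ge_zero[of "snd p"] by linarith
    then show ?thesis using source_kernel_eq_0[of T \<psi>, OF \<psi>0(1)] by (simp add: g_def)
  qed
  have lim1: "(\<lambda>n. LINT x|lborel. (LINT y|lborel. g (x, y) * \<beta> n (x + y - e) / norm y) / norm x)
      \<longlonglongrightarrow> (LINT x|lborel. g (x, e - x) / (norm x * norm (e - x)))"
    by (rule mollifier_double_limit[OF \<beta>(1) g compact_Times[OF compact_cball compact_cball] g0 e])
  define D where "D y = integral {0..T} (\<lambda>s. (?V2 (y, s) - ?V1 (y, s)) * \<psi> (norm y + s))" for y
  have "continuous_on UNIV (\<lambda>p. (?V2 (fst p, snd p) - ?V1 (fst p, snd p)) * \<psi> (norm (fst p) + snd p))"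
    by (intro continuous_intros continuous_on_compose2[OF cone_part_v1] continuous_on_compose2[OF cone_part_v2] continuous_on_compose2[OF \<psi>c]) auto
  from continuous_on_integral_param[OF this, of T] have "continuous_on UNIV D" by (simp add: D_def)
  from mollifier_limit[OF \<beta>(1) this, of e]
  have lim2: "(\<lambda>n. LINT y|lborel. D y * \<beta> n (y - e)) \<longlonglongrightarrow> D e" .
  have "D e = integral {0..T} (\<lambda>s. 0)"
    unfolding D_def
  proof (rule Henstock_Kurzweil_Integration.integral_cong)
    fix s assume s: "s \<in> {0..T}"
    show "(?V2 (e, s) - ?V1 (e, s)) * \<psi> (norm e + s) = 0"
    \<comment> \<open>As |e| = 1, the characteristic variable s corresponds to time 1 + s at e: up
      to T the data apply, later \<psi> vanishes.\<close>
    proof (cases "1 + s \<le> T")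
      case True
      then show ?thesis using data[of "1 + s"] s by (simp add: cone_part_def e)
    next
      case False
      then show ?thesis using \<psi>0(1)[of "1 + s"] by (simp add: e)
    qed
  qed
  then have De: "D e = 0" by simp
  have "\<beta> n z = 0" if "norm z \<ge> 1" for n z
  proof -
    have "1 / real (n + 1) \<le> 1" by simp
    then show ?thesis using that by (intro mollifier_zero[OF \<beta>(1)]) linarith
  qed
  from duality_kernel[OF \<psi> \<psi>0 \<beta>(2) this T]
  have "(LINT y|lborel. D y * \<beta> n (y - e)) = (LINT x|lborel. (LINT y|lborel. g (x, y) * \<beta> n (x + y - e) / norm y) / norm x)" for n
    unfolding D_def g_def by simp
  then have "(\<lambda>n. LINT x|lborel. (LINT y|lborel. g (x, y) * \<beta> n (x + y - e) / norm y) / norm x) \<longlonglongrightarrow> 0"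
    using lim2 De by simp
  from LIMSEQ_unique[OF lim1 this] show ?thesis by (simp add: g_def)
qed

end

section \<open>Mollifiers, test weights and the kernel estimate\<close>

text \<open>The normalized bump exp (- 1/(1 - (n + 1)^2 |x|^2)). The squared norm is spelled out in
  coordinates so that smoothness comes from linear functions.\<close>

lemma mollifier_exists:
  obtains \<beta> where "mollifier \<beta>" "\<And>n. smooth (\<beta> n)"
proof -
  define f :: "nat \<Rightarrow> space \<Rightarrow> real" where
    "f n x = expinv 0 (1 - (real (n + 1))\<^sup>2 * (\<Sum>b\<in>Basis. (x \<bullet> b) * (x \<bullet> b)))" for n x
  have nrm: "(\<Sum>b\<in>Basis. (x \<bullet> b) * (x \<bullet> b)) = (norm x)\<^sup>2" for x :: space
    unfolding power2_norm_eq_inner euclidean_inner[of x x] ..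
  have f_smooth: "smooth (f n)" for n
    unfolding f_def
    by (intro smooth_expinv smooth_diff smooth_const smooth_mult smooth_sum smooth_linear bounded_linear_inner_left) auto
  have f_cont: "continuous_on S (f n)" for S n by (rule smooth_continuous_on[OF f_smooth])
  have f0: "f n x = 0" if "norm x \<ge> 1 / real (n + 1)" for n x
  proof -
    have "1 \<le> real (n + 1) * norm x" using that by (simp add: field_simps)
    then have "1 \<le> (real (n + 1) * norm x)\<^sup>2" by (metis one_le_power)
    then show ?thesis unfolding f_def nrm expinv_eq_0_iff by (simp add: power_mult_distrib)
  qed
  have f_nn: "f n x \<ge> 0" for n x by (simp add: f_def expinv_nonneg)
  have f_int: "integrable lborel (f n)" for n
  proof (rule integrable_compact_support[of _ "cball 0 (1 / real (n + 1))"])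
    show "f n x = 0" if "x \<notin> cball 0 (1 / real (n + 1))" for x using that by (intro f0) simp
  qed (auto intro: f_cont)
  have f_pos: "(LINT x|lborel. f n x) > 0" for n
  \<comment> \<open>A nonnegative function with zero integral vanishes almost everywhere, yet this
    one is positive on an open set around 0.\<close>
  proof (rule ccontr)
    assume "\<not> ?thesis"
    moreover have "(LINT x|lborel. f n x) \<ge> 0" by (intro integral_nonneg_AE) (simp add: f_nn)
    ultimately have "(LINT x|lborel. f n x) = 0" by simp
    then have ae: "AE x in lborel. f n x = 0"
      using integral_nonneg_eq_0_iff_AE[OF f_int] f_nn by simp
    define S where "S = {x. 0 < f n x}"
    have "open S" unfolding S_def by (intro open_Collect_less continuous_intros f_cont)
    moreover have "0 \<in> S" by (simp add: S_def f_def nrm expinv_pos_iff)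
    ultimately have "\<not> negligible S" using open_not_negligible by blast
    moreover have "S \<in> null_sets lebesgue"
    proof -
      have "S \<in> null_sets lborel"
        using ae \<open>open S\<close> by (subst AE_iff_null_sets) (auto simp: S_def elim!: eventually_mono)
      then show ?thesis by (rule null_sets_completionI)
    qed
    ultimately show False by (simp add: negligible_iff_null_sets)
  qed
  define \<beta> where "\<beta> n x = inverse (LINT x|lborel. f n x) * f n x" for n x
  show thesis
  proof (rule that)
    show "smooth (\<beta> n)" for n unfolding \<beta>_def by (intro smooth_mult smooth_const f_smooth)
    show "mollifier \<beta>"
      unfolding mollifier_def
    proof (intro allI conjI impI)
      fix n z
      show "continuous_on UNIV (\<beta> n)" unfolding \<beta>_def by (intro continuous_intros f_cont)
      show "0 \<le> \<beta> n z" using f_nn f_pos[of n] by (simp add: \<beta>_def)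
      show "\<beta> n z = 0" if "1 / real (n + 1) \<le> norm z" using f0[OF that] by (simp add: \<beta>_def)
      show "(LINT z|lborel. \<beta> n z) = 1" using f_pos[of n] unfolding \<beta>_def by simp
    qed
  qed
qed

text \<open>The sign is regularized as h/(|h| + 1/(k + 1)). To obtain smooth functions with the
  prescribed zeros, a continuous F k is replaced by a Weierstrass polynomial and multiplied by the
  bump \<eta>, positive exactly on (-1, T). The factor 2 in the bound leaves one exp (- c t) for the
  function and one for the approximation error.\<close>

lemma sgn_approximation:
  fixes f :: "real \<Rightarrow> real" and T c :: real
  assumes f: "continuous_on {1..T} f" and T: "T > 1"
  obtains \<psi> :: "nat \<Rightarrow> real \<Rightarrow> real"
  where "\<And>k. smooth (\<psi> k)" "\<And>k t. t \<ge> T \<Longrightarrow> \<psi> k t = 0" "\<And>k t. t \<le> - 1 \<Longrightarrow> \<psi> k t = 0"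
    "\<And>k t. t \<ge> 0 \<Longrightarrow> \<bar>\<psi> k t\<bar> \<le> 2 * exp (- c * t)"
    "\<And>t. 1 \<le> t \<Longrightarrow> t < T \<Longrightarrow> (\<lambda>k. \<psi> k t) \<longlonglongrightarrow> sgn (f t) * exp (- c * t)"
proof -
  define \<eta> where "\<eta> t = expinv 0 ((t + 1) * (T - t))" for t
  have id: "smooth (\<lambda>t::real. t)" by (rule smooth_linear) (rule bounded_linear_ident)
  have \<eta>: "smooth \<eta>" unfolding \<eta>_def by (intro smooth_expinv smooth_mult smooth_add smooth_diff smooth_const id)
  have \<eta>_nn: "\<eta> t \<ge> 0" and \<eta>_le: "\<eta> t \<le> 1" for t by (simp_all add: \<eta>_def expinv_nonneg expinv_0_le_1)
  have \<eta>_0: "\<eta> t = 0" if "t \<ge> T \<or> t \<le> - 1" for t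
    unfolding \<eta>_def expinv_eq_0_iff mult_le_0_iff using that T by auto
  have \<eta>_pos: "\<eta> t > 0" if "- 1 < t" "t < T" for t
    unfolding \<eta>_def expinv_pos_iff using that by simp
  \<comment> \<open>Constant extension of f beyond [1, T], so that the approximation can run on
    [0, T].\<close>
  define h where "h t = f (max 1 (min t T))" for t
  have h: "continuous_on UNIV h"
    unfolding h_def by (intro continuous_on_compose2[OF f] continuous_intros) (use T in auto)
  \<comment> \<open>The last factor is a regularized 1/\<eta>: after multiplication by \<eta> it
    becomes \<eta>/(1/(k + 1) + \<eta>), which is at most 1 and tends to 1 where \<eta> > 0.\<close>
  define F where "F k t = h t / (\<bar>h t\<bar> + inverse (real (Suc k))) * exp (- c * t) * (real (Suc k) / (1 + real (Suc k) * \<eta> t))" for k t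
  have den: "1 + real (Suc k) * \<eta> t > 0" for k t using \<eta>_nn[of t] by (intro add_pos_nonneg) auto
  have F: "continuous_on {0..T} (F k)" for k
  proof -
    have 1: "\<bar>h t\<bar> + inverse (real (Suc k)) \<noteq> 0" for t
      using abs_ge_zero[of "h t"] by (metis add_nonneg_pos inverse_positive_iff_positive less_irrefl of_nat_0_less_iff zero_less_Suc)
    have 2: "1 + real (Suc k) * \<eta> t \<noteq> 0" for t using den[of k t] by simp
    show ?thesis unfolding F_def
      by (intro continuous_intros continuous_on_subset[OF h] smooth_continuous_on[OF \<eta>]) (use 1 2 in auto)
  qed
  \<comment> \<open>Tends to 0 and stays below exp (- c t) on [0, T] for either sign of c.\<close>
  define \<delta> where "\<delta> k = exp (- \<bar>c\<bar> * T) * inverse (real (Suc k))" for k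
  have \<delta>: "\<delta> k > 0" for k by (simp add: \<delta>_def)
  have "\<exists>g. real_polynomial_function g \<and> (\<forall>t\<in>{0..T}. \<bar>F k t - g t\<bar> < \<delta> k)" for k
    using Stone_Weierstrass_real_polynomial_function[OF compact_Icc F \<delta>] by metis
  then obtain p where p: "\<And>k. real_polynomial_function (p k)" "\<And>k t. t \<in> {0..T} \<Longrightarrow> \<bar>F k t - p k t\<bar> < \<delta> k"
    by metis
  define \<psi> where "\<psi> k t = \<eta> t * p k t" for k t
  have diff: "\<bar>\<psi> k t - \<eta> t * F k t\<bar> \<le> \<delta> k" if "t \<in> {0..T}" for k t
  proof -
    have "\<bar>\<psi> k t - \<eta> t * F k t\<bar> = \<eta> t * \<bar>F k t - p k t\<bar>"
      using \<eta>_nn[of t] by (simp add: \<psi>_def abs_mult abs_minus_commute flip: right_diff_distrib)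
    also have "\<dots> \<le> 1 * \<delta> k" using p(2)[OF that, of k] \<eta>_nn[of t] \<eta>_le[of t] by (intro mult_mono) auto
    finally show ?thesis by simp
  qed
  have \<eta>F: "\<eta> t * F k t = (h t / (\<bar>h t\<bar> + inverse (real (Suc k)))) * (\<eta> t / (inverse (real (Suc k)) + \<eta> t)) * exp (- c * t)" for k t
  proof -
    have "real (Suc k) / (1 + real (Suc k) * \<eta> t) = 1 / (inverse (real (Suc k)) + \<eta> t)"
    proof -
      have "m / (1 + m * a) = 1 / (inverse m + a)" if "m > 0" "1 + m * a > 0" for m a :: real
      proof -
        have "inverse m + a = (1 + m * a) / m" using that by (simp add: field_simps)
        then show ?thesis by simp
      qed
      from this[OF _ den[of k t]] show ?thesis by simp
    qed
    then show ?thesis by (simp add: F_def del: of_nat_Suc)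
  qed
  have \<eta>F_le: "\<bar>\<eta> t * F k t\<bar> \<le> exp (- c * t)" for k t
  proof -
    have "\<bar>h t / (\<bar>h t\<bar> + inverse (real (Suc k)))\<bar> \<le> 1"
      by (simp add: abs_divide divide_le_eq add_nonneg_pos abs_of_pos del: of_nat_Suc)
    moreover have "\<bar>\<eta> t / (inverse (real (Suc k)) + \<eta> t)\<bar> \<le> 1"
      using \<eta>_nn[of t] by (simp add: abs_divide divide_le_eq add_pos_nonneg abs_of_pos del: of_nat_Suc)
    ultimately have "\<bar>h t / (\<bar>h t\<bar> + inverse (real (Suc k)))\<bar> * \<bar>\<eta> t / (inverse (real (Suc k)) + \<eta> t)\<bar> \<le> 1"
      by (intro mult_le_one) auto
    from mult_right_mono[OF this, of "exp (- c * t)"]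
    show ?thesis unfolding \<eta>F abs_mult abs_exp_cancel by simp
  qed
  have \<delta>_le: "\<delta> k \<le> exp (- c * t)" if "t \<in> {0..T}" for k t
  proof -
    have "inverse (real (Suc k)) \<le> 1" by (simp add: inverse_eq_divide)
    then have "\<delta> k \<le> exp (- \<bar>c\<bar> * T)" unfolding \<delta>_def by (intro mult_left_le) auto
    also have "c * t \<le> \<bar>c\<bar> * T" using that by (intro mult_mono) auto
    then have "exp (- \<bar>c\<bar> * T) \<le> exp (- c * t)" by simp
    finally show ?thesis .
  qed
  show thesis
  proof (rule that)
    show "smooth (\<psi> k)" for k unfolding \<psi>_def by (intro smooth_mult \<eta> smooth_polynomial p)
    show "\<psi> k t = 0" if "t \<ge> T" for k t using \<eta>_0 that by (simp add: \<psi>_def)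
    show "\<psi> k t = 0" if "t \<le> - 1" for k t using \<eta>_0 that by (simp add: \<psi>_def)
    show "\<bar>\<psi> k t\<bar> \<le> 2 * exp (- c * t)" if "t \<ge> 0" for k t
    proof (cases "t \<le> T")
      case True
      then show ?thesis using diff[of t k] \<eta>F_le[of t k] \<delta>_le[of t k] that by simp
    next
      case False
      then show ?thesis using \<eta>_0 by (simp add: \<psi>_def)
    qed
    fix t assume t: "1 \<le> t" "t < T"
    have lim_inv: "(\<lambda>k. inverse (real (Suc k))) \<longlonglongrightarrow> 0" by (rule LIMSEQ_inverse_real_of_nat)
    have l1: "(\<lambda>k. h t / (\<bar>h t\<bar> + inverse (real (Suc k)))) \<longlonglongrightarrow> sgn (f t)"
    proof (cases "h t = 0")
      case True
      moreover have "h t = f t" using t by (simp add: h_def)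
      ultimately show ?thesis by simp
    next
      case False
      have "(\<lambda>k. h t / (\<bar>h t\<bar> + inverse (real (Suc k)))) \<longlonglongrightarrow> h t / (\<bar>h t\<bar> + 0)"
        using False by (intro tendsto_intros lim_inv) auto
      also have "h t / (\<bar>h t\<bar> + 0) = sgn (f t)"
        using t by (simp add: h_def sgn_if abs_if)
      finally show ?thesis .
    qed
    have "(\<lambda>k. \<eta> t / (inverse (real (Suc k)) + \<eta> t)) \<longlonglongrightarrow> \<eta> t / (0 + \<eta> t)"
      using \<eta>_pos[of t] t by (intro tendsto_intros lim_inv) auto
    then have l2: "(\<lambda>k. \<eta> t / (inverse (real (Suc k)) + \<eta> t)) \<longlonglongrightarrow> 1"
      using \<eta>_pos[of t] t by simp
    have "(\<lambda>k. \<eta> t * F k t) \<longlonglongrightarrow> sgn (f t) * 1 * exp (- c * t)"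
      unfolding \<eta>F by (intro tendsto_mult l1 l2 tendsto_const)
    moreover have "(\<lambda>k. \<psi> k t - \<eta> t * F k t) \<longlonglongrightarrow> 0"
    proof (rule Lim_null_comparison)
      show "\<forall>\<^sub>F k in sequentially. norm (\<psi> k t - \<eta> t * F k t) \<le> \<delta> k" using diff t by simp
      have "\<delta> \<longlonglongrightarrow> exp (- \<bar>c\<bar> * T) * 0" unfolding \<delta>_def by (intro tendsto_intros lim_inv)
      then show "\<delta> \<longlonglongrightarrow> 0" by simp
    qed
    ultimately show "(\<lambda>k. \<psi> k t) \<longlonglongrightarrow> sgn (f t) * exp (- c * t)"
      using tendsto_add by fastforce
  qed
qed

text \<open>The source of the gain 1/c: the exponential beyond a integrates to at most 1/c of its
  value at a, whatever the length of the interval.\<close>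

lemma integral_exp_le:
  fixes c a T :: real
  assumes c: "c > 0" and T: "T \<ge> 0"
  shows "integral {0..T} (\<lambda>s. exp (- c * (a + s))) \<le> exp (- c * a) / c"
proof -
  have "((\<lambda>s. exp (- c * (a + s))) has_integral (- exp (- c * (a + T)) / c - (- exp (- c * (a + 0)) / c))) {0..T}"
  proof (rule fundamental_theorem_of_calculus[OF T])
    fix s assume "s \<in> {0..T}"
    show "((\<lambda>s. - exp (- c * (a + s)) / c) has_vector_derivative exp (- c * (a + s))) (at s within {0..T})"
      unfolding has_real_derivative_iff_has_vector_derivative[symmetric]
      using c by (auto intro!: derivative_eq_intros)
  qed
  then have "integral {0..T} (\<lambda>s. exp (- c * (a + s))) = - exp (- c * (a + T)) / c - (- exp (- c * (a + 0)) / c)"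
    by (rule integral_unique)
  also have "\<dots> \<le> exp (- c * a) / c" using c by simp
  finally show ?thesis .
qed

lemma integral_bound_exp:
  fixes g :: "real \<Rightarrow> real"
  assumes g: "continuous_on {0..T} g" and c: "c > 0" and T: "T \<ge> 0" and A: "A \<ge> 0"
    and b: "\<And>s. s \<in> {0..T} \<Longrightarrow> \<bar>g s\<bar> \<le> A * exp (- c * (a + s))"
  shows "\<bar>integral {0..T} g\<bar> \<le> A * (exp (- c * a) / c)"
proof -
  have "norm (integral {0..T} g) \<le> integral {0..T} (\<lambda>s. A * exp (- c * (a + s)))"
    using b by (intro Henstock_Kurzweil_Integration.integral_norm_bound_integral integrable_continuous_real g continuous_intros) auto
  also have "\<dots> = A * integral {0..T} (\<lambda>s. exp (- c * (a + s)))" by (rule integral_mult_right)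
  also have "\<dots> \<le> A * (exp (- c * a) / c)" by (intro mult_left_mono integral_exp_le c T A)
  finally show ?thesis by simp
qed

text \<open>The regular parts smooth in time: tested against weights of size \<open>exp (- c t)\<close>, they
  contribute less to the kernel than the singular parts by a factor \<open>1/c\<close>.\<close>

lemma source_kernel_bound:
  assumes V1: "continuous_on UNIV V1" and V2: "continuous_on UNIV V2" and \<psi>: "continuous_on UNIV \<psi>"
    and \<psi>b: "\<And>t. t \<ge> 0 \<Longrightarrow> \<bar>\<psi> t\<bar> \<le> 2 * exp (- c * t)" and c: "c \<ge> 1" and T: "T \<ge> 0" and M: "M \<ge> 0"
    and V1b: "\<And>x s. norm x \<le> T \<Longrightarrow> s \<in> {0..T} \<Longrightarrow> \<bar>V1 (x, s)\<bar> \<le> M"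
    and V2b: "\<And>x s. norm x \<le> T \<Longrightarrow> s \<in> {0..T} \<Longrightarrow> \<bar>V2 (x, s)\<bar> \<le> M"
    and x: "norm x \<le> T" and y: "norm y \<le> T"
  shows "\<bar>source_kernel V1 V2 T \<psi> x y - \<psi> (norm x + norm y) / (16 * pi\<^sup>2)\<bar>
    \<le> (4 * T * M + 2 * T * T * M * M) * (exp (- c * (norm x + norm y)) / c)"
proof -
  have c0: "c > 0" using c by simp
  \<comment> \<open>What the regular part of u2 contributes to \<open>time_part\<close>; its time
    integral already carries a factor 1/c.\<close>
  define E where "E r = norm y * integral {0..T} (\<lambda>s. V2 (y, s) * \<psi> (r + norm y + s))" for r
  have tp: "time_part V2 T \<psi> y r = \<psi> (r + norm y) / (4 * pi) + E r" for r by (simp add: time_part_def E_def)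
  have Eb: "\<bar>E r\<bar> \<le> 2 * T * M * (exp (- c * (r + norm y)) / c)" if r: "r \<ge> 0" for r
  proof -
    have "\<bar>integral {0..T} (\<lambda>s. V2 (y, s) * \<psi> (r + norm y + s))\<bar> \<le> 2 * M * (exp (- c * (r + norm y)) / c)"
    proof (rule integral_bound_exp[OF _ c0 T])
      show "continuous_on {0..T} (\<lambda>s. V2 (y, s) * \<psi> (r + norm y + s))"
        by (intro continuous_intros continuous_on_compose2[OF V2] continuous_on_compose2[OF \<psi>]) auto
      show "0 \<le> 2 * M" using M by simp
      fix s assume s: "s \<in> {0..T}"
      have "\<bar>V2 (y, s)\<bar> * \<bar>\<psi> (r + norm y + s)\<bar> \<le> M * (2 * exp (- c * (r + norm y + s)))"
        using s r M by (intro mult_mono V2b[OF y s] \<psi>b) auto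
      then show "\<bar>V2 (y, s) * \<psi> (r + norm y + s)\<bar> \<le> 2 * M * exp (- c * (r + norm y + s))"
        by (simp add: abs_mult)
    qed
    then have "norm y * \<bar>integral {0..T} (\<lambda>s. V2 (y, s) * \<psi> (r + norm y + s))\<bar> \<le> T * (2 * M * (exp (- c * (r + norm y)) / c))"
      using y T by (intro mult_mono) auto
    then show ?thesis by (simp add: E_def abs_mult mult_ac)
  qed
  let ?w = "norm x + norm y"
  have p1: "1 \<le> 4 * pi" using pi_ge_two by simp
  define J where "J = integral {0..T} (\<lambda>t. V1 (x, t) * time_part V2 T \<psi> y (norm x + t))"
  have tpc: "continuous_on {0..T} (\<lambda>t. time_part V2 T \<psi> y (norm x + t))"
    using continuous_on_compose2[OF time_part_continuous[OF V2 \<psi>, of T], of "{0..T}" "\<lambda>t. (y, norm x + t)"]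
    by (simp add: continuous_on_Pair continuous_on_const continuous_on_id continuous_on_add)
  have Jb: "\<bar>J\<bar> \<le> M * (2 + 2 * T * M / c) * (exp (- c * ?w) / c)"
    unfolding J_def
  proof (rule integral_bound_exp[OF _ c0 T])
    show "continuous_on {0..T} (\<lambda>t. V1 (x, t) * time_part V2 T \<psi> y (norm x + t))"
      by (intro continuous_intros continuous_on_compose2[OF V1] tpc) auto
    show "0 \<le> M * (2 + 2 * T * M / c)" using M T c by simp
    fix s assume s: "s \<in> {0..T}"
    have "\<bar>time_part V2 T \<psi> y (norm x + s)\<bar> \<le> \<bar>\<psi> (norm x + s + norm y)\<bar> / (4 * pi) + \<bar>E (norm x + s)\<bar>"
      unfolding tp by (rule order_trans[OF abs_triangle_ineq]) (simp add: abs_divide)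
    also have "\<dots> \<le> 2 * exp (- c * (?w + s)) + 2 * T * M * (exp (- c * (?w + s)) / c)"
    proof (rule add_mono)
      have "\<bar>\<psi> (norm x + s + norm y)\<bar> / (4 * pi) \<le> \<bar>\<psi> (norm x + s + norm y)\<bar> / 1"
        using p1 by (intro divide_left_mono) auto
      also have "\<dots> \<le> 2 * exp (- c * (?w + s))" using \<psi>b[of "norm x + s + norm y"] s by (simp add: add_ac)
      finally show "\<bar>\<psi> (norm x + s + norm y)\<bar> / (4 * pi) \<le> 2 * exp (- c * (?w + s))" .
      show "\<bar>E (norm x + s)\<bar> \<le> 2 * T * M * (exp (- c * (?w + s)) / c)"
        using Eb[of "norm x + s"] s by (simp add: add_ac)
    qed
    also have "\<dots> = (2 + 2 * T * M / c) * exp (- c * (?w + s))" by (simp add: algebra_simps)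
    finally have "\<bar>V1 (x, s)\<bar> * \<bar>time_part V2 T \<psi> y (norm x + s)\<bar> \<le> M * ((2 + 2 * T * M / c) * exp (- c * (?w + s)))"
      using M by (intro mult_mono V1b[OF x s]) auto
    then show "\<bar>V1 (x, s) * time_part V2 T \<psi> y (norm x + s)\<bar> \<le> M * (2 + 2 * T * M / c) * exp (- c * (?w + s))"
      by (simp add: abs_mult mult.assoc)
  qed
  define X where "X = exp (- c * ?w) / c"
  have X: "X \<ge> 0" using c by (simp add: X_def)
  have "\<psi> (norm x + norm y) / (4 * pi) / (4 * pi) = \<psi> ?w / (16 * pi\<^sup>2)" by (simp add: power2_eq_square)
  then have "source_kernel V1 V2 T \<psi> x y - \<psi> ?w / (16 * pi\<^sup>2) = E (norm x) / (4 * pi) + norm x * J"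
    by (simp add: source_kernel_def tp J_def add_divide_distrib)
  also have "\<bar>\<dots>\<bar> \<le> \<bar>E (norm x)\<bar> / (4 * pi) + norm x * \<bar>J\<bar>"
    by (rule order_trans[OF abs_triangle_ineq]) (simp add: abs_divide abs_mult)
  \<comment> \<open>Regular part of u2 against the singular part of u1: 2TM. Regular part of u1
    against the singular and the regular part of u2: 2TM and 2TTMM. The double integral would even
    gain a second 1/c, which c \<ge> 1 allows to drop.\<close>
  also have "\<dots> \<le> 2 * T * M * X + T * (M * (2 + 2 * T * M) * X)"
  proof (rule add_mono)
    have "\<bar>E (norm x)\<bar> / (4 * pi) \<le> \<bar>E (norm x)\<bar> / 1" using p1 by (intro divide_left_mono) auto
    also have "\<dots> \<le> 2 * T * M * X" using Eb[of "norm x"] by (simp add: X_def)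
    finally show "\<bar>E (norm x)\<bar> / (4 * pi) \<le> 2 * T * M * X" .
    have "2 * T * M / c \<le> 2 * T * M" using c T M divide_left_mono[of 1 c "2 * T * M"] by simp
    then have "M * (2 + 2 * T * M / c) * X \<le> M * (2 + 2 * T * M) * X"
      using M X by (intro mult_right_mono mult_left_mono) auto
    then have "\<bar>J\<bar> \<le> M * (2 + 2 * T * M) * X" using Jb unfolding X_def[symmetric] by (rule order_trans[rotated])
    then show "norm x * \<bar>J\<bar> \<le> T * (M * (2 + 2 * T * M) * X)" using x T by (intro mult_mono) auto
  qed
  also have "\<dots> = (4 * T * M + 2 * T * T * M * M) * X" by (simp add: algebra_simps)
  finally show ?thesis by (simp add: X_def)
qed

section \<open>Uniqueness\<close>

text \<open>Partial fractions separate the two foci, with numerator g = h/(|x| + |e - x|), still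
  bounded by N as the denominator is at least |e| = 1. The term singular at e becomes one singular
  at 0 under x -> e - x.\<close>

lemma integrable_over_norms:
  fixes e :: space
  assumes h: "h \<in> borel_measurable lborel" and N: "\<And>x. \<bar>h x\<bar> \<le> N" and R: "\<And>x. norm x > R \<Longrightarrow> h x = 0"
    and e: "norm e = 1"
  shows "integrable lborel (\<lambda>x. h x / (norm x * norm (e - x)))"
proof -
  define g where "g x = h x / (norm x + norm (e - x))" for x
  have w: "norm x + norm (e - x) \<ge> 1" for x using norm_triangle_ineq[of x "e - x"] e by simp
  have gm: "g \<in> borel_measurable borel"
    unfolding g_def using h
    by (intro borel_measurable_divide borel_measurable_continuous_onI[of "\<lambda>x. norm x + norm (e - x)"] continuous_intros) simp
  have gN: "\<bar>g x\<bar> \<le> N" for x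
  proof -
    have "\<bar>g x\<bar> \<le> \<bar>h x\<bar> / 1" unfolding g_def abs_divide using w[of x] by (intro frac_le) auto
    then show ?thesis using N[of x] by simp
  qed
  have i1: "integrable lborel (\<lambda>x. g x / norm x)"
  proof (rule integrable_over_norm[of _ N R])
    show "g \<in> borel_measurable lborel" using gm by simp
    show "g x = 0" if "norm x > R" for x using R[OF that] by (simp add: g_def)
  qed (rule gN)
  have "integrable lborel (\<lambda>x. g (e - x) / norm x)"
  proof (rule integrable_over_norm[of _ N "R + 1"])
    have "(\<lambda>x. e - x) \<in> borel_measurable borel" by (intro borel_measurable_continuous_onI continuous_intros)
    from measurable_compose[OF this gm] show "(\<lambda>x. g (e - x)) \<in> borel_measurable lborel" by simp
    show "g (e - x) = 0" if "norm x > R + 1" for x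
      using R[of "e - x"] that norm_triangle_ineq4[of e "e - x"] e by (simp add: g_def)
  qed (use gN in auto)
  from integrable_lborel_reflect[OF this, of e] have i2: "integrable lborel (\<lambda>x. g x / norm (e - x))" by simp
  have i: "integrable lborel (\<lambda>x. g x / norm x + g x / norm (e - x))" by (intro Bochner_Integration.integrable_add i1 i2)
  show ?thesis
  proof (rule integrable_cong_AE_imp[OF i])
    show "(\<lambda>x. h x / (norm x * norm (e - x))) \<in> borel_measurable lborel"
      using h by (intro borel_measurable_divide) (auto intro!: borel_measurable_continuous_onI continuous_intros)
    show "AE x in lborel. g x / norm x + g x / norm (e - x) = h x / (norm x * norm (e - x))"
      using AE_lborel_neq[of 0] AE_lborel_neq[of e]
    proof eventually_elim
      fix x assume "x \<noteq> 0" "x \<noteq> e"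
      then have "norm x > 0" "norm (e - x) > 0" by auto
      from partial_fractions[OF this, of "h x"]
      show "g x / norm x + g x / norm (e - x) = h x / (norm x * norm (e - x))" by (simp add: g_def)
    qed
  qed
qed

lemma Ck_on_Suc_continuous_on: "Ck_on (Suc k) f S \<Longrightarrow> continuous_on S f"
  by (meson Ck_on.simps(2) continuous_at_imp_continuous_on differentiable_imp_continuous_within)

lemma zero_ae_imp_zero:
  fixes q :: "'a::euclidean_space \<Rightarrow> real"
  assumes "open S" "continuous_on UNIV q" "AE x in lborel. x \<in> S \<longrightarrow> q x = 0" "x \<in> S"
  shows "q x = 0"
proof (rule ccontr)
  assume "q x \<noteq> 0"
  define U where "U = {x. q x \<noteq> 0} \<inter> S"
  have "open U" unfolding U_def by (intro open_Int assms open_Collect_neq continuous_intros)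
  moreover have "x \<in> U" using assms \<open>q x \<noteq> 0\<close> by (simp add: U_def)
  ultimately have "\<not> negligible U" using open_not_negligible by blast
  moreover have "U \<in> null_sets lborel"
    using assms(3) \<open>open U\<close> by (subst AE_iff_null_sets) (auto simp: U_def elim!: eventually_mono)
  then have "U \<in> null_sets lebesgue" by (rule null_sets_completionI)
  ultimately show False by (simp add: negligible_iff_null_sets)
qed

lemma (in point_source_pair) ellipsoidal_uniqueness:
  fixes e :: space and T :: real and f :: "real \<Rightarrow> real"
  assumes e: "norm e = 1" and T: "T > 1" and f: "continuous_on {1..T} f"
    and sym: "\<And>x. q2 (e - x) = q2 x"
    and qf: "\<And>x. norm x + norm (e - x) \<le> T \<Longrightarrow> q2 x - q1 x = f (norm x + norm (e - x))"
    and data: "\<And>t. t \<in> {0..T} \<Longrightarrow> v1 (e, t) = v2 (e, t)"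
    and x0: "norm x0 + norm (e - x0) \<le> T"
  shows "q1 x0 = q2 x0"
proof -
  let ?V1 = "cone_part v1" and ?V2 = "cone_part v2"
  define w where "w x = norm x + norm (e - x)" for x
  define q where "q x = q2 x - q1 x" for x
  define P where "P x = norm x * norm (e - x)" for x
  have P: "P x \<ge> 0" for x by (simp add: P_def)
  have qc: "continuous_on UNIV q" unfolding q_def by (intro continuous_intros c1 c2)
  have wc: "continuous_on UNIV w" unfolding w_def by (intro continuous_intros)
  have w1: "w x \<ge> 1" for x using norm_triangle_ineq[of x "e - x"] e by (simp add: w_def)
  have wT: "norm x \<le> T" "norm (e - x) \<le> T" if "w x < T" for x
    using that norm_ge_zero[of x] norm_ge_zero[of "e - x"] by (auto simp: w_def simp del: norm_ge_zero)
  have qT: "q x = f (w x)" if "w x < T" for x using qf[of x] that by (simp add: q_def w_def)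

  have "compact (cball (0::space) T \<times> {0..T})" by (intro compact_Times) auto
  then have "bounded (?V1 ` (cball 0 T \<times> {0..T}))" "bounded (?V2 ` (cball 0 T \<times> {0..T}))"
    by (auto intro!: compact_imp_bounded compact_continuous_image continuous_on_subset[OF cone_part_v1] continuous_on_subset[OF cone_part_v2])
  then obtain M1 M2 where "\<forall>z\<in>?V1 ` (cball 0 T \<times> {0..T}). norm z \<le> M1" "\<forall>z\<in>?V2 ` (cball 0 T \<times> {0..T}). norm z \<le> M2"
    unfolding bounded_iff by blast
  then have M12: "\<bar>?V1 (x, s)\<bar> \<le> M1" "\<bar>?V2 (x, s)\<bar> \<le> M2" if "norm x \<le> T" "s \<in> {0..T}" for x s
    using that by auto
  define M where "M = \<bar>M1\<bar> + \<bar>M2\<bar>"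
  have M: "M \<ge> 0" "\<And>x s. norm x \<le> T \<Longrightarrow> s \<in> {0..T} \<Longrightarrow> \<bar>?V1 (x, s)\<bar> \<le> M"
    "\<And>x s. norm x \<le> T \<Longrightarrow> s \<in> {0..T} \<Longrightarrow> \<bar>?V2 (x, s)\<bar> \<le> M"
    using M12 by (force simp: M_def)+
  define C where "C = 4 * T * M + 2 * T * T * M * M"
  have C: "C \<ge> 0" using T M(1) by (simp add: C_def)
  \<comment> \<open>Chosen to give 16 pi^2 C / c \<le> 1/2, the absorption inequality used at the
    end.\<close>
  define c where "c = 1 + 32 * pi\<^sup>2 * C"
  have c: "c \<ge> 1" using C by (simp add: c_def)

  obtain \<psi> where \<psi>: "\<And>k. smooth (\<psi> k)" "\<And>k t. t \<ge> T \<Longrightarrow> \<psi> k t = 0" "\<And>k t. t \<le> - 1 \<Longrightarrow> \<psi> k t = 0"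
    "\<And>k t. t \<ge> 0 \<Longrightarrow> \<bar>\<psi> k t\<bar> \<le> 2 * exp (- c * t)"
    "\<And>t. 1 \<le> t \<Longrightarrow> t < T \<Longrightarrow> (\<lambda>k. \<psi> k t) \<longlonglongrightarrow> sgn (f t) * exp (- c * t)"
    using sgn_approximation[OF f T, of c] by blast
  obtain \<beta> where \<beta>: "mollifier \<beta>" "\<And>n. smooth (\<beta> n)" using mollifier_exists by blast
  have \<psi>c: "continuous_on S (\<psi> k)" for S k by (rule smooth_continuous_on[OF \<psi>(1)])
  define B where "B k x = source_kernel ?V1 ?V2 T (\<psi> k) x (e - x)" for k x
  have Bc: "continuous_on UNIV (B k)" for k
    unfolding B_def
    using continuous_on_compose2[OF source_kernel_continuous[OF cone_part_v1 cone_part_v2 \<psi>c, of T], of UNIV "\<lambda>x. (x, e - x)"]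
    by (simp add: continuous_on_Pair continuous_on_const continuous_on_id continuous_on_diff)
  have B0: "B k x = 0" if "w x \<ge> T" for k x
    using that source_kernel_eq_0[of T "\<psi> k", OF \<psi>(2)] by (simp add: B_def w_def)
  have id: "(LINT x|lborel. q x * B k x / P x) = 0" for k
  proof -
    have "(LINT x|lborel. (q2 (e - x) - q1 x) * source_kernel ?V1 ?V2 T (\<psi> k) x (e - x) / (norm x * norm (e - x))) = 0"
      by (rule limit_identity[OF \<psi>(1) \<psi>(2) \<psi>(3) \<beta> _ e data]) (use T in auto)
    \<comment> \<open>The reflection symmetry turns q2 (e - x) - q1 x into the difference at one and
      the same point.\<close>
    then show ?thesis by (simp add: B_def q_def P_def sym)
  qed
  have Bb: "\<bar>B k x - \<psi> k (w x) / (16 * pi\<^sup>2)\<bar> \<le> C * (exp (- c * w x) / c)" if "w x < T" for k x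
    unfolding B_def w_def C_def
    by (rule source_kernel_bound[OF cone_part_v1 cone_part_v2 \<psi>c \<psi>(4) c _ M]) (use T wT[OF that] in auto)

  \<comment> \<open>Restriction to the open ellipsoid: there the kernel estimate holds and q = f w,
    while outside B vanishes because \<psi> does.\<close>
  define \<kappa> :: "space \<Rightarrow> real" where "\<kappa> = indicator {x. w x < T}"
  have S: "open {x. w x < T}" by (intro open_Collect_less wc continuous_intros)
  have \<kappa>m: "\<kappa> \<in> borel_measurable lborel" using S by (auto simp: \<kappa>_def)
  have \<kappa>01: "\<kappa> x = (if w x < T then 1 else 0)" for x by (simp add: \<kappa>_def)
  have over: "integrable lborel (\<lambda>x. \<kappa> x * g x / P x)" if g: "continuous_on UNIV g" for g
  proof -
    have "bounded (g ` cball 0 T)" by (intro compact_imp_bounded compact_continuous_image continuous_on_subset[OF g]) auto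
    then obtain N where "\<forall>z\<in>g ` cball 0 T. norm z \<le> N" unfolding bounded_iff by blast
    then have N: "\<bar>g x\<bar> \<le> N" if "norm x \<le> T" for x using that by auto
    show ?thesis unfolding P_def
    proof (rule integrable_over_norms[OF _ _ _ e, of _ "\<bar>N\<bar>" T])
      show "(\<lambda>x. \<kappa> x * g x) \<in> borel_measurable lborel"
        using \<kappa>m borel_measurable_continuous_onI[OF g] by (intro borel_measurable_times) simp_all
      show "\<bar>\<kappa> x * g x\<bar> \<le> \<bar>N\<bar>" for x using N[of x] wT(1)[of x] by (auto simp: \<kappa>01)
      show "\<kappa> x * g x = 0" if "norm x > T" for x using wT(1)[of x] that by (auto simp: \<kappa>01)
    qed
  qed
  have \<psi>w: "continuous_on UNIV (\<lambda>x. \<psi> k (w x))" for k by (rule continuous_on_compose2[OF \<psi>c wc]) auto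
  define I where "I = (LINT x|lborel. \<kappa> x * (\<bar>q x\<bar> * exp (- c * w x)) / P x)"
  have Ii: "integrable lborel (\<lambda>x. \<kappa> x * (\<bar>q x\<bar> * exp (- c * w x)) / P x)"
    by (intro over continuous_intros qc wc)
  have I_nonneg: "I \<ge> 0" unfolding I_def by (intro integral_nonneg_AE AE_I2) (auto simp: \<kappa>01 P)
  define L where "L k = (LINT x|lborel. \<kappa> x * (q x * \<psi> k (w x)) / P x)" for k
  \<comment> \<open>Subtracting the vanishing integral of q B / P from L k / (16 pi^2) leaves only
    the kernel error, whose bound is a multiple of the integrand of I.\<close>
  have L_le: "L k \<le> 16 * pi\<^sup>2 * (C / c) * I" for k
  proof -
    have i1: "integrable lborel (\<lambda>x. \<kappa> x * (q x * \<psi> k (w x)) / P x)"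
      by (intro over continuous_intros qc \<psi>w)
    have i2: "integrable lborel (\<lambda>x. \<kappa> x * (q x * B k x) / P x)"
      by (intro over continuous_intros qc Bc)
    have "(LINT x|lborel. \<kappa> x * (q x * B k x) / P x) = (LINT x|lborel. q x * B k x / P x)"
      by (intro Bochner_Integration.integral_cong refl) (auto simp: \<kappa>01 B0)
    then have z: "(LINT x|lborel. \<kappa> x * (q x * B k x) / P x) = 0" by (simp add: id)
    have "L k / (16 * pi\<^sup>2) = (LINT x|lborel. \<kappa> x * (q x * \<psi> k (w x)) / P x / (16 * pi\<^sup>2)) - (LINT x|lborel. \<kappa> x * (q x * B k x) / P x)"
      unfolding z L_def by (simp only: integral_divide_zero diff_0_right)
    also have "\<dots> = (LINT x|lborel. \<kappa> x * (q x * \<psi> k (w x)) / P x / (16 * pi\<^sup>2) - \<kappa> x * (q x * B k x) / P x)"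
      by (intro Bochner_Integration.integral_diff[symmetric] integrable_divide i1 i2)
    also have "\<dots> \<le> (LINT x|lborel. (C / c) * (\<kappa> x * (\<bar>q x\<bar> * exp (- c * w x)) / P x))"
    proof (rule integral_mono)
      show "integrable lborel (\<lambda>x. \<kappa> x * (q x * \<psi> k (w x)) / P x / (16 * pi\<^sup>2) - \<kappa> x * (q x * B k x) / P x)"
        by (intro Bochner_Integration.integrable_diff integrable_divide i1 i2)
      show "integrable lborel (\<lambda>x. (C / c) * (\<kappa> x * (\<bar>q x\<bar> * exp (- c * w x)) / P x))"
        by (intro integrable_mult_right Ii)
      fix x
      show "\<kappa> x * (q x * \<psi> k (w x)) / P x / (16 * pi\<^sup>2) - \<kappa> x * (q x * B k x) / P x
        \<le> (C / c) * (\<kappa> x * (\<bar>q x\<bar> * exp (- c * w x)) / P x)"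
      proof (cases "w x < T")
        case True
        have "q x * (\<psi> k (w x) / (16 * pi\<^sup>2) - B k x) \<le> \<bar>q x\<bar> * \<bar>B k x - \<psi> k (w x) / (16 * pi\<^sup>2)\<bar>"
          by (metis abs_ge_self abs_minus_commute abs_mult)
        also have "\<dots> \<le> \<bar>q x\<bar> * (C * (exp (- c * w x) / c))" by (intro mult_left_mono Bb True) auto
        finally have "q x * (\<psi> k (w x) / (16 * pi\<^sup>2) - B k x) / P x \<le> \<bar>q x\<bar> * (C * (exp (- c * w x) / c)) / P x"
          by (rule divide_right_mono) (rule P)
        then show ?thesis using True by (simp add: \<kappa>01 right_diff_distrib diff_divide_distrib mult_ac)
      qed (simp add: \<kappa>01)
    qed
    also have "\<dots> = (C / c) * I" unfolding I_def by (rule integral_mult_right_zero)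
    finally show ?thesis by (simp add: divide_le_eq mult_ac)
  qed
  \<comment> \<open>The weights converge to sgn (f w) exp (- c w), and q sgn (f w) = |q| because q =
    f w; twice the limiting integrand dominates.\<close>
  have "L \<longlonglongrightarrow> I"
    unfolding L_def I_def
  proof (rule integral_dominated_convergence)
    show "(\<lambda>x. \<kappa> x * (\<bar>q x\<bar> * exp (- c * w x)) / P x) \<in> borel_measurable lborel"
      by (rule borel_measurable_integrable[OF Ii])
    show "(\<lambda>x. \<kappa> x * (q x * \<psi> k (w x)) / P x) \<in> borel_measurable lborel" for k
      by (intro borel_measurable_integrable over continuous_intros qc \<psi>w)
    show "integrable lborel (\<lambda>x. 2 * (\<kappa> x * (\<bar>q x\<bar> * exp (- c * w x)) / P x))"
      by (intro integrable_mult_right Ii)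
    show "AE x in lborel. (\<lambda>k. \<kappa> x * (q x * \<psi> k (w x)) / P x) \<longlonglongrightarrow> \<kappa> x * (\<bar>q x\<bar> * exp (- c * w x)) / P x"
    proof (rule AE_I2)
      fix x
      show "(\<lambda>k. \<kappa> x * (q x * \<psi> k (w x)) / P x) \<longlonglongrightarrow> \<kappa> x * (\<bar>q x\<bar> * exp (- c * w x)) / P x"
      proof (cases "w x < T")
        case True
        have "(\<lambda>k. \<kappa> x * (q x * \<psi> k (w x)) * inverse (P x)) \<longlonglongrightarrow> \<kappa> x * (q x * (sgn (f (w x)) * exp (- c * w x))) * inverse (P x)"
          by (intro tendsto_mult tendsto_const \<psi>(5) w1 True)
        moreover have "q x * sgn (f (w x)) = \<bar>q x\<bar>" by (simp add: qT[OF True] abs_sgn)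
        ultimately show ?thesis by (simp add: divide_inverse mult.assoc[symmetric])
      qed (simp add: \<kappa>01)
    qed
    show "AE x in lborel. norm (\<kappa> x * (q x * \<psi> k (w x)) / P x) \<le> 2 * (\<kappa> x * (\<bar>q x\<bar> * exp (- c * w x)) / P x)" for k
    proof (rule AE_I2)
      fix x
      have "\<bar>q x\<bar> * \<bar>\<psi> k (w x)\<bar> \<le> \<bar>q x\<bar> * (2 * exp (- c * w x))"
        using w1[of x] by (intro mult_left_mono \<psi>(4)) auto
      then have "\<bar>q x\<bar> * \<bar>\<psi> k (w x)\<bar> / P x \<le> \<bar>q x\<bar> * (2 * exp (- c * w x)) / P x"
        by (rule divide_right_mono) (rule P)
      then show "norm (\<kappa> x * (q x * \<psi> k (w x)) / P x) \<le> 2 * (\<kappa> x * (\<bar>q x\<bar> * exp (- c * w x)) / P x)"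
        using P[of x] by (auto simp: \<kappa>01 abs_mult mult.left_commute)
    qed
  qed
  then have "I \<le> 16 * pi\<^sup>2 * (C / c) * I" by (rule LIMSEQ_le_const2) (use L_le in auto)
  also have "\<dots> \<le> 1 / 2 * I"
  proof (rule mult_right_mono[OF _ I_nonneg])
    show "16 * pi\<^sup>2 * (C / c) \<le> 1 / 2" using c by (simp add: c_def field_simps)
  qed
  finally have "I = 0" using I_nonneg by simp
  then have "AE x in lborel. \<kappa> x * (\<bar>q x\<bar> * exp (- c * w x)) / P x = 0"
    unfolding I_def using integral_nonneg_eq_0_iff_AE[OF Ii] by (simp add: \<kappa>01 P)
  \<comment> \<open>At the foci P is 0 and the quotient is 0 by convention, so the two points are
    excluded before the positive factors are cancelled.\<close>
  then have ae: "AE x in lborel. x \<in> {x. w x < T} \<longrightarrow> q x = 0"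
    using AE_lborel_neq[of 0] AE_lborel_neq[of e] by eventually_elim (auto simp: \<kappa>01 P_def)
  have qz: "q x = 0" if "w x < T" for x
    using zero_ae_imp_zero[OF S qc ae] that by simp
  \<comment> \<open>The boundary w = T is reached by continuity along the segment from x0 towards
    e/2. There w = 1 < T, and w is convex, so w < T at every point of the sequence.\<close>
  define z where "z n = x0 + (1 / real (Suc n)) *\<^sub>R ((1 / 2) *\<^sub>R e - x0)" for n
  have "q (z n) = 0" for n
  proof (rule qz)
    let ?t = "1 / real (Suc n)"
    have t: "0 < ?t" "?t \<le> 1" by auto
    have z1: "z n = (1 - ?t) *\<^sub>R x0 + ?t *\<^sub>R ((1 / 2) *\<^sub>R e)" by (simp add: z_def algebra_simps)
    have z2: "e - z n = (1 - ?t) *\<^sub>R (e - x0) + ?t *\<^sub>R ((1 / 2) *\<^sub>R e)"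
    proof -
      have "(h + h) - (x0 + t *\<^sub>R (h - x0)) = (1 - t) *\<^sub>R ((h + h) - x0) + t *\<^sub>R h" for h t
        by (simp add: algebra_simps)
      from this[of "(1 / 2) *\<^sub>R e" ?t] show ?thesis by (simp add: z_def flip: scaleR_add_left)
    qed
    have nb: "norm ((1 - t) *\<^sub>R a + t *\<^sub>R ((1 / 2) *\<^sub>R e)) \<le> (1 - t) * norm a + t * (1 / 2)"
      if "0 < t" "t \<le> 1" for t and a :: space
      using norm_triangle_ineq[of "(1 - t) *\<^sub>R a" "t *\<^sub>R ((1 / 2) *\<^sub>R e)"] that e by simp
    have "norm (z n) \<le> (1 - ?t) * norm x0 + ?t * (1 / 2)" "norm (e - z n) \<le> (1 - ?t) * norm (e - x0) + ?t * (1 / 2)"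
      by (subst z1 z2, rule nb[OF t])+
    moreover have "p + r \<le> (1 - t) * (a + b) + t * 1"
      if "p \<le> (1 - t) * a + t * (1 / 2)" "r \<le> (1 - t) * b + t * (1 / 2)" for p r a b t :: real
      using that by (simp add: algebra_simps)
    ultimately have "w (z n) \<le> (1 - ?t) * (norm x0 + norm (e - x0)) + ?t * 1"
      unfolding w_def by blast
    also have "\<dots> \<le> (1 - ?t) * T + ?t * 1" using x0 t by (intro add_mono mult_left_mono) auto
    also have "\<dots> < (1 - ?t) * T + ?t * T" using t T by (intro add_strict_left_mono mult_strict_left_mono) auto
    also have "\<dots> = T" by (simp add: left_diff_distrib)
    finally show "w (z n) < T" .
  qed
  moreover have "z \<longlonglongrightarrow> x0 + 0 *\<^sub>R ((1 / 2) *\<^sub>R e - x0)"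
    unfolding z_def using LIMSEQ_inverse_real_of_nat by (intro tendsto_intros) (simp add: inverse_eq_divide)
  then have "(\<lambda>n. q (z n)) \<longlonglongrightarrow> q x0"
    using qc by (intro isCont_tendsto_compose[of x0 q]) (auto simp: continuous_on_eq_continuous_at)
  ultimately have "q x0 = 0" by (simp add: LIMSEQ_const_iff)
  then show ?thesis by (simp add: q_def)
qed

theorem theorem1p2:
  fixes e :: "real^3" and T \<epsilon> :: real
    and q1 q2 :: "real^3 \<Rightarrow> real"
    and a1 a2 :: "real \<Rightarrow> real"
    and u1 u2 :: functional
    and v1 v2 :: "(real^3) \<times> real \<Rightarrow> real"
  assumes e: "e = vector [1, 0, 0]"
    and T: "T > 1"
    and q1: "Ck_on 3 q1 UNIV" and q2: "Ck_on 3 q2 UNIV"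
    and \<epsilon>: "0 < \<epsilon>" "\<epsilon> < 1"
    and a1: "Ck_on 3 a1 {1 - \<epsilon><..}" and a2: "Ck_on 3 a2 {1 - \<epsilon><..}"
    and q1_a1: "\<forall>x. q1 x = a1 (norm x + norm (x - e))"
    and q2_a2: "\<forall>x. q2 x = a2 (norm x + norm (x - e))"
    and u1: "point_source_solution q1 u1" and u2: "point_source_solution q2 u2"
    and v1: "regular_part q1 u1 v1" and v2: "regular_part q2 u2 v2"
    and data: "\<forall>t\<in>{0..T}. v1 (e, t) = v2 (e, t)"
  shows "\<forall>x. norm (e - x) + norm x \<le> T \<longrightarrow> q1 x = q2 x"
proof (intro allI impI)
  fix x assume x: "norm (e - x) + norm x \<le> T"
  have "continuous_on UNIV q1" "continuous_on UNIV q2"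
    using q1 q2 unfolding numeral_3_eq_3 by (auto intro: Ck_on_Suc_continuous_on simp del: Ck_on.simps)
  then interpret point_source_pair q1 q2 u1 u2 v1 v2
    using u1 u2 v1 v2 by unfold_locales
  have "continuous_on {1 - \<epsilon><..} a1" "continuous_on {1 - \<epsilon><..} a2"
    using a1 a2 unfolding numeral_3_eq_3 by (auto intro: Ck_on_Suc_continuous_on simp del: Ck_on.simps)
  then have "continuous_on {1 - \<epsilon><..} (\<lambda>t. a2 t - a1 t)" by (intro continuous_intros)
  \<comment> \<open>|x| + |x - e| takes values from |e| = 1 on, and 1 lies inside the domain of a1
    and a2 because \<epsilon> > 0.\<close>
  then have f: "continuous_on {1..T} (\<lambda>t. a2 t - a1 t)" by (rule continuous_on_subset) (use \<epsilon> in auto)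
  have "norm e = 1"
    unfolding e norm_vec_def L2_set_def by (simp add: sum_3)
  \<comment> \<open>Replacing x by e - x merely exchanges the two distances, which gives the
    reflection symmetry of q2; f is a2 - a1.\<close>
  then show "q1 x = q2 x"
    using ellipsoidal_uniqueness[OF _ T f, of e x] q1_a1 q2_a2 data x
    by (simp add: norm_minus_commute add.commute)
qed

end
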